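(* Let $(\mathcal{D},+)$ be a nonempty abelian semigroup and $\mathrm{wt}:\mathcal{D}\to\mathbb{N}_{>0}$ a map, inducing a graduation of $\mathcal{H}_{\mathcal{G}(\mathcal{D})}$. There exists a morphism $\Phi_1:\mathcal{H}_{\mathcal{G}(\mathcal{D})}\to\mathrm{QSym}$ such that: \begin{enumerate} \item $\Phi_1:(\mathcal{H}_{\mathcal{G}(\mathcal{D})},m,\Delta)\to(\mathrm{QSym},m,\Delta)$ is a homogeneous morphism of Hopf algebras, \item $\Phi_1:(\mathcal{H}_{\mathcal{G}(\mathcal{D})},m,\delta)\to(\mathrm{QSym},m,\delta)$ is a morphism of bialgebras, \end{enumerate} if, and only if, $\mathrm{wt}:(\mathcal{D},+)\to(\mathbb{N}_{>0},+)$ is a semigroup morphism. If so, $\Phi_1=F_{chr}^{(\mathcal{D})}$ (and therefore $\Phi_1$ is unique), where $F_{chr}^{(\mathcal{D})}$ is the linear map defined on any $\mathcal{D}$-decorated graph $G$ by $$F_{chr}^{(\mathcal{D})}(G)=\sum_{f\in\mathbb{PVC}(G)}M_{\mathrm{wt}(f^{-1}(1)),\ldots,\mathrm{wt}(f^{-1}(\max(f)))}.$$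
   Context: A graph is a pair $G=(V(G),E(G))$ with $V(G)$ a finite set and $E(G)$ a set of $2$-element subsets of $V(G)$; the empty graph is considered as non connected. A $\mathcal{D}$-decorated graph is a graph with a map $d_G:V(G)\to\mathcal{D}$, considered up to decoration-preserving isomorphism. For $I\subseteq V(G)$, $G_{|I}$ is the induced subgraph, decorated by restriction. For an equivalence relation $\sim$ on $V(G)$: $G/\sim$ is the graph with vertex set $V(G)/\sim$ and with an edge between two distinct classes if and only if some edge of $G$ joins them, decorated by $d_{G/\sim}(c)=\sum_{x\in c}d_G(x)$; $G|\sim$ has vertex set $V(G)$, edges $\{x,y\}\in E(G)$ with $x\sim y$, and decoration $d_G$; $\sim\triangleleft G$ means that $G_{|c}$ is connected for every class $c$ of $\sim$. $\mathcal{H}_{\mathcal{G}(\mathcal{D})}$ is the $\mathbb{Q}$-vector space with basis the isoclasses of $\mathcal{D}$-decorated graphs, with product $m$ the disjoint union, and coproducts $\Delta(G)=\sum_{V(G)=I\sqcup J}G_{|I}\otimes G_{|J}$ and $\delta(G)=\sum_{\sim\triangleleft G}(G/\sim)\otimes(G|\sim)$. $(\mathcal{H}_{\mathcal{G}(\mathcal{D})},m,\Delta)$ is a Hopf algebra, graded by $\mathrm{wt}(G)=\sum_{x\in V(G)}\mathrm{wt}(d_G(x))$; $(\mathcal{H}_{\mathcal{G}(\mathcal{D})},m,\delta)$ is a bialgebra, with counit sending graphs without edges to $1$ and other graphs to $0$. $\mathbb{PVC}(G)$ is the set of packed valid colorings of $G$: maps $f:V(G)\to\mathbb{N}_{>0}$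 such that $f(V(G))=\{1,\ldots,k\}$ for some $k\geq0$ (with $k=\max(f)$) and $f(x)\neq f(y)$ for any edge $\{x,y\}$. For such $f$, $\mathrm{wt}(f^{-1}(i))=\sum_{x\in V(G),\,f(x)=i}\mathrm{wt}(d_G(x))$. $\mathrm{QSym}$ is the $\mathbb{Q}$-vector space with basis $(M_u)$ indexed by compositions $u$ (finite, possibly empty, sequences of positive integers), graded by the sum $|u|$ of the letters. Its product $m$ is the quasi-shuffle product, i.e. the product such that, for an infinite totally ordered alphabet $\mathbf{X}$ of commuting variables, $M_{u_1,\ldots,u_n}\mapsto\sum_{x_1<\cdots<x_n\text{ in }\mathbf{X}}x_1^{u_1}\cdots x_n^{u_n}$ defines an (injective) algebra morphism to formal power series. Its coproducts are $\Delta(M_w)=\sum_{uv=w}M_u\otimes M_v$ and, for $w$ of length $n\geq1$, $\delta(M_w)=\sum_{k=1}^n\sum_{w=w_1\cdots w_k}M_{|w_1|,\ldots,|w_k|}\otimes M_{w_1}\cdots M_{w_k}$ (factorizations into nonempty compositions), with $\delta(1)=1\otimes1$; the counit of $\delta$ sends $M_u$ to $1$ if $u$ has at most one letter and to $0$ otherwise. Bialgebra morphisms preserve units and counits. *)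

theory Defs
  imports Complex_Main "HOL-Library.Poly_Mapping" "HOL-Library.Multiset" "HOL-Library.FuncSet"
begin

section \<open>Rational vector spaces with a distinguished basis\<close>

text \<open>
  The \<open>\<rat>\<close>-vector space with basis \<open>'a\<close> is \<open>'a \<Rightarrow>\<^sub>0 rat\<close>, and the tensor product of the spaces with
  bases \<open>'a\<close> and \<open>'b\<close> is the space with basis \<open>'a \<times> 'b\<close>.  The ring multiplication that
  the library puts on \<open>'a \<Rightarrow>\<^sub>0 rat\<close> is not used.
\<close>

definition scale :: "rat \<Rightarrow> ('a \<Rightarrow>\<^sub>0 rat) \<Rightarrow> ('a \<Rightarrow>\<^sub>0 rat)"
  where "scale c x = Poly_Mapping.map ((*) c) x"

lemma lookup_scale [simp]: "Poly_Mapping.lookup (scale c x) a = c * Poly_Mapping.lookup x a"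
  unfolding scale_def by (simp add: map.rep_eq when_def)

global_interpretation free_vs: vector_space "scale :: rat \<Rightarrow> ('a \<Rightarrow>\<^sub>0 rat) \<Rightarrow> _"
  by unfold_locales (auto intro!: poly_mapping_eqI simp: lookup_add algebra_simps)

definition basis :: "'a \<Rightarrow> ('a \<Rightarrow>\<^sub>0 rat)"
  where "basis a = Poly_Mapping.single a 1"

definition lin_ext :: "('a \<Rightarrow> ('b \<Rightarrow>\<^sub>0 rat)) \<Rightarrow> ('a \<Rightarrow>\<^sub>0 rat) \<Rightarrow> ('b \<Rightarrow>\<^sub>0 rat)"
  where "lin_ext f x = (\<Sum>a\<in>Poly_Mapping.keys x. scale (Poly_Mapping.lookup x a) (f a))"

definition bilin_ext ::
    "('a \<Rightarrow> 'b \<Rightarrow> ('c \<Rightarrow>\<^sub>0 rat)) \<Rightarrow> ('a \<Rightarrow>\<^sub>0 rat) \<Rightarrow> ('b \<Rightarrow>\<^sub>0 rat) \<Rightarrow> ('c \<Rightarrow>\<^sub>0 rat)"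
  where "bilin_ext f x y = lin_ext (\<lambda>a. lin_ext (f a) y) x"

definition form_ext :: "('a \<Rightarrow> rat) \<Rightarrow> ('a \<Rightarrow>\<^sub>0 rat) \<Rightarrow> rat"
  where "form_ext f x = (\<Sum>a\<in>Poly_Mapping.keys x. Poly_Mapping.lookup x a * f a)"

definition tensor :: "('a \<Rightarrow>\<^sub>0 rat) \<Rightarrow> ('b \<Rightarrow>\<^sub>0 rat) \<Rightarrow> ('a \<times> 'b \<Rightarrow>\<^sub>0 rat)"
  where "tensor = bilin_ext (\<lambda>a b. basis (a, b))"

definition tensor_map ::
    "(('a \<Rightarrow>\<^sub>0 rat) \<Rightarrow> ('c \<Rightarrow>\<^sub>0 rat)) \<Rightarrow> (('b \<Rightarrow>\<^sub>0 rat) \<Rightarrow> ('d \<Rightarrow>\<^sub>0 rat)) \<Rightarrow>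
     ('a \<times> 'b \<Rightarrow>\<^sub>0 rat) \<Rightarrow> ('c \<times> 'd \<Rightarrow>\<^sub>0 rat)"
  where "tensor_map f g = lin_ext (\<lambda>(a, b). tensor (f (basis a)) (g (basis b)))"

definition homogeneous_component :: "('a \<Rightarrow> nat) \<Rightarrow> nat \<Rightarrow> ('a \<Rightarrow>\<^sub>0 rat) set"
  where "homogeneous_component deg n = {x. \<forall>a\<in>Poly_Mapping.keys x. deg a = n}"

definition homogeneous_map ::
    "('a \<Rightarrow> nat) \<Rightarrow> ('b \<Rightarrow> nat) \<Rightarrow> (('a \<Rightarrow>\<^sub>0 rat) \<Rightarrow> ('b \<Rightarrow>\<^sub>0 rat)) \<Rightarrow> bool"
  where "homogeneous_map degA degB \<Phi> \<longleftrightarrow>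
    (\<forall>n. \<Phi> ` homogeneous_component degA n \<subseteq> homogeneous_component degB n)"

record 'a bialgebra =
  mult :: "('a \<Rightarrow>\<^sub>0 rat) \<Rightarrow> ('a \<Rightarrow>\<^sub>0 rat) \<Rightarrow> ('a \<Rightarrow>\<^sub>0 rat)"
  unit :: "'a \<Rightarrow>\<^sub>0 rat"
  comult :: "('a \<Rightarrow>\<^sub>0 rat) \<Rightarrow> ('a \<times> 'a \<Rightarrow>\<^sub>0 rat)"
  counit :: "('a \<Rightarrow>\<^sub>0 rat) \<Rightarrow> rat"

text \<open>
  A morphism of Hopf algebras is a morphism of the underlying bialgebras; such a map automatically
  commutes with the antipodes.
\<close>

definition bialgebra_morphism ::
    "'a bialgebra \<Rightarrow> 'b bialgebra \<Rightarrow> (('a \<Rightarrow>\<^sub>0 rat) \<Rightarrow> ('b \<Rightarrow>\<^sub>0 rat)) \<Rightarrow> bool"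
  where "bialgebra_morphism A B \<Phi> \<longleftrightarrow>
    Vector_Spaces.linear scale scale \<Phi> \<and>
    \<Phi> (unit A) = unit B \<and>
    (\<forall>x y. \<Phi> (mult A x y) = mult B (\<Phi> x) (\<Phi> y)) \<and>
    (\<forall>x. counit B (\<Phi> x) = counit A x) \<and>
    (\<forall>x. comult B (\<Phi> x) = tensor_map \<Phi> \<Phi> (comult A x))"


section \<open>Sums in a commutative semigroup\<close>

text \<open>
  A semigroup need not have a zero, so \<open>sum\<close> is not available; only sums over nonempty finite sets
  are meaningful.  The accumulator \<open>None\<close> stands for the empty sum.
\<close>

definition semigroup_sum :: "('v \<Rightarrow> 'd::ab_semigroup_add) \<Rightarrow> 'v set \<Rightarrow> 'd"
  where "semigroup_sum d c =
    the (Finite_Set.fold (\<lambda>x acc. Some (case acc of None \<Rightarrow> d x | Some s \<Rightarrow> d x + s)) None c)"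

context
begin

private definition step :: "('v \<Rightarrow> 'd::ab_semigroup_add) \<Rightarrow> 'v \<Rightarrow> 'd option \<Rightarrow> 'd option"
  where "step d x acc = Some (case acc of None \<Rightarrow> d x | Some s \<Rightarrow> d x + s)"

private lemma semigroup_sum_step: "semigroup_sum d c = the (Finite_Set.fold (step d) None c)"
  unfolding semigroup_sum_def step_def by simp

private lemma comp_step: "comp_fun_commute (step d)"
  by unfold_locales (auto simp: step_def fun_eq_iff ac_simps split: option.split)

private lemma fold_step_insert:
  assumes "finite c" "x \<notin> c"
  shows "Finite_Set.fold (step d) None (insert x c) = step d x (Finite_Set.fold (step d) None c)"
proof -
  interpret comp_fun_commute "step d" by (rule comp_step)
  show ?thesis using assms by (rule fold_insert)
qed

lemma semigroup_sum_singleton [simp]: "semigroup_sum d {x} = d x"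
  using fold_step_insert[of "{}" x d] by (simp add: semigroup_sum_step step_def)

private lemma fold_step_Some:
  assumes "finite c" "c \<noteq> {}"
  shows "Finite_Set.fold (step d) None c \<noteq> None"
proof -
  from assms(2) obtain x where "x \<in> c" by auto
  then obtain B where B: "c = insert x B" "x \<notin> B" using mk_disjoint_insert by metis
  with assms have "finite B" by simp
  then show ?thesis unfolding B(1) fold_step_insert[OF \<open>finite B\<close> B(2)] by (simp add: step_def)
qed

lemma semigroup_sum_insert:
  assumes "finite c" "c \<noteq> {}" "x \<notin> c"
  shows "semigroup_sum d (insert x c) = d x + semigroup_sum d c"
proof -
  obtain s where "Finite_Set.fold (step d) None c = Some s"
    using fold_step_Some[OF assms(1,2), of d] by auto
  then show ?thesis
    unfolding semigroup_sum_step fold_step_insert[OF assms(1,3), of d] by (simp add: step_def)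
qed

end

lemma semigroup_sum_image:
  assumes "finite c" "c \<noteq> {}" "inj_on \<phi> c" "\<And>x. x \<in> c \<Longrightarrow> d' (\<phi> x) = d x"
  shows "semigroup_sum d' (\<phi> ` c) = semigroup_sum d c"
  using assms
proof (induction c rule: finite_ne_induct)
  case (insert x F)
  then have "\<phi> x \<notin> \<phi> ` F" by auto
  with insert show ?case by (simp add: semigroup_sum_insert)
qed simp


section \<open>Decorated graphs\<close>

record ('v, 'd) dgraph =
  verts :: "'v set"
  edges :: "'v set set"
  dec :: "'v \<Rightarrow> 'd"

definition wf_graph :: "('v, 'd) dgraph \<Rightarrow> bool"
  where "wf_graph G \<longleftrightarrow> finite (verts G) \<and> (\<forall>e\<in>edges G. e \<subseteq> verts G \<and> card e = 2)"

definition iso_via :: "('v \<Rightarrow> 'w) \<Rightarrow> ('v, 'd) dgraph \<Rightarrow> ('w, 'd) dgraph \<Rightarrow> bool"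
  where "iso_via \<phi> G H \<longleftrightarrow>
    bij_betw \<phi> (verts G) (verts H) \<and>
    edges H = (`) \<phi> ` edges G \<and>
    (\<forall>x\<in>verts G. dec H (\<phi> x) = dec G x)"

definition isomorphic :: "('v, 'd) dgraph \<Rightarrow> ('w, 'd) dgraph \<Rightarrow> bool"
  where "isomorphic G H \<longleftrightarrow> wf_graph G \<and> wf_graph H \<and> (\<exists>\<phi>. iso_via \<phi> G H)"

definition empty_graph :: "('v, 'd) dgraph"
  where "empty_graph = \<lparr>verts = {}, edges = {}, dec = (\<lambda>_. undefined)\<rparr>"

definition disjoint_union :: "('v, 'd) dgraph \<Rightarrow> ('w, 'd) dgraph \<Rightarrow> ('v + 'w, 'd) dgraph"
  where "disjoint_union G H =
    \<lparr>verts = verts G <+> verts H,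
     edges = (`) Inl ` edges G \<union> (`) Inr ` edges H,
     dec = case_sum (dec G) (dec H)\<rparr>"

definition induced :: "('v, 'd) dgraph \<Rightarrow> 'v set \<Rightarrow> ('v, 'd) dgraph"
  where "induced G I = \<lparr>verts = I, edges = {e \<in> edges G. e \<subseteq> I}, dec = dec G\<rparr>"

definition connected_graph :: "('v, 'd) dgraph \<Rightarrow> bool"
  where "connected_graph G \<longleftrightarrow>
    verts G \<noteq> {} \<and> (\<forall>x\<in>verts G. \<forall>y\<in>verts G. (x, y) \<in> {(a, b). {a, b} \<in> edges G}\<^sup>*)"

definition quotient_graph :: "('v, 'd::ab_semigroup_add) dgraph \<Rightarrow> ('v \<times> 'v) set \<Rightarrow> ('v set, 'd) dgraph"
  where "quotient_graph G r =
    \<lparr>verts = verts G // r,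
     edges = {{c, c'} | c c'. c \<in> verts G // r \<and> c' \<in> verts G // r \<and> c \<noteq> c' \<and>
                (\<exists>x\<in>c. \<exists>y\<in>c'. {x, y} \<in> edges G)},
     dec = semigroup_sum (dec G)\<rparr>"

definition restrict_graph :: "('v, 'd) dgraph \<Rightarrow> ('v \<times> 'v) set \<Rightarrow> ('v, 'd) dgraph"
  where "restrict_graph G r =
    \<lparr>verts = verts G, edges = {{x, y} | x y. {x, y} \<in> edges G \<and> (x, y) \<in> r}, dec = dec G\<rparr>"

definition connected_equivs :: "('v, 'd) dgraph \<Rightarrow> ('v \<times> 'v) set set"
  where "connected_equivs G =
    {r. equiv (verts G) r \<and> (\<forall>c\<in>verts G // r. connected_graph (induced G c))}"

text \<open>
  Colorings are taken extensional, so that they are determined by their values on the vertices.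
\<close>

definition packed_valid_colorings :: "('v, 'd) dgraph \<Rightarrow> ('v \<Rightarrow> nat) set"
  where "packed_valid_colorings G =
    {f \<in> verts G \<rightarrow>\<^sub>E {1..}. (\<exists>k. f ` verts G = {1..k}) \<and>
       (\<forall>x y. {x, y} \<in> edges G \<longrightarrow> f x \<noteq> f y)}"


section \<open>Isomorphism classes of decorated graphs\<close>

lemma iso_via_id: "iso_via (\<lambda>x. x) G G"
  by (auto simp: iso_via_def bij_betw_def)

lemma isomorphic_refl: "wf_graph G \<Longrightarrow> isomorphic G G"
  using iso_via_id by (auto simp: isomorphic_def)

lemma iso_via_comp: "iso_via \<phi> G H \<Longrightarrow> iso_via \<psi> H K \<Longrightarrow> iso_via (\<psi> \<circ> \<phi>) G K"
  by (auto simp: iso_via_def bij_betw_trans image_comp bij_betw_apply fun_eq_iff)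

lemma isomorphic_trans: "isomorphic G H \<Longrightarrow> isomorphic H K \<Longrightarrow> isomorphic G K"
  using iso_via_comp by (fastforce simp: isomorphic_def)

lemma iso_via_sym:
  assumes "iso_via \<phi> G H" "wf_graph G"
  shows "iso_via (the_inv_into (verts G) \<phi>) H G"
proof -
  let ?\<psi> = "the_inv_into (verts G) \<phi>"
  have bij: "bij_betw \<phi> (verts G) (verts H)" using assms by (simp add: iso_via_def)
  then have inj: "inj_on \<phi> (verts G)" by (simp add: bij_betw_def)
  have inv: "?\<psi> ` \<phi> ` e = e" if "e \<in> edges G" for e
  proof -
    have "e \<subseteq> verts G" using that assms by (auto simp: wf_graph_def)
    then have "\<And>x. x \<in> e \<Longrightarrow> ?\<psi> (\<phi> x) = x" using inj by (auto intro: the_inv_into_f_f)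
    then show ?thesis by (auto simp: image_comp image_iff)
  qed
  have "edges G = (`) ?\<psi> ` edges H"
    using assms inv by (force simp: iso_via_def image_comp)
  moreover have "\<forall>y\<in>verts H. dec G (?\<psi> y) = dec H y"
  proof
    fix y assume "y \<in> verts H"
    then obtain x where "x \<in> verts G" "y = \<phi> x" using bij by (auto simp: bij_betw_def)
    then show "dec G (?\<psi> y) = dec H y"
      using assms inj by (simp add: iso_via_def the_inv_into_f_f)
  qed
  ultimately show ?thesis using bij by (simp add: iso_via_def bij_betw_the_inv_into)
qed

lemma isomorphic_sym: "isomorphic G H \<Longrightarrow> isomorphic H G"
  using iso_via_sym by (fastforce simp: isomorphic_def)

lemma iso_via_wf:
  assumes "iso_via \<phi> G H" "wf_graph G"
  shows "wf_graph H"
proof -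
  have bij: "bij_betw \<phi> (verts G) (verts H)" using assms by (simp add: iso_via_def)
  then have inj: "inj_on \<phi> (verts G)" and im: "\<phi> ` verts G = verts H" by (auto simp: bij_betw_def)
  have "\<phi> ` e \<subseteq> verts H \<and> card (\<phi> ` e) = 2" if "e \<in> edges G" for e
  proof -
    have "e \<subseteq> verts G" "card e = 2" using that assms by (auto simp: wf_graph_def)
    then show ?thesis using inj im by (auto simp: card_image inj_on_subset)
  qed
  then show ?thesis
    using assms im[symmetric] by (auto simp: wf_graph_def iso_via_def)
qed

lemma isomorphicI: "iso_via \<phi> G H \<Longrightarrow> wf_graph G \<Longrightarrow> isomorphic G H"
  using iso_via_wf by (auto simp: isomorphic_def)

text \<open>
  Every finite graph is isomorphic to one whose vertices are natural numbers, so isoclasses are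
  represented by such graphs; \<open>iclass G\<close> is the isoclass of a graph on an arbitrary vertex type.
\<close>

quotient_type 'd iso_graph = "(nat, 'd) dgraph" / partial: isomorphic
  by (rule part_equivpI)
     (auto simp: symp_def transp_def intro: isomorphic_sym isomorphic_trans
       intro!: exI[of _ empty_graph] isomorphic_refl, simp add: wf_graph_def empty_graph_def)

definition iclass :: "('v, 'd) dgraph \<Rightarrow> 'd iso_graph"
  where "iclass G = abs_iso_graph (SOME H. isomorphic G H)"

lemma nat_graph_exists:
  assumes "wf_graph (G :: ('v, 'd) dgraph)"
  shows "\<exists>H :: (nat, 'd) dgraph. isomorphic G H"
proof -
  have "finite (verts G)" using assms by (simp add: wf_graph_def)
  then obtain \<phi> :: "'v \<Rightarrow> nat" where inj: "inj_on \<phi> (verts G)"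
    using finite_imp_inj_to_nat_seg by blast
  let ?H = "\<lparr>verts = \<phi> ` verts G, edges = (`) \<phi> ` edges G,
             dec = dec G \<circ> the_inv_into (verts G) \<phi>\<rparr>"
  have "iso_via \<phi> G ?H"
    using inj by (simp add: iso_via_def bij_betw_def the_inv_into_f_f)
  then show ?thesis using assms isomorphicI by blast
qed

lemma iclass_eq:
  fixes G :: "('v, 'd) dgraph" and H :: "('w, 'd) dgraph"
  assumes "isomorphic G H"
  shows "iclass G = iclass H"
proof -
  have "isomorphic G = (isomorphic H :: (nat, 'd) dgraph \<Rightarrow> bool)"
  proof
    fix K :: "(nat, 'd) dgraph"
    show "isomorphic G K = isomorphic H K"
      using isomorphic_trans[OF assms, of K] isomorphic_trans[OF isomorphic_sym[OF assms], of K]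
      by blast
  qed
  then show ?thesis by (simp add: iclass_def)
qed

lemma iclass_nat:
  assumes "wf_graph G"
  shows "iclass G = abs_iso_graph G"
proof -
  have "isomorphic G (SOME H :: (nat, 'a) dgraph. isomorphic G H)"
    using nat_graph_exists[OF assms] by (rule someI_ex)
  then show ?thesis
    unfolding iclass_def using Quotient3_rel_abs[OF Quotient3_iso_graph] isomorphic_sym by metis
qed

lemma iclass_eq_iff:
  assumes "wf_graph G" "wf_graph H"
  shows "iclass G = iclass H \<longleftrightarrow> isomorphic G H"
proof
  assume eq: "iclass G = iclass H"
  have G: "isomorphic G (SOME K :: (nat, 'b) dgraph. isomorphic G K)"
    using nat_graph_exists[OF assms(1)] by (rule someI_ex)
  have H: "isomorphic H (SOME K :: (nat, 'b) dgraph. isomorphic H K)"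
    using nat_graph_exists[OF assms(2)] by (rule someI_ex)
  have "isomorphic (SOME K :: (nat, 'b) dgraph. isomorphic G K)
                   (SOME K :: (nat, 'b) dgraph. isomorphic H K)"
    using eq G H assms unfolding iclass_def
    by (metis Quotient3_rel[OF Quotient3_iso_graph] isomorphic_refl isomorphic_def)
  then show "isomorphic G H"
    using G H isomorphic_sym isomorphic_trans by metis
qed (rule iclass_eq)


section \<open>The bialgebras of decorated graphs\<close>

lemma wf_empty_graph: "wf_graph empty_graph"
  by (simp add: wf_graph_def empty_graph_def)

lemma wf_disjoint_union: "wf_graph G \<Longrightarrow> wf_graph H \<Longrightarrow> wf_graph (disjoint_union G H)"
  by (auto simp: wf_graph_def disjoint_union_def card_image)

lemma wf_induced: "wf_graph G \<Longrightarrow> I \<subseteq> verts G \<Longrightarrow> wf_graph (induced G I)"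
  by (auto simp: wf_graph_def induced_def intro: finite_subset)

lemma wf_restrict_graph: "wf_graph G \<Longrightarrow> wf_graph (restrict_graph G r)"
  by (auto simp: wf_graph_def restrict_graph_def)

lemma wf_quotient_graph: "wf_graph G \<Longrightarrow> equiv (verts G) r \<Longrightarrow> wf_graph (quotient_graph G r)"
  by (auto simp: wf_graph_def quotient_graph_def equiv_def card_2_iff intro: finite_quotient)

lemma iso_via_disjoint_union:
  assumes "iso_via \<phi> G G'" "iso_via \<psi> H H'"
  shows "iso_via (map_sum \<phi> \<psi>) (disjoint_union G H) (disjoint_union G' H')"
proof -
  have "bij_betw (map_sum \<phi> \<psi>) (verts G <+> verts H) (verts G' <+> verts H')"
    unfolding bij_betw_def
  proof
    have inj: "inj_on \<phi> (verts G)" "inj_on \<psi> (verts H)"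
      and im: "verts G' = \<phi> ` verts G" "verts H' = \<psi> ` verts H"
      using assms by (simp_all add: iso_via_def bij_betw_def)
    show "inj_on (map_sum \<phi> \<psi>) (verts G <+> verts H)"
      using inj by (auto intro!: inj_onI dest: inj_onD)
    show "map_sum \<phi> \<psi> ` (verts G <+> verts H) = verts G' <+> verts H'"
      unfolding im Plus_def by (simp add: image_Un image_comp comp_def)
  qed
  moreover have "(`) (map_sum \<phi> \<psi>) ` ((`) Inl ` edges G \<union> (`) Inr ` edges H) =
      (`) Inl ` edges G' \<union> (`) Inr ` edges H'"
    using assms by (simp add: iso_via_def image_Un image_comp comp_def)
  ultimately show ?thesis
    using assms by (auto simp: iso_via_def disjoint_union_def)
qed

lemma iso_via_induced:
  assumes "iso_via \<phi> G H" "wf_graph G" "I \<subseteq> verts G"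
  shows "iso_via \<phi> (induced G I) (induced H (\<phi> ` I))"
proof -
  have inj: "inj_on \<phi> (verts G)" using assms by (simp add: iso_via_def bij_betw_def)
  have "\<phi> ` e \<subseteq> \<phi> ` I \<longleftrightarrow> e \<subseteq> I" if "e \<in> edges G" for e
  proof -
    have "e \<subseteq> verts G" using that assms by (auto simp: wf_graph_def)
    then show ?thesis using inj_on_image_mem_iff[OF inj _ assms(3)] by blast
  qed
  then have "{e \<in> (`) \<phi> ` edges G. e \<subseteq> \<phi> ` I} = (`) \<phi> ` {e \<in> edges G. e \<subseteq> I}"
    by auto
  then show ?thesis
    using assms inj by (auto simp: iso_via_def induced_def bij_betw_def intro: inj_on_subset)
qed

lemma edge_iso_iff:
  assumes "iso_via \<phi> G H" "wf_graph G" "x \<in> verts G" "y \<in> verts G"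
  shows "{\<phi> x, \<phi> y} \<in> edges H \<longleftrightarrow> {x, y} \<in> edges G"
proof -
  have inj: "inj_on \<phi> (verts G)" using assms by (simp add: iso_via_def bij_betw_def)
  have "e = {x, y}" if "e \<in> edges G" "{\<phi> x, \<phi> y} = \<phi> ` e" for e
  proof -
    have "e \<subseteq> verts G" using that assms by (auto simp: wf_graph_def)
    moreover have "\<phi> ` {x, y} = \<phi> ` e" using that by simp
    ultimately show ?thesis using inj assms by (metis empty_subsetI inj_on_image_eq_iff insert_subset)
  qed
  then show ?thesis using assms by (auto simp: iso_via_def intro!: image_eqI[of _ _ "{x, y}"])
qed

lemma connected_graph_iso:
  assumes "iso_via \<phi> G H" "wf_graph G" "connected_graph G"
  shows "connected_graph H"
proof -
  have V: "verts H = \<phi> ` verts G" using assms by (auto simp: iso_via_def bij_betw_def)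
  have *: "(\<phi> x, \<phi> y) \<in> {(a, b). {a, b} \<in> edges H}\<^sup>*"
    if "(x, y) \<in> {(a, b). {a, b} \<in> edges G}\<^sup>*" for x y
    using that
  proof (induction rule: rtrancl_induct)
    case (step y z)
    then have "{y, z} \<in> edges G" by simp
    then have "\<phi> ` {y, z} \<in> edges H" using assms unfolding iso_via_def by (metis imageI)
    then show ?case using step.IH by (simp add: rtrancl.rtrancl_into_rtrancl)
  qed simp
  then show ?thesis using assms(3) by (auto simp: connected_graph_def V)
qed

definition transport :: "('v \<Rightarrow> 'w) \<Rightarrow> ('v \<times> 'v) set \<Rightarrow> ('w \<times> 'w) set"
  where "transport \<phi> r = map_prod \<phi> \<phi> ` r"

lemma transport_iff:
  assumes "inj_on \<phi> V" "r \<subseteq> V \<times> V" "x \<in> V" "y \<in> V"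
  shows "(\<phi> x, \<phi> y) \<in> transport \<phi> r \<longleftrightarrow> (x, y) \<in> r"
proof
  assume "(\<phi> x, \<phi> y) \<in> transport \<phi> r"
  then obtain a b where "(a, b) \<in> r" "\<phi> x = \<phi> a" "\<phi> y = \<phi> b" by (auto simp: transport_def)
  moreover from this assms have "a \<in> V" "b \<in> V" by auto
  ultimately show "(x, y) \<in> r" using assms by (metis inj_onD)
qed (force simp: transport_def)

lemma equiv_transport:
  assumes "bij_betw \<phi> V W" "equiv V r"
  shows "equiv W (transport \<phi> r)"
proof -
  have inj: "inj_on \<phi> V" and W: "W = \<phi> ` V" using assms by (auto simp: bij_betw_def)
  have r: "r \<subseteq> V \<times> V" "refl_on V r" "sym r" "trans r" using assms(2) by (auto simp: equiv_def)
  show ?thesis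
  proof (rule equivI)
    show sub: "transport \<phi> r \<subseteq> W \<times> W" using r by (auto simp: transport_def W)
    show "refl_on W (transport \<phi> r)" using r by (force simp: transport_def W refl_on_def)
    show "sym (transport \<phi> r)" using r by (force simp: transport_def sym_def)
    show "trans (transport \<phi> r)"
    proof (rule transI)
      fix a b c assume *: "(a, b) \<in> transport \<phi> r" "(b, c) \<in> transport \<phi> r"
      then obtain x y z where "x \<in> V" "y \<in> V" "z \<in> V" "a = \<phi> x" "b = \<phi> y" "c = \<phi> z"
        using sub W by blast
      then show "(a, c) \<in> transport \<phi> r"
        using * transport_iff[OF inj r(1)] r(4) by (metis transD)
    qed
  qed
qed

lemma quotient_transport:
  assumes "bij_betw \<phi> V W" "equiv V r"
  shows "W // transport \<phi> r = (`) \<phi> ` (V // r)"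
proof -
  have inj: "inj_on \<phi> V" and W: "W = \<phi> ` V" using assms by (auto simp: bij_betw_def)
  have r: "r \<subseteq> V \<times> V" using assms(2) by (auto simp: equiv_def)
  have "transport \<phi> r `` {\<phi> x} = \<phi> ` (r `` {x})" if "x \<in> V" for x
  proof
    show "transport \<phi> r `` {\<phi> x} \<subseteq> \<phi> ` (r `` {x})"
      using r inj that by (auto simp: transport_def inj_on_def; blast)
    show "\<phi> ` (r `` {x}) \<subseteq> transport \<phi> r `` {\<phi> x}"
      by (force simp: transport_def)
  qed
  then show ?thesis unfolding quotient_def W by auto
qed

lemma iso_via_restrict_graph:
  assumes "iso_via \<phi> G H" "wf_graph G" "equiv (verts G) r"
  shows "iso_via \<phi> (restrict_graph G r) (restrict_graph H (transport \<phi> r))"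
proof -
  have inj: "inj_on \<phi> (verts G)" using assms by (simp add: iso_via_def bij_betw_def)
  have r: "r \<subseteq> verts G \<times> verts G" using assms(3) by (auto simp: equiv_def)
  have 1: "{\<phi> x, \<phi> y} \<in> edges H \<longleftrightarrow> {x, y} \<in> edges G" if "(x, y) \<in> r" for x y
    using edge_iso_iff[OF assms(1,2), of x y] r that by auto
  have "{{x, y} | x y. {x, y} \<in> edges H \<and> (x, y) \<in> transport \<phi> r} =
        (`) \<phi> ` {{x, y} | x y. {x, y} \<in> edges G \<and> (x, y) \<in> r}" (is "?L = ?R")
  proof
    show "?L \<subseteq> ?R"
    proof
      fix e assume "e \<in> ?L"
      then obtain x y where xy: "e = {\<phi> x, \<phi> y}" "e \<in> edges H" "(x, y) \<in> r"
        by (auto simp: transport_def)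
      then have "{x, y} \<in> {{x, y} | x y. {x, y} \<in> edges G \<and> (x, y) \<in> r}" using 1 by blast
      then have "\<phi> ` {x, y} \<in> ?R" by (rule imageI)
      then show "e \<in> ?R" using xy(1) by simp
    qed
    show "?R \<subseteq> ?L"
    proof
      fix e assume "e \<in> ?R"
      then obtain x y where "e = {\<phi> x, \<phi> y}" "{x, y} \<in> edges G" "(x, y) \<in> r" by auto
      moreover from this have "(\<phi> x, \<phi> y) \<in> transport \<phi> r" by (force simp: transport_def)
      ultimately show "e \<in> ?L" using 1 by blast
    qed
  qed
  then show ?thesis using assms(1) by (simp add: iso_via_def restrict_graph_def)
qed

lemma iso_via_quotient_graph:
  assumes "iso_via \<phi> G H" "wf_graph G" "equiv (verts G) r"
  shows "iso_via ((`) \<phi>) (quotient_graph G r) (quotient_graph H (transport \<phi> r))"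
proof -
  have bij: "bij_betw \<phi> (verts G) (verts H)" using assms by (simp add: iso_via_def)
  then have inj: "inj_on \<phi> (verts G)" by (simp add: bij_betw_def)
  let ?Q = "verts G // r" and ?Q' = "verts H // transport \<phi> r"
  have Q': "?Q' = (`) \<phi> ` ?Q" using quotient_transport[OF bij assms(3)] .
  have sub: "c \<subseteq> verts G" "c \<noteq> {}" "finite c" if "c \<in> ?Q" for c
  proof -
    show "c \<subseteq> verts G" using assms(3) that by (rule in_quotient_imp_subset)
    then show "finite c" using assms(2) by (auto simp: wf_graph_def intro: finite_subset)
    show "c \<noteq> {}" using assms(3) that by (rule in_quotient_imp_non_empty)
  qed
  have injQ: "inj_on ((`) \<phi>) ?Q"
    using sub inj by (auto simp: inj_on_def[of "(`) \<phi>"] inj_on_image_eq_iff)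
  have adj: "(\<exists>x\<in>\<phi> ` c. \<exists>y\<in>\<phi> ` c'. {x, y} \<in> edges H) \<longleftrightarrow> (\<exists>x\<in>c. \<exists>y\<in>c'. {x, y} \<in> edges G)"
    if "c \<in> ?Q" "c' \<in> ?Q" for c c'
    using edge_iso_iff[OF assms(1,2)] sub[OF that(1)] sub[OF that(2)] by blast
  have "edges (quotient_graph H (transport \<phi> r)) = (`) ((`) \<phi>) ` edges (quotient_graph G r)"
    (is "?L = ?R")
  proof
    show "?L \<subseteq> ?R"
    proof
      fix e assume "e \<in> ?L"
      then obtain c c' where c: "c \<in> ?Q" "c' \<in> ?Q" "\<phi> ` c \<noteq> \<phi> ` c'" "e = {\<phi> ` c, \<phi> ` c'}"
          "\<exists>x\<in>\<phi> ` c. \<exists>y\<in>\<phi> ` c'. {x, y} \<in> edges H"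
      proof -
        have "\<exists>d d'. e = {d, d'} \<and> d \<in> ?Q' \<and> d' \<in> ?Q' \<and> d \<noteq> d' \<and>
            (\<exists>x\<in>d. \<exists>y\<in>d'. {x, y} \<in> edges H)"
          using \<open>e \<in> ?L\<close> by (simp add: quotient_graph_def)
        then show ?thesis unfolding Q' using that by blast
      qed
      then have "{c, c'} \<in> edges (quotient_graph G r)"
      proof -
        have "c \<noteq> c'" using c(3) by blast
        moreover have "\<exists>x\<in>c. \<exists>y\<in>c'. {x, y} \<in> edges G" using adj[OF c(1,2)] c(5) by blast
        ultimately show ?thesis using c(1,2) by (auto simp: quotient_graph_def)
      qed
      then have "(`) \<phi> ` {c, c'} \<in> ?R" by (rule imageI)
      then show "e \<in> ?R" using c(4) by simp
    qed
    show "?R \<subseteq> ?L"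
    proof
      fix e assume "e \<in> ?R"
      then obtain c c' where c: "c \<in> ?Q" "c' \<in> ?Q" "c \<noteq> c'" "e = {\<phi> ` c, \<phi> ` c'}"
          "\<exists>x\<in>c. \<exists>y\<in>c'. {x, y} \<in> edges G"
        by (auto simp: quotient_graph_def)
      then have "\<phi> ` c \<noteq> \<phi> ` c'" using injQ by (auto dest: inj_onD)
      moreover have "\<exists>x\<in>\<phi> ` c. \<exists>y\<in>\<phi> ` c'. {x, y} \<in> edges H" using adj[OF c(1,2)] c(5) by blast
      moreover have "\<phi> ` c \<in> ?Q'" "\<phi> ` c' \<in> ?Q'" using Q' c(1,2) by auto
      ultimately have "\<exists>d d'. e = {d, d'} \<and> d \<in> ?Q' \<and> d' \<in> ?Q' \<and> d \<noteq> d' \<and>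
            (\<exists>x\<in>d. \<exists>y\<in>d'. {x, y} \<in> edges H)"
        using c(4) by blast
      then show "e \<in> ?L" by (simp add: quotient_graph_def)
    qed
  qed
  moreover have "semigroup_sum (dec H) (\<phi> ` c) = semigroup_sum (dec G) c" if "c \<in> ?Q" for c
    using sub[OF that] inj assms(1) by (intro semigroup_sum_image) (auto simp: iso_via_def intro: inj_on_subset)
  ultimately show ?thesis
    using injQ Q' by (simp add: iso_via_def bij_betw_def) (simp add: quotient_graph_def)
qed

lemma transport_connected_equivs:
  assumes "iso_via \<phi> G H" "wf_graph G" "r \<in> connected_equivs G"
  shows "transport \<phi> r \<in> connected_equivs H"
proof -
  have bij: "bij_betw \<phi> (verts G) (verts H)" using assms by (simp add: iso_via_def)
  have eq: "equiv (verts G) r" using assms by (simp add: connected_equivs_def)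
  have "connected_graph (induced H (\<phi> ` c))" if "c \<in> verts G // r" for c
  proof -
    have "c \<subseteq> verts G" using eq that by (rule in_quotient_imp_subset)
    then show ?thesis
      using that assms connected_graph_iso iso_via_induced wf_induced
      unfolding connected_equivs_def by blast
  qed
  then show ?thesis
    using equiv_transport[OF bij eq] quotient_transport[OF bij eq] by (auto simp: connected_equivs_def)
qed

lemma bij_betw_transport:
  assumes "iso_via \<phi> G H" "wf_graph G"
  shows "bij_betw (transport \<phi>) (connected_equivs G) (connected_equivs H)"
proof -
  let ?\<psi> = "the_inv_into (verts G) \<phi>"
  have bij: "bij_betw \<phi> (verts G) (verts H)" using assms by (simp add: iso_via_def)
  then have inj: "inj_on \<phi> (verts G)" by (simp add: bij_betw_def)
  have \<psi>: "iso_via ?\<psi> H G" "wf_graph H" using iso_via_sym iso_via_wf assms by blast+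
  have sub: "r \<subseteq> verts K \<times> verts K" if "r \<in> connected_equivs K" for r and K :: "('x, 'y) dgraph"
    using that by (auto simp: connected_equivs_def equiv_def)
  have 1: "transport ?\<psi> (transport \<phi> r) = r" if "r \<in> connected_equivs G" for r
  proof -
    have "map_prod ?\<psi> ?\<psi> (map_prod \<phi> \<phi> p) = p" if "p \<in> r" for p
      using sub[OF \<open>r \<in> connected_equivs G\<close>] that inj by (cases p) (auto simp: the_inv_into_f_f)
    then show ?thesis by (simp add: transport_def image_comp)
  qed
  have 2: "transport \<phi> (transport ?\<psi> r) = r" if "r \<in> connected_equivs H" for r
  proof -
    have "map_prod \<phi> \<phi> (map_prod ?\<psi> ?\<psi> p) = p" if "p \<in> r" for p
      using sub[OF \<open>r \<in> connected_equivs H\<close>] that bij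
      by (cases p) (auto simp: bij_betw_def f_the_inv_into_f)
    then show ?thesis by (simp add: transport_def image_comp)
  qed
  show ?thesis
    by (rule bij_betw_byWitness[where f' = "transport ?\<psi>"])
       (use 1 2 transport_connected_equivs[OF assms] transport_connected_equivs[OF \<psi>] in auto)
qed

definition split_coproduct :: "('v, 'd) dgraph \<Rightarrow> ('d iso_graph \<times> 'd iso_graph \<Rightarrow>\<^sub>0 rat)"
  where "split_coproduct G =
    (\<Sum>I\<in>Pow (verts G). basis (iclass (induced G I), iclass (induced G (verts G - I))))"

definition contraction_coproduct ::
    "('v, 'd::ab_semigroup_add) dgraph \<Rightarrow> ('d iso_graph \<times> 'd iso_graph \<Rightarrow>\<^sub>0 rat)"
  where "contraction_coproduct G =
    (\<Sum>r\<in>connected_equivs G. basis (iclass (quotient_graph G r), iclass (restrict_graph G r)))"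

lemma split_coproduct_iso:
  assumes "isomorphic G H"
  shows "split_coproduct G = split_coproduct H"
proof -
  from assms obtain \<phi> where \<phi>: "iso_via \<phi> G H" and wf: "wf_graph G" by (auto simp: isomorphic_def)
  then have bij: "bij_betw \<phi> (verts G) (verts H)" by (simp add: iso_via_def)
  have *: "iclass (induced H (\<phi> ` I)) = iclass (induced G I)" if "I \<subseteq> verts G" for I
    using iso_via_induced[OF \<phi> wf that] wf_induced[OF wf that] by (metis iclass_eq isomorphicI)
  have diff: "verts H - \<phi> ` I = \<phi> ` (verts G - I)" if "I \<subseteq> verts G" for I
    using bij that by (auto simp: bij_betw_def inj_on_image_set_diff[of \<phi> "verts G"])
  show ?thesis
    unfolding split_coproduct_def sum.reindex_bij_betw[OF bij_betw_Pow[OF bij], symmetric]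
    by (auto intro!: sum.cong simp: * diff)
qed

lemma contraction_coproduct_iso:
  assumes "isomorphic G H"
  shows "contraction_coproduct G = contraction_coproduct H"
proof -
  from assms obtain \<phi> where \<phi>: "iso_via \<phi> G H" and wf: "wf_graph G" by (auto simp: isomorphic_def)
  have *: "iclass (quotient_graph H (transport \<phi> r)) = iclass (quotient_graph G r)"
    "iclass (restrict_graph H (transport \<phi> r)) = iclass (restrict_graph G r)"
    if "r \<in> connected_equivs G" for r
  proof -
    have eq: "equiv (verts G) r" using that by (simp add: connected_equivs_def)
    show "iclass (quotient_graph H (transport \<phi> r)) = iclass (quotient_graph G r)"
      using iso_via_quotient_graph[OF \<phi> wf eq] wf_quotient_graph[OF wf eq]
      by (metis iclass_eq isomorphicI)
    show "iclass (restrict_graph H (transport \<phi> r)) = iclass (restrict_graph G r)"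
      using iso_via_restrict_graph[OF \<phi> wf eq] wf_restrict_graph[OF wf]
      by (metis iclass_eq isomorphicI)
  qed
  show ?thesis
    unfolding contraction_coproduct_def
      sum.reindex_bij_betw[OF bij_betw_transport[OF \<phi> wf], symmetric]
    by (auto intro!: sum.cong simp: *)
qed

lift_definition class_union :: "'d iso_graph \<Rightarrow> 'd iso_graph \<Rightarrow> 'd iso_graph"
  is "\<lambda>G H. iclass (disjoint_union G H)"
  by (rule iclass_eq)
     (meson iso_via_disjoint_union isomorphicI isomorphic_def wf_disjoint_union)

lift_definition class_split :: "'d iso_graph \<Rightarrow> ('d iso_graph \<times> 'd iso_graph \<Rightarrow>\<^sub>0 rat)"
  is split_coproduct
  by (rule split_coproduct_iso)

lift_definition class_contraction ::
    "'d::ab_semigroup_add iso_graph \<Rightarrow> ('d iso_graph \<times> 'd iso_graph \<Rightarrow>\<^sub>0 rat)"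
  is contraction_coproduct
  by (rule contraction_coproduct_iso)

lift_definition class_edgeless :: "'d iso_graph \<Rightarrow> bool"
  is "\<lambda>G. edges G = {}"
  by (auto simp: isomorphic_def iso_via_def)

lift_definition class_weight :: "('d \<Rightarrow> nat) \<Rightarrow> 'd iso_graph \<Rightarrow> nat"
  is "\<lambda>wt G. \<Sum>x\<in>verts G. wt (dec G x)"
proof -
  fix wt :: "'d \<Rightarrow> nat" and G H :: "(nat, 'd) dgraph"
  assume "isomorphic G H"
  then obtain \<phi> where "bij_betw \<phi> (verts G) (verts H)" "\<forall>x\<in>verts G. dec H (\<phi> x) = dec G x"
    by (auto simp: isomorphic_def iso_via_def)
  then show "(\<Sum>x\<in>verts G. wt (dec G x)) = (\<Sum>x\<in>verts H. wt (dec H x))"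
    by (simp flip: sum.reindex_bij_betw)
qed

lemma iclass_rep:
  assumes "wf_graph G"
  obtains H where "isomorphic G H" "isomorphic H H" "iclass G = abs_iso_graph H"
proof -
  obtain H :: "(nat, 'b) dgraph" where H: "isomorphic G H" using nat_graph_exists[OF assms] by blast
  then have "wf_graph H" by (simp add: isomorphic_def)
  then show thesis using that[OF H isomorphic_refl] iclass_eq[OF H] iclass_nat by metis
qed

lemma class_split_iclass: "wf_graph G \<Longrightarrow> class_split (iclass G) = split_coproduct G"
  by (metis iclass_rep class_split.abs_eq split_coproduct_iso)

lemma class_contraction_iclass:
  "wf_graph G \<Longrightarrow> class_contraction (iclass G) = contraction_coproduct G"
  by (metis iclass_rep class_contraction.abs_eq contraction_coproduct_iso)

lemma class_union_iclass:
  assumes "wf_graph G" "wf_graph H"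
  shows "class_union (iclass G) (iclass H) = iclass (disjoint_union G H)"
proof -
  obtain G' where G': "isomorphic G G'" "isomorphic G' G'" "iclass G = abs_iso_graph G'"
    using iclass_rep[OF assms(1)] .
  obtain H' where H': "isomorphic H H'" "isomorphic H' H'" "iclass H = abs_iso_graph H'"
    using iclass_rep[OF assms(2)] .
  have "isomorphic (disjoint_union G H) (disjoint_union G' H')"
    using G'(1) H'(1) by (meson iso_via_disjoint_union isomorphicI isomorphic_def wf_disjoint_union)
  then show ?thesis
    unfolding G'(3) H'(3) class_union.abs_eq[OF G'(2) H'(2)] by (rule iclass_eq[symmetric])
qed

definition graph_Delta :: "'d iso_graph bialgebra"
  where "graph_Delta =
    \<lparr>mult = bilin_ext (\<lambda>G H. basis (class_union G H)),
     unit = basis (iclass (empty_graph :: (nat, 'd) dgraph)),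
     comult = lin_ext class_split,
     counit = form_ext (\<lambda>G. if G = iclass (empty_graph :: (nat, 'd) dgraph) then 1 else 0)\<rparr>"

definition graph_delta :: "'d::ab_semigroup_add iso_graph bialgebra"
  where "graph_delta =
    \<lparr>mult = bilin_ext (\<lambda>G H. basis (class_union G H)),
     unit = basis (iclass (empty_graph :: (nat, 'd) dgraph)),
     comult = lin_ext class_contraction,
     counit = form_ext (\<lambda>G. if class_edgeless G then 1 else 0)\<rparr>"


section \<open>Quasisymmetric functions\<close>

typedef composition = "{u :: nat list. 0 \<notin> set u}"
  morphisms letters Composition
  by (rule exI[of _ "[]"]) simp

text \<open>
  \<open>qmon u\<close> is the basis element indexed by \<open>u\<close>; it is only meaningful if the entries of \<open>u\<close> are positive.
\<close>

definition qmon :: "nat list \<Rightarrow> (composition \<Rightarrow>\<^sub>0 rat)"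
  where "qmon u = basis (Composition u)"

fun quasi_shuffle :: "nat list \<Rightarrow> nat list \<Rightarrow> nat list multiset"
  where
    "quasi_shuffle [] v = {#v#}"
  | "quasi_shuffle u [] = {#u#}"
  | "quasi_shuffle (a # u) (b # v) =
       image_mset ((#) a) (quasi_shuffle u (b # v)) +
       image_mset ((#) b) (quasi_shuffle (a # u) v) +
       image_mset ((#) (a + b)) (quasi_shuffle u v)"

lemma quasi_shuffle_positive:
  "w \<in># quasi_shuffle u v \<Longrightarrow> 0 \<notin> set u \<Longrightarrow> 0 \<notin> set v \<Longrightarrow> 0 \<notin> set w"
  by (induction u v arbitrary: w rule: quasi_shuffle.induct) auto

text \<open>
  The quasi-shuffle product is the product of the monomial quasisymmetric functions: it is
  compatible with the evaluation of these functions on any finite totally ordered set of variables.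
\<close>

definition monomial_value :: "'i::linorder set \<Rightarrow> ('i \<Rightarrow> 'r::comm_ring_1) \<Rightarrow> nat list \<Rightarrow> 'r"
  where "monomial_value X x u =
    (\<Sum>js | sorted_wrt (<) js \<and> set js \<subseteq> X \<and> length js = length u.
       \<Prod>j<length u. x (js ! j) ^ (u ! j))"

lemma finite_index_lists:
  "finite X \<Longrightarrow> finite {js. sorted_wrt (<) js \<and> set js \<subseteq> X \<and> length js = (n::nat)}"
  by (rule finite_subset[OF _ finite_lists_length_eq[of X n]]) auto

lemma monomial_value_Nil [simp]: "monomial_value X x [] = 1"
proof -
  have "{js. sorted_wrt (<) js \<and> set js \<subseteq> X \<and> length js = length []} = {[]}"
    by auto
  then show ?thesis by (simp add: monomial_value_def)
qed

lemma monomial_value_empty [simp]: "monomial_value {} x (a # u) = 0"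
  unfolding monomial_value_def by (rule sum.neutral) auto

lemma monomial_value_insert:
  assumes "finite X" "\<forall>i\<in>X. b < i"
  shows "monomial_value (insert b X) x (a # u) =
    x b ^ a * monomial_value X x u + monomial_value X x (a # u)"
proof -
  let ?S = "\<lambda>X n. {js. sorted_wrt (<) js \<and> set js \<subseteq> X \<and> length js = n}"
  let ?n = "length u"
  have split: "?S (insert b X) (Suc ?n) = (#) b ` ?S X ?n \<union> ?S X (Suc ?n)"
  proof
    show "?S (insert b X) (Suc ?n) \<subseteq> (#) b ` ?S X ?n \<union> ?S X (Suc ?n)"
    proof
      fix js assume js: "js \<in> ?S (insert b X) (Suc ?n)"
      then obtain i ks where eq: "js = i # ks" by (cases js) auto
      have "b \<notin> set ks"
        using js assms(2) by (auto simp: eq dest: order.asym)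
      then have "set ks \<subseteq> X" using js by (auto simp: eq)
      then show "js \<in> (#) b ` ?S X ?n \<union> ?S X (Suc ?n)" using js by (auto simp: eq)
    qed
    show "(#) b ` ?S X ?n \<union> ?S X (Suc ?n) \<subseteq> ?S (insert b X) (Suc ?n)"
      using assms(2) by (auto simp: subset_eq)
  qed
  have disj: "(#) b ` ?S X ?n \<inter> ?S X (Suc ?n) = {}"
    using assms(2) by auto
  have *: "(\<Prod>j<Suc ?n. x ((b # js) ! j) ^ ((a # u) ! j)) = x b ^ a * (\<Prod>j<?n. x (js ! j) ^ (u ! j))"
    for js by (subst prod.lessThan_Suc_shift) simp
  show ?thesis
    unfolding monomial_value_def list.size(4) add_Suc_right add_0_right split
    by (subst sum.union_disjoint)
       (use disj finite_index_lists[OF assms(1)] in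
         \<open>auto simp: sum.reindex * sum_distrib_left simp del: nth_Cons_Suc prod.lessThan_Suc\<close>)
qed

lemma monomial_value_mult:
  assumes "finite X"
  shows "monomial_value X x u * monomial_value X x v =
    (\<Sum>w\<in>#quasi_shuffle u v. monomial_value X x w)"
  using assms
proof (induction X arbitrary: u v rule: finite_linorder_min_induct)
  case empty
  show ?case by (cases u; cases v) (simp_all add: image_mset.compositionality comp_def)
next
  case (insert b X)
  show ?case
  proof (cases "u = [] \<or> v = []")
    case True
    then show ?thesis by (cases u) auto
  next
    case False
    then obtain a u' c v' where uv: "u = a # u'" "v = c # v'" by (auto simp: neq_Nil_conv)
    have ins: "monomial_value (insert b X) x (k # w) =
        x b ^ k * monomial_value X x w + monomial_value X x (k # w)" for k w
      using insert by (intro monomial_value_insert) auto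
    have IH: "(\<Sum>w\<in>#quasi_shuffle p q. monomial_value X x w) =
        monomial_value X x p * monomial_value X x q" for p q
      using insert.IH by simp
    show ?thesis
      using IH[of "a # u'" "c # v'"]
      by (simp add: uv ins image_mset.compositionality comp_def sum_mset.distrib IH
          flip: sum_mset_distrib_left) (simp add: algebra_simps power_add)
  qed
qed

definition qsym_mult ::
    "(composition \<Rightarrow>\<^sub>0 rat) \<Rightarrow> (composition \<Rightarrow>\<^sub>0 rat) \<Rightarrow> (composition \<Rightarrow>\<^sub>0 rat)"
  where "qsym_mult = bilin_ext (\<lambda>u v. \<Sum>w\<in>#quasi_shuffle (letters u) (letters v). qmon w)"

definition deconcatenation :: "composition \<Rightarrow> (composition \<times> composition \<Rightarrow>\<^sub>0 rat)"
  where "deconcatenation w = (\<Sum>(u, v) | u @ v = letters w. tensor (qmon u) (qmon v))"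

text \<open>
  For the empty composition, the only factorization is the empty one, which contributes
  \<open>1 \<otimes> 1\<close>.
\<close>

definition factorizations :: "nat list \<Rightarrow> nat list list set"
  where "factorizations w = {ws. concat ws = w \<and> [] \<notin> set ws}"

definition block_coproduct :: "composition \<Rightarrow> (composition \<times> composition \<Rightarrow>\<^sub>0 rat)"
  where "block_coproduct w =
    (\<Sum>ws\<in>factorizations (letters w).
       tensor (qmon (map sum_list ws)) (foldr qsym_mult (map qmon ws) (qmon [])))"

definition qsym_Delta :: "composition bialgebra"
  where "qsym_Delta =
    \<lparr>mult = qsym_mult,
     unit = qmon [],
     comult = lin_ext deconcatenation,
     counit = form_ext (\<lambda>u. if letters u = [] then 1 else 0)\<rparr>"

definition qsym_delta :: "composition bialgebra"
  where "qsym_delta =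
    \<lparr>mult = qsym_mult,
     unit = qmon [],
     comult = lin_ext block_coproduct,
     counit = form_ext (\<lambda>u. if length (letters u) \<le> 1 then 1 else 0)\<rparr>"

definition composition_degree :: "composition \<Rightarrow> nat"
  where "composition_degree u = sum_list (letters u)"

lemma finite_factorizations: "finite (factorizations w)"
proof -
  have *: "length ws \<le> length (concat ws)" if "[] \<notin> set ws" for ws :: "nat list list"
    using that
  proof (induction ws)
    case (Cons v ws)
    then show ?case by (cases v) auto
  qed simp
  have "factorizations w \<subseteq> {ws. set ws \<subseteq> {v. set v \<subseteq> set w \<and> length v \<le> length w} \<and> length ws \<le> length w}"
    using * by (auto simp: factorizations_def length_concat member_le_sum_list)
  then show ?thesis
    by (rule finite_subset) (intro finite_lists_length_le, simp)
qed


section \<open>The chromatic morphism\<close>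

text \<open>The maximum of the empty coloring is \<open>0\<close>.\<close>

definition max_color :: "('v, 'd) dgraph \<Rightarrow> ('v \<Rightarrow> nat) \<Rightarrow> nat"
  where "max_color G f = Max (insert 0 (f ` verts G))"

definition color_weight :: "('d \<Rightarrow> nat) \<Rightarrow> ('v, 'd) dgraph \<Rightarrow> ('v \<Rightarrow> nat) \<Rightarrow> nat \<Rightarrow> nat"
  where "color_weight wt G f i = (\<Sum>x | x \<in> verts G \<and> f x = i. wt (dec G x))"

definition chromatic :: "('d \<Rightarrow> nat) \<Rightarrow> ('v, 'd) dgraph \<Rightarrow> (composition \<Rightarrow>\<^sub>0 rat)"
  where "chromatic wt G =
    (\<Sum>f\<in>packed_valid_colorings G. qmon (map (color_weight wt G f) [1..<Suc (max_color G f)]))"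

lemma finite_packed_valid_colorings:
  assumes "wf_graph G"
  shows "finite (packed_valid_colorings G)"
proof -
  have fin: "finite (verts G)" using assms by (simp add: wf_graph_def)
  have "packed_valid_colorings G \<subseteq> verts G \<rightarrow>\<^sub>E {1..card (verts G)}"
  proof
    fix f assume f: "f \<in> packed_valid_colorings G"
    then obtain k where k: "f ` verts G = {1..k}" by (auto simp: packed_valid_colorings_def)
    then have "k \<le> card (verts G)" using card_image_le[OF fin, of f] by simp
    then have "f ` verts G \<subseteq> {1..card (verts G)}" using k by auto
    then show "f \<in> verts G \<rightarrow>\<^sub>E {1..card (verts G)}"
      using f by (auto simp: packed_valid_colorings_def PiE_iff)
  qed
  then show ?thesis by (rule finite_subset) (intro finite_PiE fin, simp)
qed

lemma recolor_packed_valid: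
  assumes "iso_via \<phi> G H" "wf_graph G" "f \<in> packed_valid_colorings H"
  shows "restrict (f \<circ> \<phi>) (verts G) \<in> packed_valid_colorings G"
proof -
  have V: "\<phi> ` verts G = verts H" using assms by (simp add: iso_via_def bij_betw_def)
  have "restrict (f \<circ> \<phi>) (verts G) ` verts G = f ` verts H" by (auto simp flip: V)
  moreover have "f (\<phi> x) \<noteq> f (\<phi> y) \<and> x \<in> verts G \<and> y \<in> verts G" if "{x, y} \<in> edges G" for x y
  proof -
    have "x \<in> verts G" "y \<in> verts G" using that assms by (auto simp: wf_graph_def)
    then show ?thesis
      using that assms edge_iso_iff[OF assms(1,2)] by (auto simp: packed_valid_colorings_def)
  qed
  ultimately show ?thesis
    using assms(3) V by (auto simp: packed_valid_colorings_def PiE_iff)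
qed

lemma chromatic_iso:
  assumes "isomorphic G H"
  shows "chromatic wt G = chromatic wt H"
proof -
  from assms obtain \<phi> where \<phi>: "iso_via \<phi> G H" and wf: "wf_graph G" by (auto simp: isomorphic_def)
  let ?\<psi> = "the_inv_into (verts G) \<phi>"
  have bij: "bij_betw \<phi> (verts G) (verts H)" using \<phi> by (simp add: iso_via_def)
  then have inj: "inj_on \<phi> (verts G)" and V: "verts H = \<phi> ` verts G" by (auto simp: bij_betw_def)
  have \<psi>: "iso_via ?\<psi> H G" "wf_graph H" using iso_via_sym iso_via_wf \<phi> wf by blast+
  have \<psi>V: "?\<psi> y \<in> verts G" "\<phi> (?\<psi> y) = y" if "y \<in> verts H" for y
    using that inj V by (auto simp: the_inv_into_f_f)
  have ext: "f x = undefined" if "f \<in> packed_valid_colorings K" "x \<notin> verts K"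
    for f x and K :: "('x, 'y) dgraph"
    using that by (auto simp: packed_valid_colorings_def PiE_iff extensional_def)
  let ?F = "\<lambda>f. restrict (f \<circ> \<phi>) (verts G)" and ?F' = "\<lambda>g. restrict (g \<circ> ?\<psi>) (verts H)"
  show ?thesis
    unfolding chromatic_def
  proof (rule sum.reindex_bij_witness[where i = ?F and j = ?F'])
    fix g assume g: "g \<in> packed_valid_colorings G"
    show "?F (?F' g) = g"
      using inj V ext[OF g] by (auto simp: fun_eq_iff the_inv_into_f_f)
    show "?F' g \<in> packed_valid_colorings H" by (rule recolor_packed_valid[OF \<psi> g])
    have im: "?F' g ` verts H = g ` verts G"
      using inj V by (auto simp: the_inv_into_f_f image_comp image_iff)
    have "color_weight wt H (?F' g) i = color_weight wt G g i" for i
    proof -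
      have "{y \<in> verts H. ?F' g y = i} = \<phi> ` {x \<in> verts G. g x = i}"
        using inj V by (auto simp: the_inv_into_f_f dest: inj_onD)
      moreover have "inj_on \<phi> {x \<in> verts G. g x = i}" using inj by (rule inj_on_subset) auto
      ultimately show ?thesis
        using \<phi> by (auto simp: color_weight_def sum.reindex iso_via_def intro!: sum.cong)
    qed
    then show "qmon (map (color_weight wt H (?F' g)) [1..<Suc (max_color H (?F' g))]) =
        qmon (map (color_weight wt G g) [1..<Suc (max_color G g)])"
      unfolding max_color_def im by presburger
  next
    fix f assume f: "f \<in> packed_valid_colorings H"
    show "?F' (?F f) = f"
      using \<psi>V ext[OF f] by (auto simp: fun_eq_iff)
    show "?F f \<in> packed_valid_colorings G" by (rule recolor_packed_valid[OF \<phi> wf f])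
  qed
qed

lift_definition class_chromatic :: "('d \<Rightarrow> nat) \<Rightarrow> 'd iso_graph \<Rightarrow> (composition \<Rightarrow>\<^sub>0 rat)"
  is chromatic
  by (rule chromatic_iso)

lemma class_chromatic_iclass: "wf_graph G \<Longrightarrow> class_chromatic wt (iclass G) = chromatic wt G"
  by (metis iclass_rep class_chromatic.abs_eq chromatic_iso)

definition F_chr :: "('d \<Rightarrow> nat) \<Rightarrow> ('d iso_graph \<Rightarrow>\<^sub>0 rat) \<Rightarrow> (composition \<Rightarrow>\<^sub>0 rat)"
  where "F_chr wt = lin_ext (class_chromatic wt)"

definition double_bialgebra_morphism ::
    "('d::ab_semigroup_add \<Rightarrow> nat) \<Rightarrow> (('d iso_graph \<Rightarrow>\<^sub>0 rat) \<Rightarrow> (composition \<Rightarrow>\<^sub>0 rat)) \<Rightarrow> bool"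
  where "double_bialgebra_morphism wt \<Phi> \<longleftrightarrow>
    homogeneous_map (class_weight wt) composition_degree \<Phi> \<and>
    bialgebra_morphism graph_Delta qsym_Delta \<Phi> \<and>
    bialgebra_morphism graph_delta qsym_delta \<Phi>"

end

theory Submission
  imports Defs
begin

text \<open>
  Everything is reduced to an identity between coefficients. Indexing the coefficients of a
  quasisymmetric function \<open>x\<close> by all sequences \<open>w\<close> of natural numbers, with zero entries ignored,
  makes \<open>monomial_coeff x w\<close> the coefficient of the monomial with exponents \<open>w\<close> in the power
  series of \<open>x\<close>. Products then become convolutions (\<open>monomial_coeff_qsym_mult\<close>), and the first
  coproduct becomes concatenation of index sequences (\<open>lookup_deconcatenation\<close>).

  On the side of graphs, the coefficient of \<open>F_chr\<close> at \<open>u\<close> is the number \<open>coloring_count wt u G\<close>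
  of proper colorings whose color classes have weights \<open>u\<close> (\<open>monomial_coeff_chromatic\<close>). It is
  computed by removing the first color class: the coefficient at \<open>m # u\<close> is the sum, over the
  stable sets \<open>I\<close> of weight \<open>m\<close>, of the coefficient of the remaining graph at \<open>u\<close>.

  Uniqueness. Let \<open>\<Phi>\<close> be a homogeneous morphism for \<open>\<Delta>\<close> that preserves the counit of \<open>\<delta>\<close>. On a
  homogeneous quasisymmetric function of degree \<open>m > 0\<close> this counit reads off the coefficient of
  \<open>M\<^sub>m\<close>; hence the coefficient of \<open>M\<^sub>m\<close> in \<open>\<Phi>(G)\<close> is \<open>1\<close> if \<open>G\<close> has no edges and weight \<open>m\<close>, and
  \<open>0\<close> otherwise. Compatibility with \<open>\<Delta>\<close> turns this into the recursion above, so that \<open>\<Phi> = F_chr\<close>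
  (\<open>morphism_monomial_coeff\<close>).

  Existence. Compatibility of \<open>F_chr\<close> with products and with \<open>\<Delta>\<close> follows by the same recursion
  (\<open>coloring_count_separated\<close>, \<open>coloring_count_append\<close>). For \<open>\<delta>\<close>, fix the composition \<open>u\<close> in the
  left tensor factor. Let \<open>D\<^sub>u(G)\<close> be the factor on the right of \<open>M\<^sub>u\<close> in \<open>\<delta>(F_chr(G))\<close>.
  Splitting off the first block gives the recursion
  \<open>D\<^bsub>m # u\<^esub>(G) = \<Sum>\<^bsub>wt(I) = m\<^esub> F_chr(G\<^bsub>|I\<^esub>) D\<^sub>u(G\<^bsub>|V - I\<^esub>)\<close>, where \<open>I\<close> now is an arbitrary set of
  vertices (\<open>block_part_chromatic\<close>). The factor on the right of \<open>M\<^sub>u\<close> in \<open>(F_chr \<otimes> F_chr)(\<delta>(G))\<close>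
  satisfies the same recursion if the weight is additive (\<open>contraction_part_Cons\<close>): a first color
  class of a contraction \<open>G/\<sim>\<close> is a set \<open>C\<close> of classes without edges between them, which means
  that \<open>C\<close> consists of the connected components of the graph induced on \<open>I = \<Union>C\<close>. Thus \<open>(\<sim>, C)\<close>
  is the same datum as \<open>I\<close> together with the restriction of \<open>\<sim>\<close> to the complement of \<open>I\<close>.

  Necessity of additivity. A morphism for both coproducts is \<open>F_chr\<close>, as seen above, and
  comparing coefficients for a single edge with decorations \<open>a\<close> and \<open>b\<close> gives
  \<open>wt(a + b) = wt(a) + wt(b)\<close> (\<open>delta_morphism_imp_additive\<close>).
\<close>

section \<open>Linear maps between spaces with a basis\<close>

abbreviation linear_map :: "(('a \<Rightarrow>\<^sub>0 rat) \<Rightarrow> ('b \<Rightarrow>\<^sub>0 rat)) \<Rightarrow> bool"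
  where "linear_map \<equiv> Vector_Spaces.linear scale scale"

lemma linear_mapI:
  assumes "\<And>x y. f (x + y) = f x + f y" "\<And>c x. f (scale c x) = scale c (f x)"
  shows "linear_map f"
  by unfold_locales (simp_all add: assms)

lemma
  assumes "linear_map f"
  shows linear_map_add: "f (x + y) = f x + f y"
    and linear_map_scale: "f (scale c x) = scale c (f x)"
    and linear_map_sum: "f (\<Sum>i\<in>S. g i) = (\<Sum>i\<in>S. f (g i))"
proof -
  interpret Vector_Spaces.linear scale scale f by (rule assms)
  show "f (x + y) = f x + f y" "f (scale c x) = scale c (f x)"
    "f (\<Sum>i\<in>S. g i) = (\<Sum>i\<in>S. f (g i))"
    by (rule add scale sum)+
qed

lemma lookup_sum: "Poly_Mapping.lookup (\<Sum>i\<in>S. f i) a = (\<Sum>i\<in>S. Poly_Mapping.lookup (f i) a)"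
  by (induction S rule: infinite_finite_induct) (simp_all add: lookup_add)

lemma lookup_sum_mset:
  "Poly_Mapping.lookup (\<Sum>i\<in>#S. f i) a = (\<Sum>i\<in>#S. Poly_Mapping.lookup (f i) a)"
  by (induction S) (simp_all add: lookup_add)

lemma lookup_basis: "Poly_Mapping.lookup (basis a) b = of_bool (a = b)"
  by (simp add: basis_def lookup_single when_def)

lemma sum_lookup_superset:
  fixes f :: "'a \<Rightarrow> rat"
  assumes "finite S" "Poly_Mapping.keys x \<subseteq> S"
  shows "(\<Sum>a\<in>Poly_Mapping.keys x. Poly_Mapping.lookup x a * f a) =
    (\<Sum>a\<in>S. Poly_Mapping.lookup x a * f a)"
  using assms by (intro sum.mono_neutral_left) (auto simp: in_keys_iff)

lemma form_ext_add: "form_ext f (x + y) = form_ext f x + form_ext f y"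
proof -
  let ?S = "Poly_Mapping.keys x \<union> Poly_Mapping.keys y"
  have "form_ext f z = (\<Sum>a\<in>?S. Poly_Mapping.lookup z a * f a)"
    if "Poly_Mapping.keys z \<subseteq> ?S" for z
    unfolding form_ext_def using that by (intro sum_lookup_superset) auto
  then show ?thesis
    using Poly_Mapping.keys_add[of x y] by (simp add: lookup_add distrib_right sum.distrib)
qed

lemma form_ext_scale: "form_ext f (scale c x) = c * form_ext f x"
proof -
  have "Poly_Mapping.keys (scale c x) \<subseteq> Poly_Mapping.keys x" by (auto simp: in_keys_iff)
  then have "form_ext f (scale c x) =
      (\<Sum>a\<in>Poly_Mapping.keys x. Poly_Mapping.lookup (scale c x) a * f a)"
    unfolding form_ext_def by (intro sum_lookup_superset) auto
  then show ?thesis by (simp add: form_ext_def sum_distrib_left mult.assoc)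
qed

lemma form_ext_basis: "form_ext f (basis a) = f a"
  by (simp add: form_ext_def basis_def)

lemma lookup_lin_ext:
  "Poly_Mapping.lookup (lin_ext f x) b = form_ext (\<lambda>a. Poly_Mapping.lookup (f a) b) x"
  by (simp add: lin_ext_def form_ext_def lookup_sum)

lemma linear_lin_ext: "linear_map (lin_ext f)"
  by (rule linear_mapI)
     (auto intro!: poly_mapping_eqI simp: lookup_lin_ext lookup_add form_ext_add form_ext_scale)

lemma lin_ext_basis [simp]: "lin_ext f (basis a) = f a"
  by (intro poly_mapping_eqI) (simp add: lookup_lin_ext form_ext_basis)

lemma basis_induct [case_names basis add scale]:
  assumes "\<And>a. P (basis a)" "\<And>x y. P x \<Longrightarrow> P y \<Longrightarrow> P (x + y)" "\<And>c x. P x \<Longrightarrow> P (scale c x)"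
  shows "P (x :: 'a \<Rightarrow>\<^sub>0 rat)"
proof -
  have zero: "P 0"
  proof -
    have "scale 0 (basis undefined) = (0 :: 'a \<Rightarrow>\<^sub>0 rat)" by (intro poly_mapping_eqI) simp
    then show ?thesis using assms(1,3) by metis
  qed
  have "P (\<Sum>a\<in>S. scale (Poly_Mapping.lookup x a) (basis a))" for S
    by (induction S rule: infinite_finite_induct) (auto intro: zero assms)
  moreover have "(\<Sum>a\<in>Poly_Mapping.keys x. scale (Poly_Mapping.lookup x a) (basis a)) = x"
    by (intro poly_mapping_eqI)
       (auto simp: lookup_sum lookup_basis in_keys_iff of_bool_def if_distrib sum.delta' cong: if_cong)
  ultimately show ?thesis by metis
qed

lemma linear_map_eqI:
  assumes "linear_map f" "linear_map g" "\<And>a. f (basis a) = g (basis a)"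
  shows "f x = g x"
  by (induction x rule: basis_induct)
     (simp_all add: assms linear_map_add[OF assms(1)] linear_map_add[OF assms(2)]
       linear_map_scale[OF assms(1)] linear_map_scale[OF assms(2)])

lemma linear_map_comp: "linear_map f \<Longrightarrow> linear_map g \<Longrightarrow> linear_map (\<lambda>x. f (g x))"
  by (rule linear_mapI) (simp_all add: linear_map_add linear_map_scale)

lemma linear_bilin_ext_left: "linear_map (\<lambda>x. bilin_ext f x y)"
  unfolding bilin_ext_def by (rule linear_lin_ext)

lemma linear_bilin_ext_right: "linear_map (bilin_ext f x)"
  by (rule linear_mapI; induction x rule: basis_induct)
     (simp_all add: bilin_ext_def linear_map_add[OF linear_lin_ext]
       linear_map_scale[OF linear_lin_ext] free_vs.scale_right_distrib ac_simps)

lemma bilin_ext_basis [simp]: "bilin_ext f (basis a) (basis b) = f a b"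
  by (simp add: bilin_ext_def)

lemma lookup_tensor:
  "Poly_Mapping.lookup (tensor x y) (a, b) = Poly_Mapping.lookup x a * Poly_Mapping.lookup y b"
proof (induction x rule: basis_induct)
  case (basis c)
  show ?case
    by (induction y rule: basis_induct)
       (auto simp: tensor_def lookup_basis lookup_add algebra_simps
         linear_map_add[OF linear_bilin_ext_right] linear_map_scale[OF linear_bilin_ext_right])
qed (simp_all add: tensor_def lookup_add algebra_simps
    linear_map_add[OF linear_bilin_ext_left] linear_map_scale[OF linear_bilin_ext_left])

lemma tensor_basis: "tensor (basis a) (basis b) = basis (a, b)"
  by (simp add: tensor_def)

lemma linear_tensor_map: "linear_map (tensor_map f g)"
  unfolding tensor_map_def by (rule linear_lin_ext)

lemma tensor_map_basis: "tensor_map f g (basis (a, b)) = tensor (f (basis a)) (g (basis b))"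
  by (simp add: tensor_map_def)

lemma linear_tensor: "linear_map (tensor x)" "linear_map (\<lambda>x. tensor x y)"
  unfolding tensor_def by (rule linear_bilin_ext_right linear_bilin_ext_left)+

lemma lin_ext_zero: "lin_ext (\<lambda>_. 0) x = 0"
  by (simp add: lin_ext_def free_vs.scale_zero_right)

lemma lin_ext_tensor: "lin_ext h (tensor y z) = lin_ext (\<lambda>c. lin_ext (\<lambda>d. h (c, d)) z) y"
proof -
  have "lin_ext h (tensor (basis c) z) = lin_ext (\<lambda>d. h (c, d)) z" for c
  proof (rule linear_map_eqI[where f = "\<lambda>z. lin_ext h (tensor (basis c) z)"])
    show "linear_map (\<lambda>z. lin_ext h (tensor (basis c) z))"
      by (rule linear_map_comp[OF linear_lin_ext linear_tensor(1)])
  qed (simp_all add: linear_lin_ext tensor_basis)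
  note basis = this
  show ?thesis
  proof (rule linear_map_eqI[where f = "\<lambda>y. lin_ext h (tensor y z)"])
    show "linear_map (\<lambda>y. lin_ext h (tensor y z))"
      by (rule linear_map_comp[OF linear_lin_ext linear_tensor(2)])
  qed (simp_all add: linear_lin_ext basis)
qed

section \<open>Coefficients of quasisymmetric functions\<close>

text \<open>
  The index \<open>w\<close> may contain zeros, which are ignored: this is the coefficient of the monomial
  \<open>x\<^sub>1^w\<^sub>1 \<cdots> x\<^sub>n^w\<^sub>n\<close> in the power series of the quasisymmetric function.
\<close>

definition monomial_coeff :: "(composition \<Rightarrow>\<^sub>0 rat) \<Rightarrow> nat list \<Rightarrow> rat"
  where "monomial_coeff x w = Poly_Mapping.lookup x (Composition (filter (\<lambda>a. a \<noteq> 0) w))"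

lemma letters_Composition: "0 \<notin> set u \<Longrightarrow> letters (Composition u) = u"
  by (simp add: Composition_inverse)

lemma letters_positive: "0 \<notin> set (letters c)"
  using letters[of c] by simp

lemma Composition_eq_iff:
  "0 \<notin> set u \<Longrightarrow> 0 \<notin> set v \<Longrightarrow> Composition u = Composition v \<longleftrightarrow> u = v"
  by (metis letters_Composition)

lemma monomial_coeff_positive:
  "0 \<notin> set u \<Longrightarrow> monomial_coeff x u = Poly_Mapping.lookup x (Composition u)"
  unfolding monomial_coeff_def by (subst filter_True) (auto simp: neq0_conv intro!: gr0I)

lemma lookup_eq_monomial_coeff: "Poly_Mapping.lookup x c = monomial_coeff x (letters c)"
  using letters_positive by (simp add: monomial_coeff_positive letters_inverse)

lemma qsym_eqI:
  assumes "\<And>u. 0 \<notin> set u \<Longrightarrow> monomial_coeff x u = monomial_coeff y u"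
  shows "x = y"
  by (rule poly_mapping_eqI) (simp add: lookup_eq_monomial_coeff assms letters_positive)

lemma monomial_coeff_add: "monomial_coeff (x + y) w = monomial_coeff x w + monomial_coeff y w"
  by (simp add: monomial_coeff_def lookup_add)

lemma monomial_coeff_scale: "monomial_coeff (scale c x) w = c * monomial_coeff x w"
  by (simp add: monomial_coeff_def)

lemma monomial_coeff_sum: "monomial_coeff (\<Sum>i\<in>S. f i) w = (\<Sum>i\<in>S. monomial_coeff (f i) w)"
  by (simp add: monomial_coeff_def lookup_sum)

lemma monomial_coeff_qmon:
  assumes "0 \<notin> set u"
  shows "monomial_coeff (qmon u) w = of_bool (filter (\<lambda>a. a \<noteq> 0) w = u)"
proof -
  have "0 \<notin> set (filter (\<lambda>a. a \<noteq> 0) w)" by simp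
  then show ?thesis
    using assms by (auto simp: monomial_coeff_def qmon_def lookup_basis Composition_eq_iff)
qed

text \<open>
  This is the rule for the coefficient at \<open>x^w\<close> of a product of two power series: the sum of
  \<open>f u * g v\<close> over all ways to write \<open>w\<close> as the entrywise sum of \<open>u\<close> and \<open>v\<close>.
\<close>

primrec convolution :: "(nat list \<Rightarrow> rat) \<Rightarrow> (nat list \<Rightarrow> rat) \<Rightarrow> nat list \<Rightarrow> rat"
  where
    "convolution f g [] = f [] * g []"
  | "convolution f g (m # w) = (\<Sum>p\<le>m. convolution (\<lambda>u. f (p # u)) (\<lambda>v. g ((m - p) # v)) w)"

lemma convolution_add_left:
  "convolution (\<lambda>u. f u + f' u) g w = convolution f g w + convolution f' g w"
  by (induction w arbitrary: f f' g) (simp_all add: distrib_right sum.distrib)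

lemma convolution_add_right:
  "convolution f (\<lambda>v. g v + g' v) w = convolution f g w + convolution f g' w"
  by (induction w arbitrary: f g g') (simp_all add: distrib_left sum.distrib)

lemma convolution_scale_left: "convolution (\<lambda>u. c * f u) g w = c * convolution f g w"
  by (induction w arbitrary: f g) (simp_all add: sum_distrib_left)

lemma convolution_scale_right: "convolution f (\<lambda>v. c * g v) w = c * convolution f g w"
  by (induction w arbitrary: f g) (simp_all add: sum_distrib_left)

lemma convolution_zero_left: "convolution (\<lambda>_. 0) g w = 0"
  using convolution_scale_left[of 0 "\<lambda>_. 0" g w] by simp

lemma convolution_zero_right: "convolution f (\<lambda>_. 0) w = 0"
  using convolution_scale_right[of f 0 "\<lambda>_. 0" w] by simp

lemma convolution_sum_left:
  "convolution (\<lambda>u. \<Sum>i\<in>S. f i u) g w = (\<Sum>i\<in>S. convolution (f i) g w)"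
  by (induction S rule: infinite_finite_induct)
     (simp_all add: convolution_add_left convolution_zero_left)

lemma convolution_sum_right:
  "convolution f (\<lambda>v. \<Sum>i\<in>S. g i v) w = (\<Sum>i\<in>S. convolution f (g i) w)"
  by (induction S rule: infinite_finite_induct)
     (simp_all add: convolution_add_right convolution_zero_right)

text \<open>
  The coefficient of the monomial with exponents \<open>w\<close> in the monomial quasisymmetric function
  \<open>M\<^sub>u\<close>.
\<close>

definition packs_to :: "nat list \<Rightarrow> nat list \<Rightarrow> rat"
  where "packs_to u w = of_bool (filter (\<lambda>a. a \<noteq> 0) w = u)"

lemma packs_to_empty: "packs_to u [] = of_bool (u = [])"
  by (auto simp: packs_to_def)

lemma packs_to_Nil: "packs_to [] (p # s) = of_bool (p = 0) * packs_to [] s"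
  by (auto simp: packs_to_def)

lemma packs_to_Cons:
  "0 < a \<Longrightarrow> packs_to (a # u) (p # s) =
    of_bool (p = 0) * packs_to (a # u) s + of_bool (p = a) * packs_to u s"
  by (auto simp: packs_to_def)

lemma sum_atMost_split:
  fixes a b m :: nat and c :: rat
  shows "(\<Sum>p\<le>m. of_bool (p = a) * (of_bool (m - p = b) * c)) = of_bool (m = a + b) * c"
proof -
  have "(\<Sum>p\<le>m. of_bool (p = a) * (of_bool (m - p = b) * c)) =
      (\<Sum>p\<le>m. if p = a then of_bool (m - a = b) * c else 0)"
    by (rule sum.cong) auto
  also have "\<dots> = (if a \<le> m then of_bool (m - a = b) * c else 0)"
    by simp
  also have "\<dots> = of_bool (m = a + b) * c" by auto
  finally show ?thesis .
qed

text \<open>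
  The first variable occurs in a product \<open>M\<^sub>u M\<^sub>v\<close> with exponent zero, with the first letter of
  \<open>u\<close>, with the first letter of \<open>v\<close>, or with their sum; the last three cases are the three cases
  of the quasi-shuffle.
\<close>

lemma quasi_shuffle_convolution:
  assumes "0 \<notin> set u" "0 \<notin> set v"
  shows "(\<Sum>t\<in>#quasi_shuffle u v. packs_to t w) = convolution (packs_to u) (packs_to v) w"
  using assms
proof (induction w arbitrary: u v)
  case Nil
  show ?case
    by (cases "(u, v)" rule: quasi_shuffle.cases)
       (auto simp: packs_to_empty image_mset.compositionality comp_def)
next
  case (Cons m w)
  note conv = convolution_add_left convolution_add_right convolution_scale_left
    convolution_scale_right distrib_left sum.distrib sum_atMost_split
  consider (l) "u = []" "v = []" | (r) a u' where "u = a # u'" "v = []"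
    | (s) b v' where "u = []" "v = b # v'" | (t) a u' b v' where "u = a # u'" "v = b # v'"
    by (metis neq_Nil_conv)
  then show ?case
  proof cases
    case l
    then show ?thesis
      using Cons.IH[of "[]" "[]"] by (simp add: packs_to_Nil conv)
  next
    case r
    then have "0 < a" "0 \<notin> set u'" using Cons.prems by auto
    then show ?thesis
      using r Cons.IH[of u' "[]"] Cons.IH[of "a # u'" "[]"]
      by (cases u') (simp_all add: packs_to_Nil packs_to_Cons conv)
  next
    case s
    then have "0 < b" "0 \<notin> set v'" using Cons.prems by auto
    then show ?thesis
      using s Cons.IH[of "[]" v'] Cons.IH[of "[]" "b # v'"]
      by (simp add: packs_to_Nil packs_to_Cons conv)
  next
    case t
    then have pos: "0 < a" "0 < b" "0 \<notin> set u'" "0 \<notin> set v'" using Cons.prems by auto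
    have "(\<Sum>t\<in>#quasi_shuffle u v. packs_to t (m # w)) =
      of_bool (m = 0) * (\<Sum>t\<in>#quasi_shuffle u v. packs_to t w) +
      of_bool (m = a) * (\<Sum>t\<in>#quasi_shuffle u' v. packs_to t w) +
      of_bool (m = b) * (\<Sum>t\<in>#quasi_shuffle u v'. packs_to t w) +
      of_bool (m = a + b) * (\<Sum>t\<in>#quasi_shuffle u' v'. packs_to t w)"
      using pos by (simp add: t packs_to_Cons image_mset.compositionality comp_def
        sum_mset.distrib algebra_simps flip: sum_mset_distrib_left)
    also have "\<dots> =
      of_bool (m = 0) * convolution (packs_to u) (packs_to v) w +
      of_bool (m = a) * convolution (packs_to u') (packs_to v) w +
      of_bool (m = b) * convolution (packs_to u) (packs_to v') w +
      of_bool (m = a + b) * convolution (packs_to u') (packs_to v') w"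
      using Cons.prems pos by (simp only: Cons.IH not_False_eq_True)
    finally show ?thesis
      using pos by (simp add: t packs_to_Cons conv)
  qed
qed

lemma linear_qsym_mult: "linear_map (qsym_mult x)" "linear_map (\<lambda>x. qsym_mult x y)"
  unfolding qsym_mult_def by (rule linear_bilin_ext_right linear_bilin_ext_left)+

lemma monomial_coeff_basis: "monomial_coeff (basis c) = packs_to (letters c)"
  using monomial_coeff_qmon[OF letters_positive, of c]
  by (auto simp: qmon_def letters_inverse packs_to_def)

lemma monomial_coeff_qsym_mult:
  "monomial_coeff (qsym_mult x y) w = convolution (monomial_coeff x) (monomial_coeff y) w"
proof (induction x rule: basis_induct)
  case (basis c)
  show ?case
  proof (induction y rule: basis_induct)
    case (basis d)
    have "monomial_coeff (qsym_mult (basis c) (basis d)) w =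
        (\<Sum>t\<in>#quasi_shuffle (letters c) (letters d). monomial_coeff (qmon t) w)"
      by (simp add: qsym_mult_def monomial_coeff_def lookup_sum_mset
          image_mset.compositionality comp_def)
    also have "\<dots> = (\<Sum>t\<in>#quasi_shuffle (letters c) (letters d). packs_to t w)"
      using quasi_shuffle_positive[OF _ letters_positive letters_positive]
      by (intro arg_cong[where f = sum_mset] image_mset_cong)
         (metis monomial_coeff_qmon packs_to_def)
    finally show ?case
      by (simp add: quasi_shuffle_convolution letters_positive monomial_coeff_basis)
  qed (simp_all add: linear_map_add[OF linear_qsym_mult(1)] linear_map_scale[OF linear_qsym_mult(1)]
      monomial_coeff_add monomial_coeff_scale convolution_add_right convolution_scale_right)
qed (simp_all add: linear_map_add[OF linear_qsym_mult(2)] linear_map_scale[OF linear_qsym_mult(2)]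
    monomial_coeff_add monomial_coeff_scale convolution_add_left convolution_scale_left)

section \<open>Counting colorings with prescribed weights\<close>

lemma induced_simps [simp]:
  "verts (induced G I) = I" "edges (induced G I) = {e \<in> edges G. e \<subseteq> I}" "dec (induced G I) = dec G"
  by (simp_all add: induced_def)

lemma induced_induced: "J \<subseteq> I \<Longrightarrow> induced (induced G I) J = induced G J"
  by (auto simp: induced_def)

lemma induced_verts: "wf_graph G \<Longrightarrow> induced G (verts G) = G"
  by (rule dgraph.equality) (auto simp: wf_graph_def)

lemma wf_graph_finite: "wf_graph G \<Longrightarrow> finite (verts G)"
  by (simp add: wf_graph_def)

lemma wf_graph_edgeE:
  assumes "wf_graph G" "e \<in> edges G"
  obtains x y where "e = {x, y}" "x \<noteq> y" "x \<in> verts G" "y \<in> verts G"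
  using assms by (auto simp: wf_graph_def card_2_iff)

lemma wf_graph_edge: "wf_graph G \<Longrightarrow> e \<in> edges G \<Longrightarrow> e \<subseteq> verts G \<and> (\<exists>x. x \<in> e)"
  by (auto elim!: wf_graph_edgeE)

definition set_weight :: "('d \<Rightarrow> nat) \<Rightarrow> ('v, 'd) dgraph \<Rightarrow> 'v set \<Rightarrow> nat"
  where "set_weight wt G I = (\<Sum>x\<in>I. wt (dec G x))"

lemma set_weight_induced [simp]: "set_weight wt (induced G J) = set_weight wt G"
  by (simp add: set_weight_def fun_eq_iff)

lemma set_weight_union:
  "finite I \<Longrightarrow> finite J \<Longrightarrow> I \<inter> J = {} \<Longrightarrow>
    set_weight wt G (I \<union> J) = set_weight wt G I + set_weight wt G J"
  unfolding set_weight_def by (rule sum.union_disjoint)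

lemma set_weight_eq_0:
  "\<forall>d. wt d > 0 \<Longrightarrow> finite I \<Longrightarrow> set_weight wt G I = 0 \<longleftrightarrow> I = {}"
  unfolding set_weight_def by (auto; metis less_irrefl)

text \<open>
  The possible color classes of weight \<open>m\<close> in a proper coloring.
\<close>

definition stable_sets :: "('d \<Rightarrow> nat) \<Rightarrow> nat \<Rightarrow> ('v, 'd) dgraph \<Rightarrow> 'v set set"
  where "stable_sets wt m G =
    {I. I \<subseteq> verts G \<and> (\<forall>e\<in>edges G. \<not> e \<subseteq> I) \<and> set_weight wt G I = m}"

lemma stable_sets_induced:
  "stable_sets wt m (induced G I) =
    {J. J \<subseteq> I \<and> (\<forall>e\<in>edges G. \<not> e \<subseteq> J) \<and> set_weight wt G J = m}"
  unfolding stable_sets_def by (simp; blast dest: subset_trans)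

lemma finite_stable_sets: "wf_graph G \<Longrightarrow> finite (stable_sets wt m G)"
  by (rule finite_subset[of _ "Pow (verts G)"]) (auto simp: stable_sets_def wf_graph_finite)

text \<open>
  The number of proper colorings in which the \<open>i\<close>-th color class has weight \<open>u\<^sub>i\<close>, computed by
  removing one color class after the other. If the weights of vertices are positive, then a
  letter \<open>0\<close> stands for an unused color.
\<close>

primrec coloring_count :: "('d \<Rightarrow> nat) \<Rightarrow> nat list \<Rightarrow> ('v, 'd) dgraph \<Rightarrow> rat"
  where
    "coloring_count wt [] G = of_bool (verts G = {})"
  | "coloring_count wt (m # u) G =
      (\<Sum>I\<in>stable_sets wt m G. coloring_count wt u (induced G (verts G - I)))"

text \<open>
  A coloring with weights \<open>u @ v\<close> is a coloring of the set \<open>I\<close> of vertices that receive one of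
  the first colors, together with a coloring of its complement; this is what makes \<open>F_chr\<close>
  compatible with \<open>\<Delta>\<close>.
\<close>

lemma coloring_count_append:
  assumes "wf_graph G"
  shows "coloring_count wt (u @ v) G =
    (\<Sum>I\<in>Pow (verts G). coloring_count wt u (induced G I)
        * coloring_count wt v (induced G (verts G - I)))"
  using assms
proof (induction u arbitrary: G)
  case Nil
  then have "(\<Sum>I\<in>Pow (verts G). coloring_count wt [] (induced G I) *
      coloring_count wt v (induced G (verts G - I))) =
    (\<Sum>I\<in>{{}}. coloring_count wt v (induced G (verts G - I)))"
    by (intro sum.mono_neutral_cong_right) (auto simp: wf_graph_finite)
  then show ?case using Nil by (simp add: induced_verts)
next
  case (Cons m u)
  let ?V = "verts G"
  have fin: "finite ?V" using Cons.prems by (rule wf_graph_finite)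
  have wf: "wf_graph (induced G I)" if "I \<subseteq> ?V" for I using wf_induced[OF Cons.prems that] .
  let ?t = "\<lambda>K L. coloring_count wt u (induced G K) * coloring_count wt v (induced G L)"
  have "coloring_count wt ((m # u) @ v) G =
      (\<Sum>J\<in>stable_sets wt m G. \<Sum>K\<in>Pow (?V - J). ?t K (?V - J - K))"
    by (auto simp: Cons.IH wf induced_induced intro!: sum.cong)
  also have "\<dots> = (\<Sum>(J, K)\<in>Sigma (stable_sets wt m G) (\<lambda>J. Pow (?V - J)). ?t K (?V - J - K))"
    using finite_stable_sets[OF Cons.prems] fin by (intro sum.Sigma) auto
  \<comment> \<open>Here \<open>J\<close> is the first color class and \<open>I\<close> the union of the classes with weights \<open>m # u\<close>.\<close>
  also have "\<dots> = (\<Sum>(I, J)\<in>Sigma (Pow ?V) (\<lambda>I. stable_sets wt m (induced G I)). ?t (I - J) (?V - I))"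
  proof (rule sum.reindex_bij_witness[where i = "\<lambda>(I, J). (J, I - J)" and j
      = "\<lambda>(J, K). (J \<union> K, J)"])
    fix q assume "q \<in> Sigma (stable_sets wt m G) (\<lambda>J. Pow (?V - J))"
    then obtain J K where q: "q = (J, K)" "J \<in> stable_sets wt m G" "K \<subseteq> ?V - J" by auto
    then have *: "J \<union> K - J = K" "?V - (J \<union> K) = ?V - J - K" "J \<subseteq> ?V"
      by (auto simp: stable_sets_def)
    show "(\<lambda>(I, J). (J, I - J)) ((\<lambda>(J, K). (J \<union> K, J)) q) = q" using q * by simp
    show "(\<lambda>(J, K). (J \<union> K, J)) q \<in> Sigma (Pow ?V) (\<lambda>I. stable_sets wt m (induced G I))"
      using q * by (auto simp: stable_sets_induced stable_sets_def)
    show "(case (\<lambda>(J, K). (J \<union> K, J)) q of (I, J) \<Rightarrow> ?t (I - J) (?V - I)) =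
        (case q of (J, K) \<Rightarrow> ?t K (?V - J - K))"
      using q * by simp
  next
    fix q assume "q \<in> Sigma (Pow ?V) (\<lambda>I. stable_sets wt m (induced G I))"
    then obtain I J where q: "q = (I, J)" "I \<subseteq> ?V" "J \<in> stable_sets wt m (induced G I)" by auto
    then show "(\<lambda>(J, K). (J \<union> K, J)) ((\<lambda>(I, J). (J, I - J)) q) = q"
      by (auto simp: stable_sets_induced)
    show "(\<lambda>(I, J). (J, I - J)) q \<in> Sigma (stable_sets wt m G) (\<lambda>J. Pow (?V - J))"
      using q unfolding stable_sets_induced by (auto simp: stable_sets_def)
  qed
  also have "\<dots> = (\<Sum>I\<in>Pow ?V. \<Sum>J\<in>stable_sets wt m (induced G I). ?t (I - J) (?V - I))"
    using fin finite_stable_sets[OF wf] by (intro sum.Sigma[symmetric]) auto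
  also have "\<dots> = (\<Sum>I\<in>Pow ?V. coloring_count wt (m # u) (induced G I) *
      coloring_count wt v (induced G (?V - I)))"
    by (auto simp: sum_distrib_right induced_induced intro!: sum.cong)
  finally show ?case .
qed

text \<open>
  Without edges between \<open>A\<close> and \<open>B\<close>, the two parts are colored independently, and the weight of
  each color class is the sum of the weights of its traces on \<open>A\<close> and \<open>B\<close>.
\<close>

lemma coloring_count_separated:
  assumes "wf_graph G" "verts G = A \<union> B" "A \<inter> B = {}" "\<forall>e\<in>edges G. e \<subseteq> A \<or> e \<subseteq> B"
  shows "coloring_count wt w G =
    convolution (\<lambda>u. coloring_count wt u (induced G A)) (\<lambda>v. coloring_count wt v (induced G B)) w"
  using assms
proof (induction w arbitrary: G A B)
  case (Cons m w)
  have fin: "finite A" "finite B" using wf_graph_finite[OF Cons.prems(1)] Cons.prems(2) by auto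
  have wf: "wf_graph (induced G I)" if "I \<subseteq> A \<union> B" for I
    using wf_induced[OF Cons.prems(1)] Cons.prems(2) that by simp
  let ?S = "\<lambda>p I. stable_sets wt p (induced G I)"
  let ?h = "\<lambda>J K. convolution (\<lambda>u. coloring_count wt u (induced G J))
    (\<lambda>v. coloring_count wt v (induced G K)) w"
  have fS: "finite (?S p I)" if "I \<subseteq> A \<union> B" for p I using finite_stable_sets[OF wf[OF that]] .
  have "coloring_count wt (m # w) G = (\<Sum>I\<in>stable_sets wt m G. ?h (A - I) (B - I))"
  proof (simp, rule sum.cong, rule refl)
    fix I assume "I \<in> stable_sets wt m G"
    have "coloring_count wt w (induced G (A \<union> B - I)) = convolution
        (\<lambda>u. coloring_count wt u (induced (induced G (A \<union> B - I)) (A - I)))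
        (\<lambda>v. coloring_count wt v (induced (induced G (A \<union> B - I)) (B - I))) w"
      using Cons.prems wf by (intro Cons.IH) auto
    moreover have "A - I \<subseteq> A \<union> B - I" "B - I \<subseteq> A \<union> B - I" by auto
    ultimately show "coloring_count wt w (induced G (verts G - I)) = ?h (A - I) (B - I)"
      by (simp add: induced_induced Cons.prems(2))
  qed
  \<comment> \<open>A first color class \<open>I\<close> is split into its traces \<open>J\<close> on \<open>A\<close>, of weight \<open>p\<close>, and \<open>K\<close> on \<open>B\<close>.\<close>
  also have "\<dots> = (\<Sum>(p, J, K)\<in>Sigma {..m} (\<lambda>p. ?S p A \<times> ?S (m - p) B). ?h (A - J) (B - K))"
  proof (rule sum.reindex_bij_witness[where i = "\<lambda>(p, J, K). J \<union> K"
        and j = "\<lambda>I. (set_weight wt G (I \<inter> A), I \<inter> A, I \<inter> B)"])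
    fix I assume I: "I \<in> stable_sets wt m G"
    then have sub: "I = (I \<inter> A) \<union> (I \<inter> B)" using Cons.prems(2) by (auto simp: stable_sets_def)
    have "m = set_weight wt G ((I \<inter> A) \<union> (I \<inter> B))"
      using I sub by (simp add: stable_sets_def)
    also have "\<dots> = set_weight wt G (I \<inter> A) + set_weight wt G (I \<inter> B)"
      using fin Cons.prems(3) by (intro set_weight_union) auto
    finally have m: "m = \<dots>" .
    show "(set_weight wt G (I \<inter> A), I \<inter> A, I \<inter> B) \<in> Sigma {..m} (\<lambda>p. ?S p A \<times> ?S (m - p) B)"
      using I m by (auto simp: stable_sets_induced stable_sets_def)
    show "(case (set_weight wt G (I \<inter> A), I \<inter> A, I \<inter> B) of (p, J, K) \<Rightarrow> J \<union> K) = I"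
      using sub by simp
    have "A - I \<inter> A = A - I" "B - I \<inter> B = B - I" by auto
    then show "(case (set_weight wt G (I \<inter> A), I \<inter> A, I \<inter> B) of (p, J, K) \<Rightarrow> ?h (A - J) (B - K)) =
        ?h (A - I) (B - I)" by simp
  next
    fix q assume "q \<in> Sigma {..m} (\<lambda>p. ?S p A \<times> ?S (m - p) B)"
    then obtain p J K where q: "q = (p, J, K)" "p \<le> m" "J \<in> ?S p A" "K \<in> ?S (m - p) B" by auto
    then have JK: "J \<subseteq> A" "K \<subseteq> B" by (auto simp: stable_sets_def)
    then have IA: "(J \<union> K) \<inter> A = J" and IB: "(J \<union> K) \<inter> B = K" using Cons.prems(3) by auto
    show "(set_weight wt G ((case q of (p, J, K) \<Rightarrow> J \<union> K) \<inter> A),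
        (case q of (p, J, K) \<Rightarrow> J \<union> K) \<inter> A, (case q of (p, J, K) \<Rightarrow> J \<union> K) \<inter> B) = q"
      using q by (simp add: IA IB stable_sets_def)
    have "set_weight wt G (J \<union> K) = set_weight wt G J + set_weight wt G K"
      using fin JK Cons.prems(3) by (intro set_weight_union) (auto intro: finite_subset)
    moreover have "\<not> e \<subseteq> J \<union> K" if "e \<in> edges G" for e
    proof
      assume "e \<subseteq> J \<union> K"
      then have "e \<subseteq> J \<or> e \<subseteq> K"
        using Cons.prems(4) that IA IB by blast
      then show False using q that by (auto simp: stable_sets_induced)
    qed
    ultimately show "(case q of (p, J, K) \<Rightarrow> J \<union> K) \<in> stable_sets wt m G"
      using q JK Cons.prems(2) by (auto simp: stable_sets_def)
  qed
  also have "\<dots> = (\<Sum>p\<le>m. \<Sum>J\<in>?S p A. \<Sum>K\<in>?S (m - p) B. ?h (A - J) (B - K))"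
    using fS by (simp add: sum.Sigma sum.cartesian_product)
  also have "\<dots> = convolution (\<lambda>u. coloring_count wt u (induced G A))
      (\<lambda>v. coloring_count wt v (induced G B)) (m # w)"
    by (simp add: convolution_sum_left convolution_sum_right induced_induced)
  finally show ?case .
qed simp

definition weighted_colorings :: "('d \<Rightarrow> nat) \<Rightarrow> nat list \<Rightarrow> ('v, 'd) dgraph \<Rightarrow> ('v \<Rightarrow> nat) set"
  where "weighted_colorings wt u G =
    {f \<in> verts G \<rightarrow>\<^sub>E {1..length u}. (\<forall>x y. {x, y} \<in> edges G \<longrightarrow> f x \<noteq> f y) \<and>
      (\<forall>i<length u. color_weight wt G f (Suc i) = u ! i)}"

lemma finite_weighted_colorings: "wf_graph G \<Longrightarrow> finite (weighted_colorings wt u G)"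
  by (rule finite_subset[of _ "verts G \<rightarrow>\<^sub>E {1..length u}"])
     (auto simp: weighted_colorings_def wf_graph_finite intro!: finite_PiE)

lemma color_weight_set_weight:
  "color_weight wt G f i = set_weight wt G {x \<in> verts G. f x = i}"
  by (simp add: color_weight_def set_weight_def)

text \<open>
  Removing the class of color \<open>1\<close> and decreasing all other colors by one is a bijection.
\<close>

lemma card_weighted_colorings_Cons:
  assumes wf: "wf_graph G"
  shows "card (weighted_colorings wt (m # u) G) =
    card (Sigma (stable_sets wt m G) (\<lambda>I. weighted_colorings wt u (induced G (verts G - I))))"
proof (rule bij_betw_same_card)
  let ?V = "verts G"
  let ?first = "\<lambda>f. {x \<in> ?V. f x = (1 :: nat)}"
  let ?split = "\<lambda>f. (?first f, restrict (\<lambda>x. f x - 1) (?V - ?first f))"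
  let ?glue = "\<lambda>(I, g). restrict (\<lambda>x. if x \<in> I then 1 else Suc (g x)) ?V"
  show "bij_betw ?split (weighted_colorings wt (m # u) G)
    (Sigma (stable_sets wt m G) (\<lambda>I. weighted_colorings wt u (induced G (?V - I))))"
  proof (rule bij_betw_byWitness[where f' = ?glue]; (intro ballI)?)
    fix f assume f: "f \<in> weighted_colorings wt (m # u) G"
    have f1: "1 \<le> f x" if "x \<in> ?V" for x using f that by (auto simp: weighted_colorings_def)
    have "f x = undefined" if "x \<notin> ?V" for x using f that by (auto simp: weighted_colorings_def)
    then show "?glue (?split f) = f"
      using f1 by (force simp: fun_eq_iff)
  next
    fix q assume "q \<in> Sigma (stable_sets wt m G) (\<lambda>I. weighted_colorings wt u (induced G (?V - I)))"
    then obtain I g where q: "q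
        = (I, g)" "I \<subseteq> ?V" "g \<in> weighted_colorings wt u (induced G (?V - I))"
      by (auto simp: stable_sets_def)
    have g: "1 \<le> g x" if "x \<in> ?V - I" for x using q that
      by (auto simp: weighted_colorings_def PiE_iff)
    have "g x = undefined" if "x \<notin> ?V - I" for x
      using q that unfolding weighted_colorings_def by (auto simp: PiE_iff extensional_def)
    moreover have first: "?first (?glue (I, g)) = I"
    proof -
      have "\<forall>x\<in>?V - I. g x \<noteq> 0" using g by fastforce
      then show ?thesis using q(2) by auto (metis DiffI less_irrefl)+
    qed
    ultimately show "?split (?glue q) = q"
      unfolding q(1) first using g q(2) by (auto simp: fun_eq_iff)
  next
    show "?split ` weighted_colorings wt (m # u) G \<subseteq>
        (Sigma (stable_sets wt m G) (\<lambda>I. weighted_colorings wt u (induced G (?V - I))))"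
    proof (rule image_subsetI)
      fix f assume f: "f \<in> weighted_colorings wt (m # u) G"
      let ?I = "?first f" and ?g = "restrict (\<lambda>x. f x - 1) (?V - ?first f)"
      have range: "1 \<le> f x" "f x \<le> Suc (length u)" if "x \<in> ?V" for x
        using f that by (auto simp: weighted_colorings_def)
      have valid: "f x \<noteq> f y" if "{x, y} \<in> edges G" for x y
        using f that by (auto simp: weighted_colorings_def)
      have weight: "color_weight wt G f (Suc i) = (m # u) ! i" if "i < Suc (length u)" for i
        using f that by (auto simp: weighted_colorings_def)
      have "\<not> e \<subseteq> ?I" if "e \<in> edges G" for e
        using wf that by (rule wf_graph_edgeE) (use valid that in force)
      then have 1: "?I \<in> stable_sets wt m G"
        using weight[of 0] by (auto simp: stable_sets_def color_weight_set_weight)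
      have "?g \<in> ?V - ?I \<rightarrow>\<^sub>E {1..length u}"
      proof (rule PiE_I)
        fix x assume "x \<in> ?V - ?I"
        then show "?g x \<in> {1..length u}" using range[of x] by auto
      qed simp
      moreover have "?g x \<noteq> ?g y" if "{x, y} \<in> edges G" "{x, y} \<subseteq> ?V - ?I" for x y
        using valid[OF that(1)] that(2) range[of x] range[of y] by auto
      moreover have "color_weight wt (induced G (?V - ?I)) ?g (Suc i) = u ! i"
        if "i < length u" for i
      proof -
        have "{x \<in> ?V - ?I. ?g x = Suc i} = {x \<in> ?V. f x = Suc (Suc i)}"
          using range by (auto; force)
        then show ?thesis
          using weight[of "Suc i"] that by (simp add: color_weight_set_weight)
      qed
      ultimately show "?split f \<in>
          Sigma (stable_sets wt m G) (\<lambda>I. weighted_colorings wt u (induced G (?V - I)))"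
        using 1 by (auto simp: weighted_colorings_def)
    qed
  next
    show "?glue ` (Sigma (stable_sets wt m G) (\<lambda>I. weighted_colorings wt u (induced G (?V - I)))) \<subseteq>
        weighted_colorings wt (m # u) G"
    proof (rule image_subsetI)
      fix q assume "q \<in> Sigma (stable_sets wt m G) (\<lambda>I. weighted_colorings wt u (induced G (?V - I)))"
      then obtain I g where q: "q = (I, g)" and I: "I \<in> stable_sets wt m G"
        and g: "g \<in> weighted_colorings wt u (induced G (?V - I))" by auto
      let ?f = "?glue (I, g)"
      have sub: "I \<subseteq> ?V" using I by (simp add: stable_sets_def)
      have range: "1 \<le> g x" "g x \<le> length u" if "x \<in> ?V - I" for x
        using g that by (auto simp: weighted_colorings_def PiE_iff)
      have "?f \<in> ?V \<rightarrow>\<^sub>E {1..Suc (length u)}"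
        using range by (auto simp: PiE_iff)
      moreover have "?f x \<noteq> ?f y" if xy: "{x, y} \<in> edges G" for x y
      proof -
        have V: "x \<in> ?V" "y \<in> ?V" using xy wf by (auto simp: wf_graph_def)
        have "\<not> {x, y} \<subseteq> I" using I xy unfolding stable_sets_def by blast
        moreover have "g x \<noteq> g y" if "x \<notin> I" "y \<notin> I"
          using g xy V that by (auto simp: weighted_colorings_def)
        ultimately show ?thesis using V range[of x] range[of y] by auto
      qed
      moreover have "color_weight wt G ?f (Suc i) = (m # u) ! i" if "i < Suc (length u)" for i
      proof (cases i)
        case 0
        have "{x \<in> ?V. ?f x = Suc 0} = I" 
        proof -
          have "\<forall>x\<in>?V - I. g x \<noteq> 0" using range(1) by fastforce
          then show ?thesis using sub by auto (metis DiffI less_irrefl)+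
        qed
        then show ?thesis using I 0 by (simp add: color_weight_set_weight stable_sets_def)
      next
        case (Suc j)
        have "{x \<in> ?V. ?f x = Suc (Suc j)} = {x \<in> ?V - I. g x = Suc j}" using sub by auto
        then show ?thesis
          using g Suc that by (simp add: color_weight_set_weight weighted_colorings_def)
      qed
      ultimately show "?glue q \<in> weighted_colorings wt (m # u) G"
        unfolding q weighted_colorings_def by simp
    qed
  qed
qed

lemma coloring_count_eq_card:
  "wf_graph G \<Longrightarrow> coloring_count wt u G = of_nat (card (weighted_colorings wt u G))"
proof (induction u arbitrary: G)
  case (Nil G)
  show ?case
  proof (cases "verts G = {}")
    case True
    with Nil have "edges G = {}" by (auto simp: wf_graph_def)
    then show ?thesis using True by (simp add: weighted_colorings_def)
  next
    case False
    then have "verts G \<rightarrow>\<^sub>E {1..length ([] :: nat list)} = {}"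
      by (auto simp: PiE_eq_empty_iff)
    then show ?thesis using False unfolding weighted_colorings_def by simp
  qed
next
  case (Cons m u)
  have wf: "wf_graph (induced G (verts G - I))" for I
    using Cons.prems by (rule wf_induced) auto
  show ?case
    using finite_stable_sets[OF Cons.prems] finite_weighted_colorings[OF wf]
    by (simp add: card_weighted_colorings_Cons[OF Cons.prems] Cons.IH wf)
qed

section \<open>The coefficients of the chromatic morphism\<close>

lemma coloring_count_zero:
  assumes "\<forall>d. wt d > 0" "wf_graph G"
  shows "coloring_count wt (0 # u) G = coloring_count wt u G"
proof -
  have "e \<noteq> {}" if "e \<in> edges G" for e using assms(2) that by (auto simp: wf_graph_def)
  then have "stable_sets wt 0 G = {{}}"
    using set_weight_eq_0[OF assms(1), of _ G] wf_graph_finite[OF assms(2)]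
    by (auto simp: stable_sets_def dest: finite_subset)
  then show ?thesis using assms(2) by (simp add: induced_verts)
qed

text \<open>
  Since weights are positive, the only class of weight \<open>0\<close> is empty, so that zeros can be dropped
  from \<open>u\<close>, as they can in \<open>monomial_coeff\<close>.
\<close>

lemma coloring_count_filter:
  assumes "\<forall>d. wt d > 0" "wf_graph G"
  shows "coloring_count wt (filter (\<lambda>a. a \<noteq> 0) u) G = coloring_count wt u G"
  using assms(2)
proof (induction u arbitrary: G)
  case (Cons m u)
  show ?case
  proof (cases "m = 0")
    case True
    have "coloring_count wt (filter (\<lambda>a. a \<noteq> 0) (m # u)) G = coloring_count wt u G"
      using True Cons by simp
    also have "\<dots> = coloring_count wt (m # u) G"
      using True by (simp only: coloring_count_zero[OF assms(1) Cons.prems])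
    finally show ?thesis .
  next
    case False
    have "wf_graph (induced G (verts G - I))" for I
      using Cons.prems by (rule wf_induced) auto
    with False Cons.IH show ?thesis by simp
  qed
qed simp

lemma packed_valid_colorings_positive:
  assumes "\<forall>d. wt d > 0" "wf_graph G" "f \<in> packed_valid_colorings G"
  shows "f ` verts G = {1..max_color G f}"
    and "0 \<notin> set (map (color_weight wt G f) [1..<Suc (max_color G f)])"
proof -
  have fin: "finite (verts G)" using assms(2) by (rule wf_graph_finite)
  obtain k where k: "f ` verts G = {1..k}" using assms(3) by (auto simp: packed_valid_colorings_def)
  have "max_color G f = k"
    unfolding max_color_def k by (rule Max_eqI) auto
  then show im: "f ` verts G = {1..max_color G f}" using k by simp
  have "color_weight wt G f i \<noteq> 0" if "i \<in> {1..max_color G f}" for i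
  proof -
    have "{x \<in> verts G. f x = i} \<noteq> {}" using that unfolding im[symmetric] by auto
    then show ?thesis using fin by (simp add: color_weight_set_weight set_weight_eq_0[OF assms(1)])
  qed
  then show "0 \<notin> set (map (color_weight wt G f) [1..<Suc (max_color G f)])"
    unfolding set_map set_upt by (metis atLeastLessThanSuc_atLeastAtMost imageE)
qed

text \<open>
  If the prescribed weights are positive, then no color class is empty, and the coloring is
  packed.
\<close>

lemma packed_valid_colorings_of_weight:
  assumes "\<forall>d. wt d > 0" "wf_graph G" "0 \<notin> set u"
  shows "{f \<in> packed_valid_colorings G. map (color_weight wt G f) [1..<Suc (max_color G f)] = u} =
    weighted_colorings wt u G" (is "?L = ?R")
proof
  show "?L \<subseteq> ?R"
  proof
    fix f assume "f \<in> ?L"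
    then have f: "f \<in> packed_valid_colorings G"
      and u: "map (color_weight wt G f) [1..<Suc (max_color G f)] = u" by auto
    have len: "length u = max_color G f" using u by auto
    have "color_weight wt G f (Suc i) = u ! i" if "i < length u" for i
      using that len unfolding u[symmetric] by (simp del: upt_Suc)
    then show "f \<in> ?R"
      using f packed_valid_colorings_positive(1)[OF assms(1,2) f] len
      by (auto simp: weighted_colorings_def packed_valid_colorings_def PiE_iff)
  qed
  show "?R \<subseteq> ?L"
  proof
    fix f assume f: "f \<in> ?R"
    have "i \<in> f ` verts G" if i: "i \<in> {1..length u}" for i
    proof -
      obtain j where j: "i = Suc j" "j < length u" using i by (cases i) auto
      have "color_weight wt G f i = u ! j"
        using f j by (simp add: weighted_colorings_def)
      moreover have "u ! j \<in> set u" using j by simp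
      ultimately have "color_weight wt G f i \<noteq> 0" using assms(3) by metis
      then have "{x \<in> verts G. f x = i} \<noteq> {}" unfolding color_weight_def by (metis sum.empty)
      then show ?thesis by auto
    qed
    then have im: "f ` verts G = {1..length u}"
      using f by (auto simp: weighted_colorings_def PiE_iff)
    have "max_color G f = length u"
      unfolding max_color_def im by (rule Max_eqI) (auto simp: Suc_le_eq)
    moreover from f im have "f \<in> packed_valid_colorings G"
      by (auto simp: weighted_colorings_def packed_valid_colorings_def PiE_iff)
    moreover have "map (color_weight wt G f) [1..<Suc (length u)] = u"
    proof (rule nth_equalityI)
      show len: "length (map (color_weight wt G f) [1..<Suc (length u)]) = length u"
        by (simp only: length_map length_upt diff_Suc_1 One_nat_def)
      fix i assume "i < length (map (color_weight wt G f) [1..<Suc (length u)])"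
      then have "i < length u" unfolding len .
      then show "map (color_weight wt G f) [1..<Suc (length u)] ! i = u ! i"
        using f by (simp add: weighted_colorings_def del: upt_Suc)
    qed
    ultimately show "f \<in> ?L" by (simp del: upt_Suc)
  qed
qed

lemma monomial_coeff_chromatic:
  assumes "\<forall>d. wt d > 0" "wf_graph G"
  shows "monomial_coeff (chromatic wt G) u = coloring_count wt u G"
proof -
  let ?u = "filter (\<lambda>a. a \<noteq> 0) u"
  let ?w = "\<lambda>f. map (color_weight wt G f) [1..<Suc (max_color G f)]"
  have "monomial_coeff (chromatic wt G) u =
      (\<Sum>f\<in>packed_valid_colorings G. of_bool (?u = ?w f))"
    unfolding chromatic_def monomial_coeff_sum
  proof (rule sum.cong[OF refl])
    fix f assume "f \<in> packed_valid_colorings G"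
    then show "monomial_coeff (qmon (?w f)) u = of_bool (?u = ?w f)"
      by (intro monomial_coeff_qmon packed_valid_colorings_positive(2)[OF assms])
  qed
  also have "\<dots> = of_nat (card {f \<in> packed_valid_colorings G. ?w f = ?u})"
  proof -
    have "packed_valid_colorings G \<inter> {f. ?u = ?w f} = {f \<in> packed_valid_colorings G. ?w f = ?u}"
      by (rule set_eqI) (simp only: Int_iff mem_Collect_eq eq_commute[of ?u])
    then show ?thesis
      by (simp only: sum_of_bool_eq finite_packed_valid_colorings[OF assms(2)])
  qed
  also have "\<dots> = coloring_count wt u G"
  proof -
    have "0 \<notin> set ?u" by simp
    then have "card {f \<in> packed_valid_colorings G. ?w f = ?u} = card (weighted_colorings wt ?u G)"
      by (rule arg_cong[where f = card, OF packed_valid_colorings_of_weight[OF assms]])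
    then show ?thesis
      by (simp only: coloring_count_eq_card[OF assms(2), symmetric] coloring_count_filter[OF assms])
  qed
  finally show ?thesis .
qed

text \<open>
  Invariance is inherited from the chromatic quasisymmetric function, whose coefficients these
  numbers are.
\<close>

lemma coloring_count_iso:
  assumes "\<forall>d. wt d > 0" "isomorphic G H"
  shows "coloring_count wt u G = coloring_count wt u H"
  using monomial_coeff_chromatic[OF assms(1)] chromatic_iso[OF assms(2)] assms(2)
  by (metis isomorphic_def)

lemma chromatic_empty:
  assumes "\<forall>d. wt d > 0" "wf_graph G" "verts G = {}"
  shows "chromatic wt G = qmon []"
proof (rule qsym_eqI)
  fix u :: "nat list" assume u: "0 \<notin> set u"
  have "coloring_count wt u G = of_bool (u = [])"
  proof (cases u)
    case (Cons m v)
    then have "stable_sets wt m G = {}" using u assms(3)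
      by (auto simp: stable_sets_def set_weight_def)
    then show ?thesis using Cons by simp
  qed (simp add: assms(3))
  moreover have "filter (\<lambda>a. a \<noteq> 0) u = u" using u by (intro filter_True) (auto intro!: gr0I)
  ultimately show "monomial_coeff (chromatic wt G) u = monomial_coeff (qmon []) u"
    unfolding monomial_coeff_chromatic[OF assms(1,2)]
      by (simp only: monomial_coeff_qmon list.set empty_iff not_False_eq_True)
qed

lemma F_chr_iclass: "wf_graph G \<Longrightarrow> F_chr wt (basis (iclass G)) = chromatic wt G"
  by (simp add: F_chr_def class_chromatic_iclass)

lemma iso_graph_cases:
  obtains G :: "(nat, 'd) dgraph" where "wf_graph G" "g = iclass G"
proof -
  let ?G = "rep_iso_graph g"
  have "isomorphic ?G ?G" by (rule Quotient3_rep_reflp[OF Quotient3_iso_graph])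
  then have wf: "wf_graph ?G" by (simp add: isomorphic_def)
  have "g = iclass ?G"
    by (simp add: iclass_nat[OF wf] Quotient3_abs_rep[OF Quotient3_iso_graph])
  with wf show ?thesis by (rule that)
qed

lemma iclass_weight: "wf_graph G \<Longrightarrow> class_weight wt (iclass G) = set_weight wt G (verts G)"
proof -
  assume "wf_graph G"
  then obtain H where H: "isomorphic G H" "isomorphic H H" "iclass G = abs_iso_graph H"
    by (rule iclass_rep)
  then obtain \<phi> where "bij_betw \<phi> (verts G) (verts H)" "\<forall>x\<in>verts G. dec H (\<phi> x) = dec G x"
    by (auto simp: isomorphic_def iso_via_def)
  then have "set_weight wt G (verts G) = set_weight wt H (verts H)"
    unfolding set_weight_def by (simp flip: sum.reindex_bij_betw)
  then show ?thesis using H by (simp add: class_weight.abs_eq set_weight_def)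
qed

lemma class_edgeless_iclass: "wf_graph G \<Longrightarrow> class_edgeless (iclass G) \<longleftrightarrow> edges G = {}"
proof -
  assume "wf_graph G"
  then obtain H where H: "isomorphic G H" "isomorphic H H" "iclass G = abs_iso_graph H"
    by (rule iclass_rep)
  then have "edges G = {} \<longleftrightarrow> edges H = {}" by (auto simp: isomorphic_def iso_via_def)
  then show ?thesis using H by (simp add: class_edgeless.abs_eq)
qed

lemma iclass_eq_empty_iff:
  assumes "wf_graph G"
  shows "iclass G = iclass (empty_graph :: (nat, 'd) dgraph) \<longleftrightarrow> verts (G :: ('v, 'd) dgraph) = {}"
  unfolding iclass_eq_iff[OF assms wf_empty_graph]
proof
  assume "isomorphic G (empty_graph :: (nat, 'd) dgraph)"
  then show "verts G = {}"
    by (auto simp: isomorphic_def iso_via_def empty_graph_def bij_betw_def)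
next
  assume "verts G = {}"
  moreover from this have "edges G = {}" using assms by (auto simp: wf_graph_def)
  ultimately have "iso_via (\<lambda>_. 0) G (empty_graph :: (nat, 'd) dgraph)"
    by (simp add: iso_via_def empty_graph_def bij_betw_def)
  then show "isomorphic G (empty_graph :: (nat, 'd) dgraph)" using assms by (rule isomorphicI)
qed

section \<open>Products, the splitting coproduct and the counits\<close>

lemma qsym_tensor_eqI:
  assumes "\<And>u v. 0 \<notin> set u \<Longrightarrow> 0 \<notin> set v \<Longrightarrow>
    Poly_Mapping.lookup x (Composition u, Composition v) =
    Poly_Mapping.lookup y (Composition u, Composition v)"
  shows "x = y"
proof (rule poly_mapping_eqI)
  fix p :: "composition \<times> composition"
  obtain c d where p: "p = (c, d)" by (cases p)
  show "Poly_Mapping.lookup x p = Poly_Mapping.lookup y p"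
    using assms[OF letters_positive letters_positive, of c d] by (simp add: p letters_inverse)
qed

lemma finite_append_splits: "finite {(u, v). u @ v = w}"
proof -
  have "{(u, v). u @ v = w} \<subseteq> (\<lambda>n. (take n w, drop n w)) ` {..length w}"
  proof
    fix p assume "p \<in> {(u, v). u @ v = w}"
    then obtain u v where "p = (u, v)" "u @ v = w" by auto
    then show "p \<in> (\<lambda>n. (take n w, drop n w)) ` {..length w}"
      by (intro image_eqI[of _ _ "length u"]) auto
  qed
  then show ?thesis by (rule finite_subset) simp
qed

lemma lookup_deconcatenation:
  assumes "0 \<notin> set u" "0 \<notin> set v"
  shows "Poly_Mapping.lookup (lin_ext deconcatenation x) (Composition u, Composition v) =
    monomial_coeff x (u @ v)"
proof (induction x rule: basis_induct)
  case (basis c)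
  let ?A = "{(a, b). a @ b = letters c}"
  have "Poly_Mapping.lookup (lin_ext deconcatenation (basis c)) (Composition u, Composition v) =
      (\<Sum>p\<in>?A. if p = (u, v) then 1 else 0)"
    unfolding lin_ext_basis deconcatenation_def lookup_sum
  proof (rule sum.cong[OF refl])
    fix p assume p: "p \<in> ?A"
    obtain a b where ab: "p = (a, b)" by (cases p)
    have "0 \<notin> set (a @ b)" using p letters_positive[of c] by (simp add: ab)
    then show "Poly_Mapping.lookup (case p of (a, b) \<Rightarrow> tensor (qmon a) (qmon b))
        (Composition u, Composition v) = (if p = (u, v) then 1 else 0)"
      using assms by (simp add: ab lookup_tensor qmon_def lookup_basis Composition_eq_iff)
  qed
  also have "\<dots> = of_bool (u @ v = letters c)"
    using finite_append_splits[of "letters c"] by simp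
  also have "\<dots> = monomial_coeff (basis c) (u @ v)"
  proof -
    have "filter (\<lambda>a. a \<noteq> 0) (u @ v) = u @ v" using assms by (intro filter_True) (auto intro!: gr0I)
    then show ?thesis unfolding monomial_coeff_basis packs_to_def by simp
  qed
  finally show ?case .
qed (simp_all add: linear_map_add[OF linear_lin_ext] linear_map_scale[OF linear_lin_ext]
    lookup_add monomial_coeff_add monomial_coeff_scale)

lemma lookup_tensor_map_split:
  "Poly_Mapping.lookup (tensor_map \<Phi> \<Psi> (split_coproduct G)) (c, d) =
    (\<Sum>I\<in>Pow (verts G). Poly_Mapping.lookup (\<Phi> (basis (iclass (induced G I)))) c *
      Poly_Mapping.lookup (\<Psi> (basis (iclass (induced G (verts G - I))))) d)"
  by (simp add: split_coproduct_def linear_map_sum[OF linear_tensor_map] lookup_sum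
      tensor_map_basis lookup_tensor)

lemma tensor_map_split:
  "tensor_map \<Phi> \<Psi> (split_coproduct G) =
    (\<Sum>I\<in>Pow (verts G). tensor (\<Phi> (basis (iclass (induced G I))))
      (\<Psi> (basis (iclass (induced G (verts G - I))))))"
  by (simp add: split_coproduct_def linear_map_sum[OF linear_tensor_map] tensor_map_basis)

lemma F_chr_split:
  assumes "\<forall>d. wt d > 0" "wf_graph G"
  shows "lin_ext deconcatenation (chromatic wt G) =
    tensor_map (F_chr wt) (F_chr wt) (split_coproduct G)"
proof (rule qsym_tensor_eqI)
  fix u v :: "nat list" assume uv: "0 \<notin> set u" "0 \<notin> set v"
  show "Poly_Mapping.lookup (lin_ext deconcatenation (chromatic wt G))
    (Composition u, Composition v) =
      Poly_Mapping.lookup (tensor_map (F_chr wt) (F_chr wt) (split_coproduct G))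
        (Composition u, Composition v)"
    unfolding lookup_deconcatenation[OF uv] lookup_tensor_map_split
      monomial_coeff_chromatic[OF assms] coloring_count_append[OF assms(2)]
      monomial_coeff_positive[OF uv(1), symmetric] monomial_coeff_positive[OF uv(2), symmetric]
    by (intro sum.cong refl)
       (simp add: F_chr_iclass wf_induced assms monomial_coeff_chromatic[OF assms(1)])
qed

text \<open>
  The color classes partition the vertices, so their weights add up to the weight of the graph.
\<close>

lemma keys_chromatic_degree:
  assumes "\<forall>d. wt d > 0" "wf_graph G" "c \<in> Poly_Mapping.keys (chromatic wt G)"
  shows "composition_degree c = set_weight wt G (verts G)"
proof -
  have "coloring_count wt u G \<noteq> 0 \<Longrightarrow> sum_list u = set_weight wt G (verts G)" for u
    using assms(2)
  proof (induction u arbitrary: G)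
    case Nil
    then show ?case by (auto simp: set_weight_def)
  next
    case (Cons m u)
    then obtain I where I: "I \<in> stable_sets wt m G"
      "coloring_count wt u (induced G (verts G - I)) \<noteq> 0"
      by (auto elim: sum.not_neutral_contains_not_neutral)
    have "sum_list u = set_weight wt G (verts G - I)"
      using Cons.IH[OF I(2) wf_induced[OF Cons.prems(2)]] by simp
    moreover have "I \<subseteq> verts G" "set_weight wt G I = m" using I(1) by (auto simp: stable_sets_def)
    moreover have "finite (verts G)" using Cons.prems(2) by (rule wf_graph_finite)
    ultimately show ?case
      using set_weight_union[of I "verts G - I" wt G] by (auto simp: Un_absorb1 finite_subset)
  qed
  moreover have "coloring_count wt (letters c) G \<noteq> 0"
    using assms(3) monomial_coeff_chromatic[OF assms(1,2), of "letters c"]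
    by (simp add: in_keys_iff lookup_eq_monomial_coeff)
  ultimately show ?thesis by (simp add: composition_degree_def)
qed

lemma form_ext_qsym_empty:
  "form_ext (\<lambda>u. if letters u = [] then 1 else 0) x = monomial_coeff x []"
proof (induction x rule: basis_induct)
  case (basis c)
  then show ?case by (simp add: form_ext_basis monomial_coeff_basis packs_to_empty)
qed (simp_all add: form_ext_add form_ext_scale monomial_coeff_add monomial_coeff_scale)

text \<open>
  In degree \<open>m > 0\<close>, the only composition with at most one letter is \<open>(m)\<close>.
\<close>

lemma form_ext_qsym_homogeneous:
  assumes "x \<in> homogeneous_component composition_degree m" "0 < m"
  shows "form_ext (\<lambda>u. if length (letters u) \<le> 1 then 1 else 0) x = monomial_coeff x [m]"
proof -
  let ?m = "Composition [m]"
  have eq: "length (letters c) \<le> 1 \<longleftrightarrow> c = ?m" if "c \<in> Poly_Mapping.keys x" for c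
  proof
    assume "length (letters c) \<le> 1"
    moreover have "sum_list (letters c) = m"
      using assms(1) that by (simp add: homogeneous_component_def composition_degree_def)
    ultimately have "letters c = [m]" using assms(2) by (cases "letters c") auto
    then show "c = ?m" by (metis letters_inverse)
  next
    assume "c = ?m"
    then show "length (letters c) \<le> 1" using assms(2) by (simp add: letters_Composition)
  qed
  have "form_ext (\<lambda>u. if length (letters u) \<le> 1 then 1 else 0) x =
      (\<Sum>c\<in>Poly_Mapping.keys x. if c = ?m then Poly_Mapping.lookup x c else 0)"
    unfolding form_ext_def using eq by (intro sum.cong) auto
  also have "\<dots> = monomial_coeff x [m]"
    using assms(2) by (simp add: monomial_coeff_positive in_keys_iff)
  finally show ?thesis .
qed

lemma coloring_count_single:
  assumes "wf_graph G"
  shows "coloring_count wt [m] G = of_bool (edges G = {} \<and> set_weight wt G (verts G) = m)"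
proof -
  have "coloring_count wt [m] G = (\<Sum>I\<in>stable_sets wt m G. of_bool (verts G - I = {}))" by simp
  also have "\<dots> = (\<Sum>I\<in>stable_sets wt m G \<inter> {verts G}. 1)"
    using finite_stable_sets[OF assms]
    by (intro sum.mono_neutral_cong_right) (auto simp: stable_sets_def)
  also have "stable_sets wt m G \<inter> {verts G} =
      (if edges G = {} \<and> set_weight wt G (verts G) = m then {verts G} else {})"
    using assms by (auto simp: stable_sets_def wf_graph_def)
  finally show ?thesis by simp
qed

text \<open>
  The counit sees only the colorings with at most one color, and these are proper exactly when
  there are no edges.
\<close>

lemma F_chr_counit_delta:
  assumes wt: "\<forall>d. wt d > 0" and "wf_graph G"
  shows "form_ext (\<lambda>u. if length (letters u) \<le> 1 then 1 else 0) (chromatic wt G)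
      = of_bool (edges G = {})"
proof (cases "verts G = {}")
  case True
  then have e: "edges G = {}" using assms(2) by (auto simp: wf_graph_def)
  have "chromatic wt G = basis (Composition [])"
    using chromatic_empty[OF assms True] by (simp add: qmon_def)
  then show ?thesis using e by (simp add: form_ext_basis letters_Composition)
next
  case False
  define m where "m = set_weight wt G (verts G)"
  have "0 < m" using False wt assms(2) set_weight_eq_0[of wt "verts G" G]
    by (simp add: m_def wf_graph_finite)
  moreover have "chromatic wt G \<in> homogeneous_component composition_degree m"
    using keys_chromatic_degree[OF assms] by (simp add: homogeneous_component_def m_def)
  ultimately have *: "form_ext (\<lambda>u. if length (letters u) \<le> 1 then 1 else 0) (chromatic wt G) =
      coloring_count wt [m] G"
    by (simp only: form_ext_qsym_homogeneous monomial_coeff_chromatic[OF assms])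
  then show ?thesis by (simp only: coloring_count_single[OF assms(2)] m_def simp_thms)
qed

text \<open>
  The two summands are separated inside the disjoint union, and the induced graphs on them are
  copies of \<open>G\<close> and \<open>H\<close>.
\<close>

lemma chromatic_disjoint_union:
  fixes G :: "('v, 'd) dgraph" and H :: "('w, 'd) dgraph"
  assumes wt: "\<forall>d. wt d > 0" and G: "wf_graph G" and H: "wf_graph H"
  shows "chromatic wt (disjoint_union G H) = qsym_mult (chromatic wt G) (chromatic wt H)"
proof (rule qsym_eqI)
  fix u :: "nat list"
  let ?U = "disjoint_union G H"
  have wf: "wf_graph ?U" using G H by (rule wf_disjoint_union)
  have U: "verts ?U = Inl ` verts G \<union> Inr ` verts H"
    "edges ?U = (`) Inl ` edges G \<union> (`) Inr ` edges H"
    by (auto simp: disjoint_union_def)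
  have Inl: "Inl ` e \<subseteq> Inl ` verts G" "\<not> Inl ` e \<subseteq> Inr ` verts H" if "e \<in> edges G" for e
    using wf_graph_edge[OF G that] by auto
  have Inr: "Inr ` e \<subseteq> Inr ` verts H" "\<not> Inr ` e \<subseteq> Inl ` verts G" if "e \<in> edges H" for e
    using wf_graph_edge[OF H that] by auto
  have sub: "e \<in> edges ?U \<and> e \<subseteq> Inl ` verts G \<longleftrightarrow> e \<in> (`) Inl ` edges G"
    "e \<in> edges ?U \<and> e \<subseteq> Inr ` verts H \<longleftrightarrow> e \<in> (`) Inr ` edges H" for e
    unfolding U using Inl Inr by (metis UnE UnI1 UnI2 imageE)+
  have "edges (induced ?U (Inl ` verts G)) = (`) Inl ` edges G"
    "edges (induced ?U (Inr ` verts H)) = (`) Inr ` edges H"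
    by (simp_all add: sub)
  then have "iso_via Inl G (induced ?U (Inl ` verts G))" "iso_via Inr H (induced ?U (Inr ` verts H))"
    by (simp_all add: iso_via_def bij_betw_def) (simp_all add: disjoint_union_def)
  then have "isomorphic G (induced ?U (Inl ` verts G))" "isomorphic H (induced ?U (Inr ` verts H))"
    using G H isomorphicI by blast+
  note iso = this[THEN coloring_count_iso[OF wt], symmetric]
  have "coloring_count wt u ?U = convolution (\<lambda>u. coloring_count wt u (induced ?U (Inl ` verts G)))
      (\<lambda>v. coloring_count wt v (induced ?U (Inr ` verts H))) u"
    using wf
  proof (rule coloring_count_separated)
    show "verts ?U = Inl ` verts G \<union> Inr ` verts H" by (rule U)
    show "\<forall>e\<in>edges ?U. e \<subseteq> Inl ` verts G \<or> e \<subseteq> Inr ` verts H"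
      unfolding U using Inl(1) Inr(1) by blast
  qed auto
  then show "monomial_coeff (chromatic wt ?U) u =
      monomial_coeff (qsym_mult (chromatic wt G) (chromatic wt H)) u"
    unfolding iso monomial_coeff_qsym_mult
    by (simp add: monomial_coeff_chromatic[OF wt wf] monomial_coeff_chromatic[OF wt G, abs_def]
      monomial_coeff_chromatic[OF wt H, abs_def])
qed

section \<open>Stable sets of contractions\<close>

lemma equiv_quotient_class:
  assumes "equiv A r" "c \<in> A // r" "x \<in> c"
  shows "c = r `` {x}" and "x \<in> A"
proof -
  show "x \<in> A" using in_quotient_imp_subset[OF assms(1,2)] assms(3) by blast
  obtain a where "a \<in> A" "c = r `` {a}" using assms(2) by (rule quotientE)
  then show "c = r `` {x}" using assms(1,3) by (metis Image_singleton_iff equiv_class_eq)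
qed

text \<open>
  A set \<open>C\<close> of classes cuts an equivalence relation into its restrictions to \<open>\<Union>C\<close> and to the
  complement of \<open>\<Union>C\<close>.
\<close>

lemma restrict_saturated:
  assumes r: "equiv A r" and C: "C \<subseteq> A // r"
  shows "equiv (\<Union>C) (r \<inter> \<Union>C \<times> \<Union>C)"
    and "\<Union>C // (r \<inter> \<Union>C \<times> \<Union>C) = C"
    and "A - \<Union>C = \<Union>(A // r - C)"
    and "r = (r \<inter> \<Union>C \<times> \<Union>C) \<union> (r \<inter> (A - \<Union>C) \<times> (A - \<Union>C))"
proof -
  let ?I = "\<Union>C"
  have I: "?I \<subseteq> A" using C Union_quotient[OF r] by blast
  have cls: "r `` {x} \<in> C" if x: "x \<in> ?I" for x
  proof -
    obtain c where c: "c \<in> C" "x \<in> c" using x by blast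
    then have "c = r `` {x}" using C by (intro equiv_quotient_class(1)[OF r]) auto
    then show ?thesis using c(1) by simp
  qed
  have sat: "y \<in> ?I" if "(x, y) \<in> r" "x \<in> ?I" for x y using cls[OF that(2)] that(1) by blast
  have rA: "r \<subseteq> A \<times> A" and refl: "refl_on A r" and sym: "sym r" and tr: "trans r"
    using r by (auto simp: equiv_def)
  show "equiv ?I (r \<inter> ?I \<times> ?I)"
  proof (rule equivI)
    show "refl_on ?I (r \<inter> ?I \<times> ?I)" using refl I by (auto simp: refl_on_def)
    show "sym (r \<inter> ?I \<times> ?I)" using sym by (auto simp: sym_def)
    show "trans (r \<inter> ?I \<times> ?I)" by (rule transI) (auto dest: transD[OF tr] simp del: Union_iff)
  qed auto
  have img: "(r \<inter> ?I \<times> ?I) `` {x} = r `` {x}" if "x \<in> ?I" for x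
    using sat[OF _ that] that by (auto simp del: Union_iff)
  show "?I // (r \<inter> ?I \<times> ?I) = C"
  proof
    show "?I // (r \<inter> ?I \<times> ?I) \<subseteq> C"
    proof
      fix c assume "c \<in> ?I // (r \<inter> ?I \<times> ?I)"
      then obtain x where "x \<in> ?I" "c = (r \<inter> ?I \<times> ?I) `` {x}" by (rule quotientE)
      then show "c \<in> C" using img cls by simp
    qed
    show "C \<subseteq> ?I // (r \<inter> ?I \<times> ?I)"
    proof
      fix c assume c: "c \<in> C"
      then have cq: "c \<in> A // r" using C by (rule subsetD[rotated])
      then obtain x where x: "x \<in> c" using in_quotient_imp_non_empty[OF r cq] by (meson ex_in_conv)
      then have xI: "x \<in> ?I" using c by (rule UnionI[rotated])
      have "c = (r \<inter> ?I \<times> ?I) `` {x}"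
        unfolding img[OF xI] by (rule equiv_quotient_class(1)[OF r cq x])
      then show "c \<in> ?I // (r \<inter> ?I \<times> ?I)" using quotientI[OF xI] by simp
    qed
  qed
  show "A - ?I = \<Union>(A // r - C)"
  proof
    show "A - ?I \<subseteq> \<Union>(A // r - C)" using Union_quotient[OF r] by auto
    show "\<Union>(A // r - C) \<subseteq> A - ?I"
    proof
      fix x assume "x \<in> \<Union>(A // r - C)"
      then obtain c where c: "c \<in> A // r" "c \<notin> C" "x \<in> c" by blast
      note eq = equiv_quotient_class[OF r c(1,3)]
      have "x \<notin> ?I" using cls[of x] c(2) unfolding eq(1)[symmetric] by (rule contrapos_nn[rotated])
      then show "x \<in> A - ?I" using eq(2) by simp
    qed
  qed
  have "x \<in> ?I \<longleftrightarrow> y \<in> ?I" if "(x, y) \<in> r" for x y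
    using sat[OF that] sat[OF symD[OF sym that]] by (rule iffI)
  then show "r = (r \<inter> ?I \<times> ?I) \<union> (r \<inter> (A - ?I) \<times> (A - ?I))"
    using rA by (auto simp del: Union_iff)
qed

lemma equiv_disjoint_union:
  assumes "equiv A r" "equiv B s" "A \<inter> B = {}"
  shows "equiv (A \<union> B) (r \<union> s)" and "(A \<union> B) // (r \<union> s) = A // r \<union> B // s"
    and "A // r \<inter> B // s = {}" and "(r \<union> s) \<inter> A \<times> A = r" and "(r \<union> s) \<inter> B \<times> B = s"
proof -
  have r: "r \<subseteq> A \<times> A" "refl_on A r" "sym r" "trans r"
    and s: "s \<subseteq> B \<times> B" "refl_on B s" "sym s" "trans s"
    using assms by (simp_all add: equiv_def)
  have in_A: "x \<in> A \<and> y \<in> A \<and> x \<notin> B \<and> y \<notin> B" if "(x, y) \<in> r" for x y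
    using that r(1) assms(3) by auto
  have in_B: "x \<in> B \<and> y \<in> B \<and> x \<notin> A \<and> y \<notin> A" if "(x, y) \<in> s" for x y
    using that s(1) assms(3) by auto
  show "equiv (A \<union> B) (r \<union> s)"
  proof (rule equivI)
    show "r \<union> s \<subseteq> (A \<union> B) \<times> (A \<union> B)" using in_A in_B by auto
    show "refl_on (A \<union> B) (r \<union> s)" using r(2) s(2) by (auto simp: refl_on_def)
    show "sym (r \<union> s)" using r(3) s(3) by (rule sym_Un)
    show "trans (r \<union> s)"
    proof (rule transI)
      fix x y z assume "(x, y) \<in> r \<union> s" "(y, z) \<in> r \<union> s"
      then consider "(x, y) \<in> r" "(y, z) \<in> r" | "(x, y) \<in> s" "(y, z) \<in> s"
        using in_A in_B by (metis UnE)
      then show "(x, z) \<in> r \<union> s" using transD[OF r(4)] transD[OF s(4)] by cases auto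
    qed
  qed
  have "(r \<union> s) `` {x} = r `` {x}" if "x \<in> A" for x using that in_A in_B by auto
  moreover have "(r \<union> s) `` {x} = s `` {x}" if "x \<in> B" for x using that in_A in_B by auto
  ultimately have "(\<lambda>x. (r \<union> s) `` {x}) ` A = (\<lambda>x. r `` {x}) ` A"
    "(\<lambda>x. (r \<union> s) `` {x}) ` B = (\<lambda>x. s `` {x}) ` B" by (auto cong: image_cong)
  then show "(A \<union> B) // (r \<union> s) = A // r \<union> B // s"
    by (simp add: quotient_def UNION_singleton_eq_range image_Un)
  have "c \<notin> B // s" if "c \<in> A // r" for c
    using in_quotient_imp_subset[OF assms(1) that] in_quotient_imp_non_empty[OF assms(1) that]
      in_quotient_imp_subset[OF assms(2), of c] assms(3) by auto
  then show "A // r \<inter> B // s = {}" by auto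
  show "(r \<union> s) \<inter> A \<times> A = r" "(r \<union> s) \<inter> B \<times> B = s" using in_A in_B by auto
qed

abbreviation adjacency :: "('v, 'd) dgraph \<Rightarrow> ('v \<times> 'v) set"
  where "adjacency G \<equiv> {(a, b). {a, b} \<in> edges G}"

definition components :: "('v, 'd) dgraph \<Rightarrow> ('v \<times> 'v) set"
  where "components G = (adjacency G)\<^sup>* \<inter> verts G \<times> verts G"

lemma sym_adjacency: "sym ((adjacency G)\<^sup>*)"
  by (rule sym_rtrancl) (auto simp: sym_def insert_commute)

lemma equiv_components: "equiv (verts G) (components G)"
proof (rule equivI)
  show "components G \<subseteq> verts G \<times> verts G" by (auto simp: components_def)
  show "refl_on (verts G) (components G)" by (auto simp: components_def refl_on_def)
  show "sym (components G)" using sym_adjacency[of G] by (auto simp: components_def sym_def)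
  show "trans (components G)" by (auto simp: components_def trans_def intro: rtrancl_trans)
qed

lemma edge_in_components: "wf_graph G \<Longrightarrow> {x, y} \<in> edges G \<Longrightarrow> (x, y) \<in> components G"
  by (auto simp: components_def dest: wf_graph_edge)

lemma components_connected:
  assumes "wf_graph G"
  shows "components G \<in> connected_equivs G"
proof -
  have "connected_graph (induced G c)" if c: "c \<in> verts G // components G" for c
  proof -
    have cls: "c = components G `` {x}" if "x \<in> c" for x
      using equiv_quotient_class(1)[OF equiv_components c that] .
    have "y \<in> c \<and> (x, y) \<in> (adjacency (induced G c))\<^sup>*"
      if "(x, y) \<in> (adjacency G)\<^sup>*" "x \<in> c" for x y
      using that
    proof (induction rule: rtrancl_induct)
      case (step y z)
      then have y: "y \<in> c" "(x, y) \<in> (adjacency (induced G c))\<^sup>*" and yz: "{y, z} \<in> edges G"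
        by simp_all
      have "z \<in> c" using cls[OF y(1)] edge_in_components[OF assms yz] by simp
      moreover from this y yz have "(y, z) \<in> adjacency (induced G c)" by simp
      ultimately show ?case using rtrancl_into_rtrancl[OF y(2)] by simp
    qed simp
    moreover have "(x, y) \<in> (adjacency G)\<^sup>*" if "x \<in> c" "y \<in> c" for x y
    proof -
      have "y \<in> components G `` {x}" using cls[OF that(1)] that(2) by simp
      then show ?thesis by (simp add: components_def)
    qed
    ultimately have "\<forall>x\<in>c. \<forall>y\<in>c. (x, y) \<in> (adjacency (induced G c))\<^sup>*" by metis
    then show ?thesis
      using in_quotient_imp_non_empty[OF equiv_components c]
      unfolding connected_graph_def induced_simps(1) by blast
  qed
  then show ?thesis using equiv_components by (auto simp: connected_equivs_def)
qed

text \<open>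
  A relation with connected classes is contained in the component relation; it is all of it as
  soon as both endpoints of every edge are related.
\<close>

lemma connected_equiv_eq_components:
  assumes r: "r \<in> connected_equivs G" and edges: "\<And>x y. {x, y} \<in> edges G \<Longrightarrow> (x, y) \<in> r"
  shows "r = components G"
proof
  have eq: "equiv (verts G) r" using r by (simp add: connected_equivs_def)
  show "r \<subseteq> components G"
  proof
    fix p assume p: "p \<in> r"
    obtain x y where xy: "p = (x, y)" by (cases p)
    have V: "x \<in> verts G" "y \<in> verts G" using eq p xy by (auto simp: equiv_def)
    let ?c = "r `` {x}"
    have "?c \<in> verts G // r" using V(1) by (rule quotientI)
    then have "connected_graph (induced G ?c)" using r by (simp add: connected_equivs_def)
    moreover have "x \<in> ?c" "y \<in> ?c" using p xy eq V by (auto simp: equiv_def refl_on_def)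
    ultimately have "(x, y) \<in> (adjacency (induced G ?c))\<^sup>*" unfolding connected_graph_def by simp
    moreover have "adjacency (induced G ?c) \<subseteq> adjacency G" by auto
    ultimately show "p \<in> components G" using xy V rtrancl_mono by (auto simp: components_def)
  qed
  show "components G \<subseteq> r"
  proof
    fix p assume "p \<in> components G"
    then obtain x y where xy: "p = (x, y)" "x \<in> verts G" "(x, y) \<in> (adjacency G)\<^sup>*"
      by (auto simp: components_def)
    from xy(3) have "(x, y) \<in> r"
    proof (induction rule: rtrancl_induct)
      case base
      show ?case using eq xy(2) by (auto simp: equiv_def refl_on_def)
    next
      case (step y z)
      then show ?case using edges eq by (auto simp: equiv_def dest: transD)
    qed
    then show "p \<in> r" using xy by simp
  qed
qed

lemma connected_equivs_union:
  assumes "s \<in> connected_equivs (induced G I)" "r \<in> connected_equivs (induced G (verts G - I))"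
    and I: "I \<subseteq> verts G"
  shows "s \<union> r \<in> connected_equivs G"
proof -
  have s: "equiv I s" and r: "equiv (verts G - I) r" using assms
    by (auto simp: connected_equivs_def)
  have V: "I \<union> (verts G - I) = verts G" using I by blast
  note u = equiv_disjoint_union[OF s r, unfolded V]
  have "connected_graph (induced G c)" if "c \<in> verts G // (s \<union> r)" for c
  proof -
    from that u(2) consider "c \<in> I // s" | "c \<in> (verts G - I) // r" by auto
    then show ?thesis
    proof cases
      case 1
      then have "connected_graph (induced (induced G I) c)" "c \<subseteq> I"
        using assms(1) in_quotient_imp_subset[OF s] by (auto simp: connected_equivs_def)
      then show ?thesis by (simp add: induced_induced)
    next
      case 2
      then have "connected_graph (induced (induced G (verts G - I)) c)" "c \<subseteq> verts G - I"
        using assms(2) in_quotient_imp_subset[OF r] by (auto simp: connected_equivs_def)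
      then show ?thesis by (simp add: induced_induced)
    qed
  qed
  then show ?thesis using u(1) by (auto simp: connected_equivs_def)
qed

lemma connected_equivs_restrict:
  assumes r: "r \<in> connected_equivs G" and C: "C \<subseteq> verts G // r"
  shows "r \<inter> \<Union>C \<times> \<Union>C \<in> connected_equivs (induced G (\<Union>C))"
proof -
  have eq: "equiv (verts G) r" using r by (simp add: connected_equivs_def)
  have "connected_graph (induced (induced G (\<Union>C)) c)" if "c \<in> C" for c
    using that r C by (subst induced_induced) (auto simp: connected_equivs_def)
  then show ?thesis
    using restrict_saturated(1,2)[OF eq C] by (simp add: connected_equivs_def)
qed

lemma quotient_graph_edgeI:
  assumes "c \<in> verts G // r" "d \<in> verts G // r" "c \<noteq> d" "x \<in> c" "y \<in> d" "{x, y} \<in> edges G"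
  shows "{c, d} \<in> edges (quotient_graph G r)"
  unfolding quotient_graph_def dgraph.simps
  by (rule CollectI, rule exI[of _ c], rule exI[of _ d]) (use assms in simp, blast)

lemma quotient_graph_edgeE:
  assumes "e \<in> edges (quotient_graph G r)"
  obtains c d x y where "e = {c, d}" "c \<in> verts G // r" "d \<in> verts G // r" "c \<noteq> d"
    "x \<in> c" "y \<in> d" "{x, y} \<in> edges G"
proof -
  from assms obtain c d where "e = {c, d}" "c \<in> verts G // r" "d \<in> verts G // r" "c \<noteq> d"
    "\<exists>x\<in>c. \<exists>y\<in>d. {x, y} \<in> edges G"
    unfolding quotient_graph_def dgraph.simps mem_Collect_eq by (elim exE conjE)
  then show thesis using that by (elim bexE)
qed

text \<open>
  A set of classes is stable in the contraction when each edge inside its union stays inside a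
  class.
\<close>

lemma stable_quotient_edges:
  assumes wf: "wf_graph G" and r: "equiv (verts G) r" and C: "C \<subseteq> verts G // r"
  shows "(\<forall>e\<in>edges (quotient_graph G r). \<not> e \<subseteq> C) \<longleftrightarrow>
    (\<forall>x y. {x, y} \<in> edges G \<and> {x, y} \<subseteq> \<Union>C \<longrightarrow> (x, y) \<in> r)"
proof
  assume stable: "\<forall>e\<in>edges (quotient_graph G r). \<not> e \<subseteq> C"
  show "\<forall>x y. {x, y} \<in> edges G \<and> {x, y} \<subseteq> \<Union>C \<longrightarrow> (x, y) \<in> r"
  proof (intro allI impI)
    fix x y assume xy: "{x, y} \<in> edges G \<and> {x, y} \<subseteq> \<Union>C"
    then obtain c d where cd: "c \<in> C" "d \<in> C" "x \<in> c" "y \<in> d" by auto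
    have "c = d"
    proof (rule ccontr)
      assume "c \<noteq> d"
      then have "{c, d} \<in> edges (quotient_graph G r)"
        by (rule quotient_graph_edgeI[OF subsetD[OF C cd(1)] subsetD[OF C cd(2)]
            _ cd(3,4) conjunct1[OF xy]])
      then show False using stable cd by auto
    qed
    then have "d = r `` {x}" using equiv_quotient_class(1)[OF r subsetD[OF C cd(1)] cd(3)] by simp
    then show "(x, y) \<in> r" using cd(4) by simp
  qed
next
  assume R: "\<forall>x y. {x, y} \<in> edges G \<and> {x, y} \<subseteq> \<Union>C \<longrightarrow> (x, y) \<in> r"
  show "\<forall>e\<in>edges (quotient_graph G r). \<not> e \<subseteq> C"
  proof (intro ballI notI)
    fix e assume "e \<in> edges (quotient_graph G r)" "e \<subseteq> C"
    then obtain c d x y where *: "c \<in> verts G // r" "d \<in> verts G // r" "c \<noteq> d" "x \<in> c" "y \<in> d"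
      "{x, y} \<in> edges G" "c \<in> C" "d \<in> C" by (elim quotient_graph_edgeE) simp
    then have "{x, y} \<subseteq> \<Union>C" by auto
    then have "(x, y) \<in> r" using R *(6) by simp
    then have "y \<in> c" using equiv_quotient_class(1)[OF r *(1,4)] by auto
    then have "c = d" using equiv_quotient_class(1)[OF r *(1)]
        equiv_quotient_class(1)[OF r *(2,5)] by simp
    then show False using *(3) by simp
  qed
qed

lemma semigroup_sum_additive:
  fixes wt :: "'d::ab_semigroup_add \<Rightarrow> nat"
  assumes "\<forall>a b. wt (a + b) = wt a + wt b" "finite c" "c \<noteq> {}"
  shows "wt (semigroup_sum d c) = (\<Sum>x\<in>c. wt (d x))"
  using assms(2,3) by (induction c rule: finite_ne_induct) (simp_all add: semigroup_sum_insert assms(1))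

text \<open>
  Additivity of the weight is used here: a class of vertices then has the same weight whether it
  is seen as one vertex of the contraction or as a set of vertices of \<open>G\<close>.
\<close>

lemma set_weight_quotient:
  fixes wt :: "'d::ab_semigroup_add \<Rightarrow> nat"
  assumes add: "\<forall>a b. wt (a + b) = wt a + wt b" and wf: "wf_graph G"
    and r: "equiv (verts G) r" and C: "C \<subseteq> verts G // r"
  shows "set_weight wt (quotient_graph G r) C = set_weight wt G (\<Union>C)"
proof -
  have fin: "finite c" "c \<noteq> {}" if c: "c \<in> C" for c
  proof -
    have "c \<in> verts G // r" using C c by (rule subsetD)
    then have "c \<subseteq> verts G" and "c \<noteq> {}"
      using in_quotient_imp_subset[OF r] in_quotient_imp_non_empty[OF r] by simp_all
    then show "finite c" "c \<noteq> {}" using wf_graph_finite[OF wf] by (simp_all add: finite_subset)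
  qed
  have "set_weight wt (quotient_graph G r) C = (\<Sum>c\<in>C. \<Sum>x\<in>c. wt (dec G x))"
    unfolding set_weight_def
  proof (rule sum.cong[OF refl])
    fix c assume "c \<in> C"
    then show "wt (dec (quotient_graph G r) c) = (\<Sum>x\<in>c. wt (dec G x))"
      using semigroup_sum_additive[OF add fin] by (simp add: quotient_graph_def)
  qed
  also have "\<dots> = set_weight wt G (\<Union>C)"
  proof -
    have "c \<inter> d = {}" if "c \<in> C" "d \<in> C" "c \<noteq> d" for c d
      using quotient_disj[OF r subsetD[OF C that(1)] subsetD[OF C that(2)]] that(3) by simp
    then have "(\<Sum>x\<in>\<Union>C. wt (dec G x)) = (\<Sum>c\<in>C. \<Sum>x\<in>c. wt (dec G x))"
      using fin(1) by (subst sum.Union_disjoint) (simp_all add: comp_def)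
    then show ?thesis by (simp add: set_weight_def)
  qed
  finally show ?thesis .
qed

lemma induced_quotient_graph:
  assumes "(verts G - I) // s = D" "D \<subseteq> verts G // r"  "\<And>c. c \<in> D \<Longrightarrow> c \<subseteq> verts G - I"
  shows "induced (quotient_graph G r) D = quotient_graph (induced G (verts G - I)) s"
proof (rule dgraph.equality)
  show "edges (induced (quotient_graph G r) D) = edges (quotient_graph (induced G (verts G - I)) s)"
    (is "?L = ?R")
  proof (intro equalityI subsetI)
    fix e assume "e \<in> ?L"
    then have "e \<in> edges (quotient_graph G r)" "e \<subseteq> D" by simp_all
    then obtain c d x y where e: "e = {c, d}" "c \<noteq> d" "x \<in> c" "y \<in> d" "{x, y} \<in> edges G"
      "c \<in> D" "d \<in> D" by (elim quotient_graph_edgeE) simp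
    then have "{x, y} \<in> edges (induced G (verts G - I))"
      using assms(3)[OF e(6)] assms(3)[OF e(7)] by auto
    then show "e \<in> ?R"
      unfolding e(1) using e by (intro quotient_graph_edgeI) (simp_all add: assms(1))
  next
    fix e assume "e \<in> ?R"
    then obtain c d x y where e: "e
        = {c, d}" "c \<in> D" "d \<in> D" "c \<noteq> d" "x \<in> c" "y \<in> d" "{x, y} \<in> edges G"
      by (elim quotient_graph_edgeE) (simp add: assms(1))
    then have "e \<in> edges (quotient_graph G r)"
      unfolding e(1) using subsetD[OF assms(2) e(2)] subsetD[OF assms(2) e(3)]
      by (intro quotient_graph_edgeI)
    then show "e \<in> ?L" using e by simp
  qed
qed (use assms in \<open>simp_all add: quotient_graph_def\<close>)

text \<open>
  A stable set \<open>C\<close> of the contraction leaves no choice for the relation on \<open>I = \<Union>C\<close>: its classes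
  there are connected, and all edges inside \<open>I\<close> are inside classes, so they are the connected
  components. Hence \<open>r\<close> and \<open>C\<close> are recovered from \<open>I\<close> and the restriction of \<open>r\<close> to the
  complement of \<open>I\<close>.
\<close>

lemma connected_equiv_split:
  assumes wf: "wf_graph G" and r: "r \<in> connected_equivs G" and C: "C \<subseteq> verts G // r"
    and stable: "\<forall>e\<in>edges (quotient_graph G r). \<not> e \<subseteq> C"
  shows "r \<inter> (verts G - \<Union>C) \<times> (verts G - \<Union>C) \<in> connected_equivs (induced G (verts G - \<Union>C))"
    and "components (induced G (\<Union>C)) = r \<inter> \<Union>C \<times> \<Union>C"
    and "components (induced G (\<Union>C)) \<union> r \<inter> (verts G - \<Union>C) \<times> (verts G - \<Union>C) = r"
    and "\<Union>C // components (induced G (\<Union>C)) = C"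
proof -
  have eq: "equiv (verts G) r" using r by (simp add: connected_equivs_def)
  note R = restrict_saturated[OF eq C]
  show "r \<inter> (verts G - \<Union>C) \<times> (verts G - \<Union>C) \<in> connected_equivs (induced G (verts G - \<Union>C))"
    unfolding R(3) by (rule connected_equivs_restrict[OF r Diff_subset])
  have edges: "\<forall>x y. {x, y} \<in> edges G \<and> {x, y} \<subseteq> \<Union>C \<longrightarrow> (x, y) \<in> r"
    using stable unfolding stable_quotient_edges[OF wf eq C] .
  have "r \<inter> \<Union>C \<times> \<Union>C = components (induced G (\<Union>C))"
    using connected_equivs_restrict[OF r C]
  proof (rule connected_equiv_eq_components)
    fix x y assume "{x, y} \<in> edges (induced G (\<Union>C))"
    then show "(x, y) \<in> r \<inter> \<Union>C \<times> \<Union>C" using edges by simp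
  qed
  then show c: "components (induced G (\<Union>C)) = r \<inter> \<Union>C \<times> \<Union>C" by simp
  show "components (induced G (\<Union>C)) \<union> r \<inter> (verts G - \<Union>C) \<times> (verts G - \<Union>C) = r"
    unfolding c using R(4) by (rule sym)
  show "\<Union>C // components (induced G (\<Union>C)) = C" unfolding c by (rule R(2))
qed

text \<open>
  The inverse construction: a set \<open>I\<close> of vertices and a connected relation \<open>s\<close> on its complement
  are glued by adding the connected components of \<open>I\<close>. The last four claims describe what remains
  of the contraction once the classes in \<open>I\<close> are removed, and show that the restricted graph
  falls apart into the graph on \<open>I\<close> and the restricted graph on the complement.
\<close>

lemma connected_equiv_join:
  assumes wf: "wf_graph G" and I: "I \<subseteq> verts G"
    and s: "s \<in> connected_equivs (induced G (verts G - I))"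
  defines "k \<equiv> components (induced G I)"
  shows "k \<union> s \<in> connected_equivs G" and "I // k \<subseteq> verts G // (k \<union> s)" and "\<Union>(I // k) = I"
    and "(k \<union> s) \<inter> (verts G - I) \<times> (verts G - I) = s"
    and "\<forall>e\<in>edges (quotient_graph G (k \<union> s)). \<not> e \<subseteq> I // k"
    and "induced (quotient_graph G (k \<union> s)) (verts G // (k \<union> s) - I // k) =
      quotient_graph (induced G (verts G - I)) s"
    and "induced (restrict_graph G (k \<union> s)) I = induced G I"
    and "induced (restrict_graph G (k \<union> s)) (verts G - I)
        = restrict_graph (induced G (verts G - I)) s"
    and "\<forall>e\<in>edges (restrict_graph G (k \<union> s)). e \<subseteq> I \<or> e \<subseteq> verts G - I"
proof -
  have wfI: "wf_graph (induced G I)" using wf I by (rule wf_induced)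
  have k: "k \<in> connected_equivs (induced G I)" unfolding k_def using wfI
    by (rule components_connected)
  have ek: "equiv I k" and es: "equiv (verts G - I) s" using k s
    by (auto simp: connected_equivs_def)
  have V: "I \<union> (verts G - I) = verts G" using I by blast
  have "I \<inter> (verts G - I) = {}" by blast
  note u = equiv_disjoint_union[OF ek es this, unfolded V]
  show "k \<union> s \<in> connected_equivs G" using connected_equivs_union[OF k s I] .
  show sub: "I // k \<subseteq> verts G // (k \<union> s)" using u(2) by blast
  show UI: "\<Union>(I // k) = I" using ek by (rule Union_quotient)
  show "(k \<union> s) \<inter> (verts G - I) \<times> (verts G - I) = s" by (rule u(5))
  have edge_k: "(x, y) \<in> k" if "{x, y} \<in> edges G" "{x, y} \<subseteq> I" for x y
    using edge_in_components[OF wfI, of x y] that by (simp add: k_def)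
  then show "\<forall>e\<in>edges (quotient_graph G (k \<union> s)). \<not> e \<subseteq> I // k"
    unfolding stable_quotient_edges[OF wf u(1) sub] UI by blast
  have D: "(verts G - I) // s = verts G // (k \<union> s) - I // k" using u(2,3) by blast
  show "induced (quotient_graph G (k \<union> s)) (verts G // (k \<union> s) - I // k) =
      quotient_graph (induced G (verts G - I)) s"
    using D in_quotient_imp_subset[OF es] by (intro induced_quotient_graph) auto
  have ksub: "k \<subseteq> I \<times> I" "s \<subseteq> (verts G - I) \<times> (verts G - I)" using ek es by (auto simp: equiv_def)
  show "induced (restrict_graph G (k \<union> s)) I = induced G I"
  proof (rule dgraph.equality)
    show "edges (induced (restrict_graph G (k \<union> s)) I) = edges (induced G I)"
    proof
      show "edges (induced G I) \<subseteq> edges (induced (restrict_graph G (k \<union> s)) I)"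
      proof
        fix e assume e: "e \<in> edges (induced G I)"
        obtain x y where "e = {x, y}" by (rule wf_graph_edgeE[OF wfI e])
        then have xy: "e = {x, y}" "{x, y} \<in> edges G" "{x, y} \<subseteq> I" using e by auto
        then show "e \<in> edges (induced (restrict_graph G (k \<union> s)) I)"
          using edge_k[OF xy(2,3)] by (auto simp: restrict_graph_def)
      qed
    qed (auto simp: restrict_graph_def)
  qed (simp_all add: restrict_graph_def)
  show "induced (restrict_graph G (k \<union> s)) (verts G - I)
      = restrict_graph (induced G (verts G - I)) s"
  proof (rule dgraph.equality)
    show "edges (induced (restrict_graph G (k \<union> s)) (verts G - I)) =
        edges (restrict_graph (induced G (verts G - I)) s)"
      using ksub by (auto simp: restrict_graph_def; blast)
  qed (simp_all add: restrict_graph_def)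
  show "\<forall>e\<in>edges (restrict_graph G (k \<union> s)). e \<subseteq> I \<or> e \<subseteq> verts G - I"
    using ksub by (auto simp: restrict_graph_def)
qed

section \<open>The block coproduct and the contraction coproduct\<close>

text \<open>
  The right-hand factor of \<open>M\<^sub>u\<close> in \<open>\<delta>(M\<^sub>c)\<close>.
\<close>

definition block_part :: "nat list \<Rightarrow> composition \<Rightarrow> (composition \<Rightarrow>\<^sub>0 rat)"
  where "block_part u c =
    (\<Sum>ws | ws \<in> factorizations (letters c) \<and> map sum_list ws = u.
        foldr qsym_mult (map qmon ws) (qmon []))"

lemma lookup_block_coproduct:
  assumes "0 \<notin> set u"
  shows "Poly_Mapping.lookup (block_coproduct c) (Composition u, d) =
    Poly_Mapping.lookup (block_part u c) d"
proof -
  let ?F = "factorizations (letters c)"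
  let ?p = "\<lambda>ws. Poly_Mapping.lookup (foldr qsym_mult (map qmon ws) (qmon [])) d"
  have "0 \<notin> set (map sum_list ws)" if "ws \<in> ?F" for ws
  proof
    assume "0 \<in> set (map sum_list ws)"
    then obtain w where w: "w \<in> set ws" "sum_list w = 0" by auto
    then have "w \<noteq> []" using that by (auto simp: factorizations_def)
    then have "0 \<in> set w" using w(2) by (cases w) auto
    then have "0 \<in> set (concat ws)" using w(1) by auto
    moreover have "concat ws = letters c" using that by (simp add: factorizations_def)
    ultimately have "0 \<in> set (letters c)" by (simp only:)
    then show False using letters_positive by simp
  qed
  then have "Poly_Mapping.lookup (block_coproduct c) (Composition u, d) =
      (\<Sum>ws\<in>?F. of_bool (map sum_list ws = u) * ?p ws)"
    unfolding block_coproduct_def lookup_sum lookup_tensor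
    by (intro sum.cong refl arg_cong2[where f = "(*)"])
       (simp add: qmon_def lookup_basis Composition_eq_iff assms)
  also have "\<dots> = Poly_Mapping.lookup (block_part u c) d"
    unfolding block_part_def lookup_sum
    using finite_factorizations by (simp add: Int_def)
  finally show ?thesis .
qed

lemma block_part_Nil: "block_part [] c = (if letters c = [] then qmon [] else 0)"
proof -
  have "{ws. ws \<in> factorizations (letters c) \<and> map sum_list ws = []} =
      (if letters c = [] then {[]} else {})"
    by (auto simp: factorizations_def)
  then show ?thesis by (simp add: block_part_def)
qed

text \<open>
  The sum is over the choices of the first block, whose letters add up to \<open>m\<close>; positivity of \<open>m\<close>
  guarantees that the block is nonempty.
\<close>

lemma block_part_Cons:
  assumes "0 < m"
  shows "block_part (m # u) c =
    (\<Sum>p | fst p @ snd p = letters c \<and> sum_list (fst p) = m.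
      qsym_mult (qmon (fst p)) (block_part u (Composition (snd p))))"
proof -
  let ?P = "{p. fst p @ snd p = letters c \<and> sum_list (fst p) = m}"
  let ?W = "\<lambda>b. {ws. ws \<in> factorizations b \<and> map sum_list ws = u}"
  let ?prod = "\<lambda>ws. foldr qsym_mult (map qmon ws) (qmon [])"
  let ?j = "\<lambda>ws. ((hd ws, concat (tl ws)), tl ws)"
  let ?i = "\<lambda>q. fst (fst q) # snd q"
  have fin: "finite ?P" by (rule finite_subset[OF _ finite_append_splits[of "letters c"]]) auto
  have "block_part (m # u) c =
      (\<Sum>q\<in>Sigma ?P (\<lambda>p. ?W (snd p)). qsym_mult (qmon (fst (fst q))) (?prod (snd q)))"
    unfolding block_part_def
  proof (rule sum.reindex_bij_witness[where i = ?i and j = ?j])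
    fix ws assume ws: "ws \<in> {ws. ws \<in> factorizations (letters c) \<and> map sum_list ws = m # u}"
    then obtain a vs where a: "ws = a # vs" by auto
    then show "?i (?j ws) = ws" by simp
    show "?j ws \<in> Sigma ?P (\<lambda>p. ?W (snd p))"
      using ws a by (auto simp: factorizations_def)
    show "qsym_mult (qmon (fst (fst (?j ws)))) (?prod (snd (?j ws))) = ?prod ws" using a by simp
  next
    fix q assume "q \<in> Sigma ?P (\<lambda>p. ?W (snd p))"
    then obtain a b ws where q: "q = ((a, b), ws)" "a @ b = letters c" "sum_list a = m"
      "concat ws = b" "[] \<notin> set ws" "map sum_list ws = u"
      by (auto simp: factorizations_def)
    then show "?j (?i q) = q" by simp
    have "a \<noteq> []" using q(3) assms by auto
    then show "?i q \<in> {ws. ws \<in> factorizations (letters c) \<and> map sum_list ws = m # u}"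
      using q by (auto simp: factorizations_def)
  qed
  also have "\<dots> = (\<Sum>p\<in>?P. \<Sum>ws\<in>?W (snd p). qsym_mult (qmon (fst p)) (?prod ws))"
    using fin finite_factorizations by (subst sum.Sigma) (auto simp: case_prod_beta)
  also have "\<dots> = (\<Sum>p\<in>?P. qsym_mult (qmon (fst p)) (block_part u (Composition (snd p))))"
  proof (rule sum.cong[OF refl])
    fix p assume "p \<in> ?P"
    then have "0 \<notin> set (snd p)" using letters_positive[of c]
      by (metis (mono_tags) UnI2 mem_Collect_eq set_append)
    then show "(\<Sum>ws\<in>?W (snd p). qsym_mult (qmon (fst p)) (?prod ws)) =
        qsym_mult (qmon (fst p)) (block_part u (Composition (snd p)))"
      by (simp add: block_part_def letters_Composition linear_map_sum[OF linear_qsym_mult(1)])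
  qed
  finally show ?thesis .
qed

text \<open>
  Splitting off the first block is done by the coproduct \<open>\<Delta>\<close>, whose behavior under \<open>F_chr\<close> is
  known.
\<close>

lemma block_part_deconcatenation:
  assumes "0 < m"
  shows "lin_ext (block_part (m # u)) x =
    lin_ext (\<lambda>(c, d). if composition_degree c = m then qsym_mult (basis c) (block_part u d) else 0)
      (lin_ext deconcatenation x)"
    (is "_ = lin_ext ?h _")
proof (rule linear_map_eqI[where x = x])
  show "linear_map (lin_ext (block_part (m # u)))" by (rule linear_lin_ext)
  show "linear_map (\<lambda>x. lin_ext ?h (lin_ext deconcatenation x))"
    by (rule linear_map_comp[OF linear_lin_ext linear_lin_ext])
  fix c :: composition
  have "lin_ext ?h (deconcatenation c) =
      (\<Sum>p | fst p @ snd p = letters c. lin_ext ?h (tensor (qmon (fst p)) (qmon (snd p))))"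
    unfolding deconcatenation_def linear_map_sum[OF linear_lin_ext] by (rule sum.cong) auto
  also have "\<dots> = (\<Sum>p | fst p @ snd p = letters c. if sum_list (fst p) = m
      then qsym_mult (qmon (fst p)) (block_part u (Composition (snd p))) else 0)"
  proof (rule sum.cong[OF refl])
    fix p assume p: "p \<in> {p. fst p @ snd p = letters c}"
    have "0 \<notin> set (fst p @ snd p)" using p letters_positive[of c] by simp
    then show "lin_ext ?h (tensor (qmon (fst p)) (qmon (snd p))) = (if sum_list (fst p) = m
        then qsym_mult (qmon (fst p)) (block_part u (Composition (snd p))) else 0)"
      by (simp add: qmon_def tensor_basis composition_degree_def letters_Composition)
  qed
  also have "\<dots> = (\<Sum>p | fst p @ snd p = letters c \<and> sum_list (fst p) = m.
      qsym_mult (qmon (fst p)) (block_part u (Composition (snd p))))"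
    using finite_append_splits[of "letters c"]
    by (intro sum.mono_neutral_cong_right) (auto simp: case_prod_unfold)
  also have "\<dots> = block_part (m # u) c"
    unfolding block_part_Cons[OF assms] ..
  finally show "lin_ext (block_part (m # u)) (basis c)
      = lin_ext ?h (lin_ext deconcatenation (basis c))"
    by simp
qed

text \<open>
  For a homogeneous left factor, the projection to degree \<open>m\<close> keeps everything or nothing.
\<close>

lemma lin_ext_graded_tensor:
  assumes "\<And>c. c \<in> Poly_Mapping.keys y \<Longrightarrow> composition_degree c = k"
  shows "lin_ext (\<lambda>(c, d). if composition_degree c
      = m then qsym_mult (basis c) (g d) else 0) (tensor y z) =
    (if k = m then qsym_mult y (lin_ext g z) else 0)"
proof -
  have "lin_ext (\<lambda>d. qsym_mult (basis c) (g d)) z = qsym_mult (basis c) (lin_ext g z)" for c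
  proof (rule linear_map_eqI[where g = "\<lambda>z. qsym_mult (basis c) (lin_ext g z)"])
    show "linear_map (\<lambda>z. qsym_mult (basis c) (lin_ext g z))"
      by (rule linear_map_comp[OF linear_qsym_mult(1) linear_lin_ext])
  qed (simp_all add: linear_lin_ext)
  moreover have "lin_ext (\<lambda>c. qsym_mult (basis c) w) y = qsym_mult y w" for w
    by (rule linear_map_eqI[where g = "\<lambda>y. qsym_mult y w"])
       (simp_all add: linear_lin_ext linear_qsym_mult(2))
  moreover have "lin_ext (\<lambda>c. lin_ext (\<lambda>d. if composition_degree c
      = m then qsym_mult (basis c) (g d) else 0) z) y =
      lin_ext (\<lambda>c. lin_ext (\<lambda>d. if k = m then qsym_mult (basis c) (g d) else 0) z) y"
    unfolding lin_ext_def[of _ y] using assms by (intro sum.cong refl) simp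
  ultimately show ?thesis
    unfolding lin_ext_tensor by (cases "k = m") (simp_all add: lin_ext_zero)
qed

text \<open>
  By \<open>F_chr_split\<close>, the coproduct \<open>\<Delta>\<close> of \<open>F_chr(G)\<close> is the sum of
  \<open>F_chr(G\<^bsub>|I\<^esub>) \<otimes> F_chr(G\<^bsub>|V - I\<^esub>)\<close>, and the left factors are homogeneous of degree \<open>wt(I)\<close>; so
  \<open>I\<close> is the set of vertices that contribute to the first block.
\<close>

lemma block_part_chromatic:
  assumes wt: "\<forall>d. wt d > 0" and wf: "wf_graph G" and m: "0 < m"
  shows "lin_ext (block_part (m # u)) (chromatic wt G) =
    (\<Sum>I | I \<subseteq> verts G \<and> set_weight wt G I = m.
      qsym_mult (chromatic wt (induced G I)) (lin_ext (block_part u)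
          (chromatic wt (induced G (verts G - I)))))"
proof -
  have sub: "wf_graph (induced G I)" if "I \<subseteq> verts G" for I using wf that by (rule wf_induced)
  have "lin_ext (block_part (m # u)) (chromatic wt G) = (\<Sum>I\<in>Pow (verts G).
      if set_weight wt G I = m then qsym_mult (chromatic wt (induced G I))
        (lin_ext (block_part u) (chromatic wt (induced G (verts G - I)))) else 0)"
    unfolding block_part_deconcatenation[OF m] F_chr_split[OF wt wf] tensor_map_split
      linear_map_sum[OF linear_lin_ext]
  proof (rule sum.cong[OF refl])
    fix I assume "I \<in> Pow (verts G)"
    then have I: "wf_graph (induced G I)" "wf_graph (induced G (verts G - I))" using sub by auto
    show "lin_ext (\<lambda>(c, d). if composition_degree c
        = m then qsym_mult (basis c) (block_part u d) else 0)
        (tensor (F_chr wt (basis (iclass (induced G I))))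
            (F_chr wt (basis (iclass (induced G (verts G - I)))))) =
      (if set_weight wt G I = m then qsym_mult (chromatic wt (induced G I))
        (lin_ext (block_part u) (chromatic wt (induced G (verts G - I)))) else 0)"
      unfolding F_chr_iclass[OF I(1)] F_chr_iclass[OF I(2)]
      using keys_chromatic_degree[OF wt I(1)] by (intro lin_ext_graded_tensor) simp
  qed
  also have "\<dots> = (\<Sum>I | I \<subseteq> verts G \<and> set_weight wt G I = m.
      qsym_mult (chromatic wt (induced G I)) (lin_ext (block_part u)
          (chromatic wt (induced G (verts G - I)))))"
    using wf_graph_finite[OF wf] by (intro sum.mono_neutral_cong_right) auto
  finally show ?thesis .
qed

text \<open>
  The right-hand factor of \<open>M\<^sub>u\<close> in \<open>(F_chr \<otimes> F_chr)(\<delta>(G))\<close>.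
\<close>

definition contraction_part :: "('d::ab_semigroup_add \<Rightarrow> nat) \<Rightarrow> nat list \<Rightarrow> ('v, 'd) dgraph \<Rightarrow>
    (composition \<Rightarrow>\<^sub>0 rat)"
  where "contraction_part wt u G =
    (\<Sum>r\<in>connected_equivs G. scale (coloring_count wt u (quotient_graph G r))
        (chromatic wt (restrict_graph G r)))"

lemma finite_connected_equivs: "wf_graph G \<Longrightarrow> finite (connected_equivs G)"
  by (rule finite_subset[of _ "Pow (verts G \<times> verts G)"])
     (auto simp: connected_equivs_def equiv_def wf_graph_finite)

lemma contraction_part_Nil:
  fixes wt :: "'d::ab_semigroup_add \<Rightarrow> nat" and G :: "('v, 'd) dgraph"
  assumes "\<forall>d. wt d > 0" "wf_graph G"
  shows "contraction_part wt [] G = (if verts G = {} then qmon [] else 0)"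
proof (cases "verts G = {}")
  case True
  have "connected_equivs G = {{}}"
    using True by (auto simp: connected_equivs_def equiv_def)
  moreover have "chromatic wt (restrict_graph G {}) = qmon []"
    using True by (intro chromatic_empty wf_restrict_graph assms) (simp add: restrict_graph_def)
  ultimately show ?thesis
    using True by (simp add: contraction_part_def quotient_graph_def)
next
  case False
  then have "verts (quotient_graph G r) \<noteq> {}" for r by (simp add: quotient_graph_def)
  then show ?thesis using False by (simp add: contraction_part_def)
qed

text \<open>
  The left side sums over pairs \<open>(r, C)\<close>, where \<open>C\<close> is the first color class of a coloring of the
  contraction by \<open>r\<close>; such pairs correspond to pairs \<open>(I, s)\<close> with \<open>I = \<Union>C\<close> and \<open>s\<close> the
  restriction of \<open>r\<close> to the complement. The restricted graph is the disjoint union of the graph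
  on \<open>I\<close> and the graph on the complement restricted along \<open>s\<close>, which accounts for the product.
\<close>

lemma contraction_part_Cons:
  fixes wt :: "'d::ab_semigroup_add \<Rightarrow> nat" and G :: "('v, 'd) dgraph"
  assumes wt: "\<forall>d. wt d > 0" and add: "\<forall>a b. wt (a + b) = wt a + wt b" and wf: "wf_graph G"
  shows "contraction_part wt (m # u) G =
    (\<Sum>I | I \<subseteq> verts G \<and> set_weight wt G I = m.
      qsym_mult (chromatic wt (induced G I)) (contraction_part wt u (induced G (verts G - I))))"
proof -
  let ?V = "verts G" and ?Q = "quotient_graph G" and ?R = "restrict_graph G"
  let ?t = "\<lambda>r C. scale (coloring_count wt u (induced (?Q r) (?V // r - C))) (chromatic wt (?R r))"
  let ?s = "\<lambda>I s. qsym_mult (chromatic wt (induced G I))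
    (scale (coloring_count wt u (quotient_graph (induced G (?V - I)) s))
        (chromatic wt (restrict_graph (induced G (?V - I)) s)))"
  let ?A = "{I. I \<subseteq> ?V \<and> set_weight wt G I = m}"
  let ?join = "\<lambda>(I, s). (components (induced G I) \<union> s, I // components (induced G I))"
  let ?split = "\<lambda>(r, C). (\<Union>C, r \<inter> (?V - \<Union>C) \<times> (?V - \<Union>C))"
  have fin: "finite ?V" using wf by (rule wf_graph_finite)
  have wfI: "wf_graph (induced G I)" if "I \<subseteq> ?V" for I using wf that by (rule wf_induced)
  have eq: "equiv ?V r" if "r \<in> connected_equivs G" for r using that
    by (simp add: connected_equivs_def)
  have vQ: "verts (?Q r) = ?V // r" for r by (simp add: quotient_graph_def)
  \<comment> \<open>The bijection does not change the summand.\<close>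
  have term_eq: "?t (components (induced G I) \<union> s) (I // components (induced G I)) = ?s I s"
    if I: "I \<subseteq> ?V" and s: "s \<in> connected_equivs (induced G (?V - I))" for I s
  proof -
    note J = connected_equiv_join[OF wf I s]
    let ?r = "components (induced G I) \<union> s"
    have wR: "wf_graph (?R ?r)" using wf by (rule wf_restrict_graph)
    have w1: "wf_graph (induced G I)" using I by (rule wfI)
    have w2: "wf_graph (restrict_graph (induced G (?V - I)) s)"
      by (intro wf_restrict_graph wfI) auto
    have "chromatic wt (?R ?r) = qsym_mult (chromatic wt (induced G I))
        (chromatic wt (restrict_graph (induced G (?V - I)) s))"
    proof (rule qsym_eqI)
      fix v
      have "coloring_count wt v (?R ?r) = convolution (\<lambda>u. coloring_count wt u (induced (?R ?r) I))
          (\<lambda>v. coloring_count wt v (induced (?R ?r) (?V - I))) v"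
        using wR
      proof (rule coloring_count_separated)
        show "verts (?R ?r) = I \<union> (?V - I)" using I by (auto simp: restrict_graph_def)
        show "\<forall>e\<in>edges (?R ?r). e \<subseteq> I \<or> e \<subseteq> ?V - I" by (rule J(9))
      qed auto
      then show "monomial_coeff (chromatic wt (?R ?r)) v = monomial_coeff
          (qsym_mult (chromatic wt (induced G I))
              (chromatic wt (restrict_graph (induced G (?V - I)) s))) v"
        unfolding J(7,8) monomial_coeff_qsym_mult
        by (simp only: monomial_coeff_chromatic[OF wt wR]
            monomial_coeff_chromatic[OF wt w1, abs_def]
          monomial_coeff_chromatic[OF wt w2, abs_def])
    qed
    then show ?thesis
      unfolding J(6) by (simp add: linear_map_scale[OF linear_qsym_mult(1)])
  qed
  have "contraction_part wt (m # u) G =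
      (\<Sum>r\<in>connected_equivs G. \<Sum>C\<in>stable_sets wt m (?Q r). ?t r C)"
    by (simp add: contraction_part_def free_vs.scale_sum_left vQ)
  also have "\<dots> = (\<Sum>(r, C)\<in>Sigma (connected_equivs G) (\<lambda>r. stable_sets wt m (?Q r)). ?t r C)"
    using finite_connected_equivs[OF wf] finite_stable_sets[OF wf_quotient_graph[OF wf eq]]
    by (intro sum.Sigma) auto
  also have "\<dots> = (\<Sum>(I, s)\<in>Sigma ?A (\<lambda>I. connected_equivs (induced G (?V - I))). ?s I s)"
  proof (rule sum.reindex_bij_witness[where i = ?join and j = ?split])
    fix q assume "q \<in> Sigma (connected_equivs G) (\<lambda>r. stable_sets wt m (?Q r))"
    then obtain r C where q: "q = (r, C)"
      and r: "r \<in> connected_equivs G" and C: "C \<in> stable_sets wt m (?Q r)"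
      by auto
    have sub: "C \<subseteq> ?V // r" and stable: "\<forall>e\<in>edges (?Q r). \<not> e \<subseteq> C"
      and weight: "set_weight wt (?Q r) C = m" using C by (simp_all add: stable_sets_def vQ)
    note S = connected_equiv_split[OF wf r sub stable]
    have UV: "\<Union>C \<subseteq> ?V" using sub Union_quotient[OF eq[OF r]] by (metis Union_mono)
    show "?join (?split q) = q" by (simp add: q S(3,4))
    show "?split q \<in> Sigma ?A (\<lambda>I. connected_equivs (induced G (?V - I)))"
      using UV weight S(1) set_weight_quotient[OF add wf eq[OF r] sub] by (simp add: q)
    show "(case ?split q of (I, s) \<Rightarrow> ?s I s) = (case q of (r, C) \<Rightarrow> ?t r C)"
      using term_eq[OF UV S(1)] by (simp only: q S(3,4) prod.case)
  next
    fix q assume "q \<in> Sigma ?A (\<lambda>I. connected_equivs (induced G (?V - I)))"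
    then obtain I s where q: "q = (I, s)" and I: "I \<subseteq> ?V" "set_weight wt G I = m"
      and s: "s \<in> connected_equivs (induced G (?V - I))" by auto
    note J = connected_equiv_join[OF wf I(1) s]
    show "?split (?join q) = q" by (simp only: q prod.case J(3,4))
    show "?join q \<in> Sigma (connected_equivs G) (\<lambda>r. stable_sets wt m (?Q r))"
      using J(1,2,5) I(2) set_weight_quotient[OF add wf eq[OF J(1)] J(2)]
      by (simp add: q stable_sets_def vQ J(3))
  qed
  also have "\<dots> = (\<Sum>I\<in>?A. \<Sum>s\<in>connected_equivs (induced G (?V - I)). ?s I s)"
    using fin finite_connected_equivs[OF wfI] by (intro sum.Sigma[symmetric]) auto
  also have "\<dots> = (\<Sum>I\<in>?A. qsym_mult
      (chromatic wt (induced G I)) (contraction_part wt u (induced G (?V - I))))"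
    by (simp add: contraction_part_def linear_map_sum[OF linear_qsym_mult(1)])
  finally show ?thesis .
qed

text \<open>
  Both sides satisfy the same recursion along \<open>u\<close>.
\<close>

lemma block_part_eq_contraction_part:
  fixes wt :: "'d::ab_semigroup_add \<Rightarrow> nat" and G :: "('v, 'd) dgraph"
  assumes wt: "\<forall>d. wt d > 0" and add: "\<forall>a b. wt (a + b) = wt a + wt b" and "wf_graph G" "0 \<notin> set u"
  shows "lin_ext (block_part u) (chromatic wt G) = contraction_part wt u G"
  using assms(3,4)
proof (induction u arbitrary: G)
  case Nil
  have "lin_ext (block_part []) x = scale (monomial_coeff x []) (qmon [])" for x
  proof (rule linear_map_eqI[where x = x])
    show "linear_map (\<lambda>x. scale (monomial_coeff x []) (qmon []))"
      by (rule linear_mapI) (simp_all add: monomial_coeff_add monomial_coeff_scale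
          free_vs.scale_left_distrib)
  qed (auto simp: linear_lin_ext block_part_Nil monomial_coeff_basis packs_to_empty)
  then show ?case
    using Nil by (simp add: contraction_part_Nil[OF wt] monomial_coeff_chromatic[OF wt])
next
  case (Cons m u)
  have "wf_graph (induced G (verts G - I))" for I using Cons.prems(1) by (rule wf_induced) auto
  then show ?case
    using Cons by (simp add: block_part_chromatic[OF wt Cons.prems(1)]
        contraction_part_Cons[OF wt add Cons.prems(1)])
qed

section \<open>The chromatic morphism is a morphism for both coproducts\<close>

lemma lookup_block_coproduct_ext:
  assumes "0 \<notin> set u"
  shows "Poly_Mapping.lookup (lin_ext block_coproduct x) (Composition u, d) =
    Poly_Mapping.lookup (lin_ext (block_part u) x) d"
  unfolding lookup_lin_ext by (simp add: lookup_block_coproduct[OF assms])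

lemma lookup_tensor_map_contraction:
  fixes wt :: "'d::ab_semigroup_add \<Rightarrow> nat" and G :: "('v, 'd) dgraph"
  assumes wt: "\<forall>d. wt d > 0" and wf: "wf_graph G" and "0 \<notin> set u" "0 \<notin> set v"
  shows "Poly_Mapping.lookup (tensor_map (F_chr wt) (F_chr wt) (contraction_coproduct G))
    (Composition u, Composition v) =
    (\<Sum>r\<in>connected_equivs G. coloring_count wt u (quotient_graph G r)
        * coloring_count wt v (restrict_graph G r))"
  unfolding contraction_coproduct_def linear_map_sum[OF linear_tensor_map] lookup_sum
proof (rule sum.cong[OF refl])
  fix r assume "r \<in> connected_equivs G"
  then have Q: "wf_graph (quotient_graph G r)"
    using wf by (auto simp: connected_equivs_def intro: wf_quotient_graph)
  have R: "wf_graph (restrict_graph G r)" using wf by (rule wf_restrict_graph)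
  show "Poly_Mapping.lookup (tensor_map (F_chr wt) (F_chr wt)
      (basis (iclass (quotient_graph G r), iclass (restrict_graph G r))))
        (Composition u, Composition v) =
    coloring_count wt u (quotient_graph G r) * coloring_count wt v (restrict_graph G r)"
    using monomial_coeff_chromatic[OF wt Q, of u] monomial_coeff_chromatic[OF wt R, of v] assms(3,4)
    by (simp add: tensor_map_basis lookup_tensor F_chr_iclass Q R monomial_coeff_positive)
qed

lemma F_chr_contraction:
  fixes wt :: "'d::ab_semigroup_add \<Rightarrow> nat" and G :: "('v, 'd) dgraph"
  assumes wt: "\<forall>d. wt d > 0" and add: "\<forall>a b. wt (a + b) = wt a + wt b" and wf: "wf_graph G"
  shows "lin_ext block_coproduct (chromatic wt G) =
    tensor_map (F_chr wt) (F_chr wt) (contraction_coproduct G)"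
proof (rule qsym_tensor_eqI)
  fix u v :: "nat list" assume uv: "0 \<notin> set u" "0 \<notin> set v"
  have "Poly_Mapping.lookup (lin_ext block_coproduct (chromatic wt G))
    (Composition u, Composition v) =
      monomial_coeff (contraction_part wt u G) v"
    unfolding lookup_block_coproduct_ext[OF uv(1)] block_part_eq_contraction_part[OF wt add wf uv(1)]
    using uv(2) by (simp add: monomial_coeff_positive)
  also have "\<dots> = (\<Sum>r\<in>connected_equivs G. coloring_count wt u (quotient_graph G r) *
      coloring_count wt v (restrict_graph G r))"
    by (simp add: contraction_part_def monomial_coeff_sum monomial_coeff_scale
      monomial_coeff_chromatic[OF wt] wf_restrict_graph[OF wf])
  finally show "Poly_Mapping.lookup (lin_ext block_coproduct (chromatic wt G))
    (Composition u, Composition v) =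
      Poly_Mapping.lookup (tensor_map (F_chr wt) (F_chr wt) (contraction_coproduct G))
        (Composition u, Composition v)"
    unfolding lookup_tensor_map_contraction[OF wt wf uv] .
qed

lemma linear_F_chr: "linear_map (F_chr wt)"
  unfolding F_chr_def by (rule linear_lin_ext)

lemma F_chr_homogeneous:
  assumes wt: "\<forall>d. wt d > 0"
  shows "homogeneous_map (class_weight wt) composition_degree (F_chr wt)"
  unfolding homogeneous_map_def
proof (intro allI image_subsetI)
  fix n x assume x: "x \<in> homogeneous_component (class_weight wt) n"
  have "composition_degree c = n" if c: "c \<in> Poly_Mapping.keys (F_chr wt x)" for c
  proof -
    have "Poly_Mapping.lookup (F_chr wt x) c \<noteq> 0" using c by (simp add: in_keys_iff)
    then obtain g where g: "g \<in> Poly_Mapping.keys x" "Poly_Mapping.lookup (class_chromatic wt g) c \<noteq> 0"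
      unfolding F_chr_def lookup_lin_ext form_ext_def
      by (metis (no_types, lifting) mult_zero_right sum.neutral)
    obtain G :: "(nat, 'a) dgraph" where G: "wf_graph G" "g = iclass G" by (rule iso_graph_cases)
    have "c \<in> Poly_Mapping.keys (chromatic wt G)"
      using g(2) G by (simp add: class_chromatic_iclass in_keys_iff)
    then have "composition_degree c = class_weight wt g"
      using keys_chromatic_degree[OF wt G(1)] G by (simp add: iclass_weight)
    then show ?thesis using x g(1) by (simp add: homogeneous_component_def)
  qed
  then show "F_chr wt x \<in> homogeneous_component composition_degree n"
    by (simp add: homogeneous_component_def)
qed

lemma F_chr_mult:
  assumes wt: "\<forall>d. wt d > 0"
  shows "F_chr wt (bilin_ext (\<lambda>G H. basis (class_union G H)) x y)
      = qsym_mult (F_chr wt x) (F_chr wt y)"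
proof (induction x rule: basis_induct)
  case (basis g)
  show ?case
  proof (induction y rule: basis_induct)
    case (basis h)
    obtain G :: "(nat, 'a) dgraph" where G: "wf_graph G" "g = iclass G" by (rule iso_graph_cases)
    obtain H :: "(nat, 'a) dgraph" where H: "wf_graph H" "h = iclass H" by (rule iso_graph_cases)
    show ?case
      using G H by (simp add: class_union_iclass F_chr_iclass wf_disjoint_union
          chromatic_disjoint_union[OF wt])
  qed (simp_all add: linear_map_add[OF linear_bilin_ext_right]
      linear_map_scale[OF linear_bilin_ext_right]
      linear_map_add[OF linear_F_chr] linear_map_scale[OF linear_F_chr]
      linear_map_add[OF linear_qsym_mult(1)] linear_map_scale[OF linear_qsym_mult(1)])
qed (simp_all add: linear_map_add[OF linear_bilin_ext_left]
    linear_map_scale[OF linear_bilin_ext_left]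
    linear_map_add[OF linear_F_chr] linear_map_scale[OF linear_F_chr]
    linear_map_add[OF linear_qsym_mult(2)] linear_map_scale[OF linear_qsym_mult(2)])

lemma F_chr_unit:
  assumes wt: "\<forall>d. wt d > 0"
  shows "F_chr wt (basis (iclass (empty_graph :: (nat, 'd) dgraph))) = qmon []"
  unfolding F_chr_iclass[OF wf_empty_graph]
  by (rule chromatic_empty[OF wt wf_empty_graph]) (simp add: empty_graph_def)

lemma F_chr_counits:
  assumes wt: "\<forall>d. wt d > 0"
  shows "form_ext (\<lambda>u. if letters u = [] then 1 else 0) (F_chr wt x) =
      form_ext (\<lambda>G. if G = iclass (empty_graph :: (nat, 'd) dgraph) then 1 else 0) x" (is ?Delta)
    and "form_ext (\<lambda>u. if length (letters u) \<le> 1 then 1 else 0) (F_chr wt x) =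
      form_ext (\<lambda>G. if class_edgeless G then 1 else 0) x" (is ?delta)
proof -
  show ?Delta
  proof (induction x rule: basis_induct)
    case (basis g)
    obtain G :: "(nat, 'd) dgraph" where "wf_graph G" "g = iclass G" by (rule iso_graph_cases)
    then show ?case
      by (simp add: F_chr_iclass form_ext_basis form_ext_qsym_empty
          monomial_coeff_chromatic[OF wt] iclass_eq_empty_iff)
  qed (simp_all only: linear_map_add[OF linear_F_chr]
      linear_map_scale[OF linear_F_chr] form_ext_add form_ext_scale)
  show ?delta
  proof (induction x rule: basis_induct)
    case (basis g)
    obtain G :: "(nat, 'd) dgraph" where G: "wf_graph G" "g = iclass G" by (rule iso_graph_cases)
    show ?case
      unfolding G(2) F_chr_iclass[OF G(1)] F_chr_counit_delta[OF wt G(1)]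
      by (simp add: form_ext_basis class_edgeless_iclass[OF G(1)])
  qed (simp_all only: linear_map_add[OF linear_F_chr]
      linear_map_scale[OF linear_F_chr] form_ext_add form_ext_scale)
qed

lemma F_chr_Delta_morphism:
  assumes wt: "\<forall>d. wt d > 0"
  shows "bialgebra_morphism graph_Delta qsym_Delta (F_chr wt)"
proof -
  have "lin_ext deconcatenation (F_chr wt x)
      = tensor_map (F_chr wt) (F_chr wt) (lin_ext class_split x)" for x
  proof (rule linear_map_eqI[where f = "\<lambda>x. lin_ext deconcatenation (F_chr wt x)"
        and g = "\<lambda>x. tensor_map (F_chr wt) (F_chr wt) (lin_ext class_split x)"])
    show "linear_map (\<lambda>x. lin_ext deconcatenation (F_chr wt x))"
      by (rule linear_map_comp[OF linear_lin_ext linear_F_chr])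
    show "linear_map (\<lambda>x. tensor_map (F_chr wt) (F_chr wt) (lin_ext class_split x))"
      by (rule linear_map_comp[OF linear_tensor_map linear_lin_ext])
    fix g :: "'a iso_graph"
    obtain G :: "(nat, 'a) dgraph" where G: "wf_graph G" "g = iclass G" by (rule iso_graph_cases)
    then show "lin_ext deconcatenation (F_chr wt (basis g)) =
        tensor_map (F_chr wt) (F_chr wt) (lin_ext class_split (basis g))"
      by (simp add: F_chr_iclass class_split_iclass F_chr_split[OF wt])
  qed
  then show ?thesis
    unfolding bialgebra_morphism_def graph_Delta_def qsym_Delta_def
    using linear_F_chr F_chr_unit[OF wt] F_chr_mult[OF wt] F_chr_counits(1)[OF wt] by simp
qed

lemma F_chr_delta_morphism:
  fixes wt :: "'d::ab_semigroup_add \<Rightarrow> nat"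
  assumes wt: "\<forall>d. wt d > 0" and add: "\<forall>a b. wt (a + b) = wt a + wt b"
  shows "bialgebra_morphism graph_delta qsym_delta (F_chr wt)"
proof -
  have "lin_ext block_coproduct (F_chr wt x)
      = tensor_map (F_chr wt) (F_chr wt) (lin_ext class_contraction x)" for x
  proof (rule linear_map_eqI[where f = "\<lambda>x. lin_ext block_coproduct (F_chr wt x)"
        and g = "\<lambda>x. tensor_map (F_chr wt) (F_chr wt) (lin_ext class_contraction x)"])
    show "linear_map (\<lambda>x. lin_ext block_coproduct (F_chr wt x))"
      by (rule linear_map_comp[OF linear_lin_ext linear_F_chr])
    show "linear_map (\<lambda>x. tensor_map (F_chr wt) (F_chr wt) (lin_ext class_contraction x))"
      by (rule linear_map_comp[OF linear_tensor_map linear_lin_ext])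
    fix g :: "'d iso_graph"
    obtain G :: "(nat, 'd) dgraph" where G: "wf_graph G" "g = iclass G" by (rule iso_graph_cases)
    then show "lin_ext block_coproduct (F_chr wt (basis g)) =
        tensor_map (F_chr wt) (F_chr wt) (lin_ext class_contraction (basis g))"
      by (simp add: F_chr_iclass class_contraction_iclass F_chr_contraction[OF wt add])
  qed
  then show ?thesis
    unfolding bialgebra_morphism_def graph_delta_def qsym_delta_def
    using linear_F_chr F_chr_unit[OF wt] F_chr_mult[OF wt] F_chr_counits(2)[OF wt] by simp
qed

section \<open>Uniqueness and additivity of the weight\<close>

text \<open>
  The coefficient at \<open>(m, u\<^sub>1, \<dots>, u\<^sub>n)\<close> is read off from \<open>\<Delta>(\<Phi>(G))\<close> at \<open>M\<^sub>m \<otimes> M\<^sub>u\<close>. The left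
  factor is the coefficient of \<open>M\<^sub>m\<close>, which homogeneity and the counit of \<open>\<delta>\<close> determine: it
  selects the induced subgraphs of weight \<open>m\<close> without edges.
\<close>

lemma morphism_monomial_coeff:
  fixes \<Phi> :: "('d iso_graph \<Rightarrow>\<^sub>0 rat) \<Rightarrow> (composition \<Rightarrow>\<^sub>0 rat)" and G :: "('v, 'd) dgraph"
  assumes wt: "\<forall>d. wt d > 0"
    and hom: "homogeneous_map (class_weight wt) composition_degree \<Phi>"
    and counit_Delta: "\<forall>x. counit qsym_Delta (\<Phi> x) = counit graph_Delta x"
    and comult_Delta: "\<forall>x. comult qsym_Delta (\<Phi> x) = tensor_map \<Phi> \<Phi> (comult graph_Delta x)"
    and counit_delta: "\<forall>x. form_ext (\<lambda>u. if length (letters u) \<le> 1 then 1 else 0) (\<Phi> x) =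
      form_ext (\<lambda>G. if class_edgeless G then 1 else 0) x"
  assumes "wf_graph G" "0 \<notin> set u"
  shows "monomial_coeff (\<Phi> (basis (iclass G))) u = coloring_count wt u G"
  using assms(6,7)
proof (induction u arbitrary: G)
  case Nil
  have "monomial_coeff (\<Phi> (basis (iclass G))) [] = counit graph_Delta (basis (iclass G))"
    using counit_Delta by (simp add: qsym_Delta_def form_ext_qsym_empty)
  then show ?case
    using Nil.prems by (simp add: graph_Delta_def form_ext_basis iclass_eq_empty_iff)
next
  case (Cons m u)
  have m: "0 < m" and u: "0 \<notin> set u" using Cons.prems by auto
  \<comment> \<open>The linear functional that gives the coefficient at \<open>M\<^sub>m\<close> is the counit of \<open>\<delta>\<close> in degree \<open>m\<close>.\<close>
  have single: "monomial_coeff (\<Phi> (basis (iclass H))) [m] =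
      of_bool (edges H = {} \<and> set_weight wt H (verts H) = m)"
        if "wf_graph H" for H :: "('v, 'd) dgraph"
  proof -
    have "basis (iclass H) \<in> homogeneous_component (class_weight wt) (set_weight wt H (verts H))"
      using that by (simp add: homogeneous_component_def basis_def iclass_weight)
    then have h: "\<Phi> (basis (iclass H)) \<in>
        homogeneous_component composition_degree (set_weight wt H (verts H))"
      using hom by (auto simp: homogeneous_map_def)
    show ?thesis
    proof (cases "set_weight wt H (verts H) = m")
      case True
      have "monomial_coeff (\<Phi> (basis (iclass H))) [m] =
          form_ext (\<lambda>G. if class_edgeless G then 1 else 0) (basis (iclass H))"
        using form_ext_qsym_homogeneous[OF h[unfolded True] m] counit_delta by simp
      then show ?thesis using True that by (simp add: form_ext_basis class_edgeless_iclass)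
    next
      case False
      have "composition_degree (Composition [m]) = m"
        using m by (simp add: composition_degree_def letters_Composition)
      then have "Composition [m] \<notin> Poly_Mapping.keys (\<Phi> (basis (iclass H)))"
        using h False by (auto simp: homogeneous_component_def)
      then show ?thesis using m False by (simp add: monomial_coeff_positive in_keys_iff)
    qed
  qed
  have wf: "wf_graph (induced G I)" if "I \<subseteq> verts G" for I
    using Cons.prems(1) that by (rule wf_induced)
  have "monomial_coeff (\<Phi> (basis (iclass G))) (m # u) =
      Poly_Mapping.lookup (comult qsym_Delta (\<Phi> (basis (iclass G))))
        (Composition [m], Composition u)"
    using lookup_deconcatenation[of "[m]" u] m u by (simp add: qsym_Delta_def)
  also have "\<dots> = (\<Sum>I\<in>Pow (verts G). monomial_coeff (\<Phi> (basis (iclass (induced G I)))) [m] *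
      monomial_coeff (\<Phi> (basis (iclass (induced G (verts G - I))))) u)"
    using comult_Delta Cons.prems(1) m u
    by (simp add: graph_Delta_def class_split_iclass lookup_tensor_map_split monomial_coeff_positive)
  also have "\<dots> = (\<Sum>I\<in>Pow (verts G). of_bool (I \<in> stable_sets wt m G) *
      coloring_count wt u (induced G (verts G - I)))"
    using Cons.IH[OF wf u] by (intro sum.cong refl) (auto simp: single wf stable_sets_def)
  also have "\<dots> = coloring_count wt (m # u) G"
    using wf_graph_finite[OF Cons.prems(1)]
    by (auto simp: stable_sets_def intro!: sum.cong)
  finally show ?case .
qed

lemma double_bialgebra_morphism_unique:
  fixes wt :: "'d::ab_semigroup_add \<Rightarrow> nat"
  assumes wt: "\<forall>d. wt d > 0" and \<Phi>: "double_bialgebra_morphism wt \<Phi>"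
  shows "\<Phi> = F_chr wt"
proof
  fix x
  have hom: "homogeneous_map (class_weight wt) composition_degree \<Phi>"
    and Delta: "bialgebra_morphism graph_Delta qsym_Delta \<Phi>"
    and delta: "bialgebra_morphism graph_delta qsym_delta \<Phi>"
    using \<Phi> by (simp_all add: double_bialgebra_morphism_def)
  show "\<Phi> x = F_chr wt x"
  proof (rule linear_map_eqI[where f = \<Phi> and g = "F_chr wt"])
    show "linear_map \<Phi>" using Delta by (simp add: bialgebra_morphism_def)
    show "linear_map (F_chr wt)" by (rule linear_F_chr)
    fix g :: "'d iso_graph"
    obtain G :: "(nat, 'd) dgraph" where G: "wf_graph G" "g = iclass G" by (rule iso_graph_cases)
    show "\<Phi> (basis g) = F_chr wt (basis g)"
    proof (rule qsym_eqI)
      fix u :: "nat list" assume "0 \<notin> set u"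
      then have "monomial_coeff (\<Phi> (basis (iclass G))) u = coloring_count wt u G"
        using Delta delta G(1)
        by (intro morphism_monomial_coeff[OF wt hom])
           (simp_all add: bialgebra_morphism_def graph_delta_def qsym_delta_def)
      then show "monomial_coeff (\<Phi> (basis g)) u = monomial_coeff (F_chr wt (basis g)) u"
        by (simp add: G F_chr_iclass monomial_coeff_chromatic[OF wt G(1)])
    qed
  qed
qed

lemma qsym_mult_unit_right: "qsym_mult x (qmon []) = x"
proof (rule linear_map_eqI[where f = "\<lambda>x. qsym_mult x (qmon [])" and g = "\<lambda>x. x" and x = x])
  show "linear_map (\<lambda>x. qsym_mult x (qmon []))" by (rule linear_qsym_mult)
  show "linear_map (\<lambda>x :: composition \<Rightarrow>\<^sub>0 rat. x)" by (rule linear_mapI) simp_all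
  fix c :: composition
  have "quasi_shuffle (letters c) [] = {#letters c#}" by (cases "letters c") simp_all
  then show "qsym_mult (basis c) (qmon []) = basis c"
    by (simp add: qsym_mult_def qmon_def letters_Composition letters_inverse)
qed

text \<open>
  Let \<open>G\<close> be an edge with decorations \<open>a\<close>, \<open>b\<close>, and put \<open>m = wt(a) + wt(b)\<close>. The coefficient of
  \<open>M\<^sub>m \<otimes> M\<^bsub>(wt a, wt b)\<^esub>\<close> in \<open>\<delta>(F_chr(G))\<close> is the coefficient of \<open>M\<^bsub>(wt a, wt b)\<^esub>\<close> in \<open>F_chr(G)\<close>,
  which is positive. In \<open>(F_chr \<otimes> F_chr)(\<delta>(G))\<close>, a nonzero contribution requires a contraction of
  \<open>G\<close> that has no edges and weight \<open>m\<close>; this is the contraction to a single vertex with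
  decoration \<open>a + b\<close>.
\<close>

lemma delta_morphism_imp_additive:
  fixes wt :: "'d::ab_semigroup_add \<Rightarrow> nat"
  assumes wt: "\<forall>d. wt d > 0" and delta: "bialgebra_morphism graph_delta qsym_delta (F_chr wt)"
  shows "wt (a + b) = wt a + wt b"
proof -
  define G :: "(nat, 'd) dgraph"
    where "G = \<lparr>verts = {0, 1}, edges = {{0, 1}}, dec = (\<lambda>x. if x = 0 then a else b)\<rparr>"
  define m where "m = wt a + wt b"
  have G: "verts G = {0, 1}" "edges G = {{0, 1}}" "dec G 0 = a" "dec G (Suc 0) = b"
    by (simp_all add: G_def)
  have wf: "wf_graph G" by (simp add: wf_graph_def G)
  have pos: "0 < wt a" "0 < wt b" using wt by auto
  have m: "set_weight wt G (verts G) = m" by (simp add: set_weight_def G m_def)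
  \<comment> \<open>The first block of weight \<open>m\<close> exhausts \<open>G\<close>, as all weights are positive.\<close>
  have only: "{I. I \<subseteq> verts G \<and> set_weight wt G I = m} = {verts G}"
  proof -
    have "I = verts G" if "I \<subseteq> verts G" "set_weight wt G I = m" for I
    proof -
      have "set_weight wt G (I \<union> (verts G - I)) = set_weight wt G I + set_weight wt G (verts G - I)"
        using that(1) wf_graph_finite[OF wf] by (intro set_weight_union) (auto intro: finite_subset)
      moreover have "I \<union> (verts G - I) = verts G" using that(1) by auto
      ultimately have "set_weight wt G (verts G - I) = 0" using that(2) m by simp
      then have "verts G - I = {}"
        using set_weight_eq_0[OF wt, of "verts G - I" G] wf_graph_finite[OF wf] by simp
      then show ?thesis using that(1) by auto
    qed
    then show ?thesis using m by auto
  qed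
  have empty: "chromatic wt (induced G {}) = qmon []"
    by (intro chromatic_empty wt wf_induced wf) auto
  have "lin_ext (block_part [m]) (chromatic wt G) = chromatic wt G"
  proof -
    have "letters (Composition []) = []" by (simp add: letters_Composition)
    then have "lin_ext (block_part []) (qmon []) = qmon []" by (simp add: qmon_def block_part_Nil)
    moreover have "0 < m" using pos by (simp add: m_def)
    ultimately show ?thesis
      unfolding block_part_chromatic[OF wt wf \<open>0 < m\<close>] only
      by (simp add: empty induced_verts[OF wf] qsym_mult_unit_right)
  qed
  then have "coloring_count wt [wt a, wt b] G =
      Poly_Mapping.lookup (lin_ext block_coproduct (chromatic wt G))
        (Composition [m], Composition [wt a, wt b])"
    using pos monomial_coeff_chromatic[OF wt wf, of "[wt a, wt b]"]
    by (simp add: lookup_block_coproduct_ext m_def monomial_coeff_positive)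
  also have "\<dots> = Poly_Mapping.lookup (tensor_map (F_chr wt) (F_chr wt) (contraction_coproduct G))
      (Composition [m], Composition [wt a, wt b])"
  proof -
    have "comult qsym_delta (F_chr wt (basis (iclass G))) =
        tensor_map (F_chr wt) (F_chr wt) (comult graph_delta (basis (iclass G)))"
      using delta by (simp add: bialgebra_morphism_def)
    then show ?thesis
      by (simp add: qsym_delta_def graph_delta_def F_chr_iclass[OF wf] class_contraction_iclass[OF wf])
  qed
  also have "\<dots> = (\<Sum>r\<in>connected_equivs G. coloring_count wt [m] (quotient_graph G r) *
      coloring_count wt [wt a, wt b] (restrict_graph G r))"
    using pos by (intro lookup_tensor_map_contraction[OF wt wf]) (auto simp: m_def)
  finally have eq: "coloring_count wt [wt a, wt b] G = \<dots>" .
  have "coloring_count wt [wt a, wt b] G \<noteq> 0"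
  proof -
    have wfI: "wf_graph (induced G (verts G - I))" for I using wf by (rule wf_induced) auto
    have "coloring_count wt [wt b] (induced G (verts G - {0})) = 1"
      unfolding coloring_count_single[OF wfI] by (auto simp: G set_weight_def)
    moreover have "{0} \<in> stable_sets wt (wt a) G" by (simp add: stable_sets_def G set_weight_def)
    moreover have "0 \<le> coloring_count wt [wt b] (induced G (verts G - I))" for I
      unfolding coloring_count_single[OF wfI] by simp
    ultimately have "1 \<le> coloring_count wt [wt a, wt b] G"
      unfolding coloring_count.simps(2)[of wt "wt a"]
      using member_le_sum[of "{0}" "stable_sets wt (wt a) G"
          "\<lambda>I. coloring_count wt [wt b] (induced G (verts G - I))"]
        finite_stable_sets[OF wf] by auto
    then show ?thesis by auto
  qed
  then obtain r where r: "r \<in> connected_equivs G" and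
    "coloring_count wt [m] (quotient_graph G r)
        * coloring_count wt [wt a, wt b] (restrict_graph G r) \<noteq> 0"
    unfolding eq by (rule sum.not_neutral_contains_not_neutral)
  then have nz: "coloring_count wt [m] (quotient_graph G r) \<noteq> 0" by (metis mult_zero_left)
  have er: "equiv (verts G) r" using r by (simp add: connected_equivs_def)
  have vQ: "verts (quotient_graph G r) = verts G // r" by (simp add: quotient_graph_def)
  have Q: "edges (quotient_graph G r) = {}" "set_weight wt (quotient_graph G r) (verts G // r) = m"
    using nz unfolding coloring_count_single[OF wf_quotient_graph[OF wf er]] vQ by auto
  have "\<forall>x y. {x, y} \<in> edges G \<and> {x, y} \<subseteq> \<Union>(verts G // r) \<longrightarrow> (x, y) \<in> r"
    using stable_quotient_edges[OF wf er subset_refl] Q(1) by (simp only: ball_empty simp_thms)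
  then have "{0, 1} \<in> edges G \<and> {0, 1} \<subseteq> \<Union>(verts G // r) \<longrightarrow> (0, 1) \<in> r" by (elim allE)
  moreover have "{0, 1} \<in> edges G \<and> {0, 1} \<subseteq> \<Union>(verts G // r)"
    unfolding Union_quotient[OF er] by (simp add: G)
  ultimately have r01: "(0, 1) \<in> r" by (rule mp)
  \<comment> \<open>Since the endpoints of the edge are related, there is only one class.\<close>
  have "c = verts G" if c: "c \<in> verts G // r" for c
  proof -
    obtain x where "x \<in> c" using in_quotient_imp_non_empty[OF er c] by (meson ex_in_conv)
    moreover have sub: "c \<subseteq> {0, 1}" using in_quotient_imp_subset[OF er c] by (simp only: G)
    ultimately have "0 \<in> c \<or> 1 \<in> c" by (metis insertE singletonD subsetD)
    moreover have "(1, 0) \<in> r" using er r01 by (meson equivE symD)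
    ultimately have "0 \<in> c \<and> 1 \<in> c"
      using r01 equiv_quotient_class(1)[OF er c, of 0] equiv_quotient_class(1)[OF er c, of 1]
      by (metis Image_singleton_iff)
    then show ?thesis using sub unfolding G
      by (intro equalityI) (simp_all only: insert_subset simp_thms empty_subsetI)
  qed
  moreover have "verts G // r \<noteq> {}" by (simp add: G)
  ultimately have "verts G // r = {verts G}" by (metis singletonI subsetI subset_singletonD)
  then have "m = wt (semigroup_sum (dec G) {0, 1})"
    using Q(2) by (simp add: set_weight_def quotient_graph_def G)
  also have "semigroup_sum (dec G) {0, 1} = a + b"
    using semigroup_sum_insert[of "{1}" 0 "dec G"] by (simp add: G)
  finally show ?thesis by (simp add: m_def)
qed

theorem theorem3p6:
  fixes wt :: "'d::ab_semigroup_add \<Rightarrow> nat"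
  assumes "\<forall>d. wt d > 0"
  shows "((\<exists>\<Phi>. double_bialgebra_morphism wt \<Phi>) \<longleftrightarrow> (\<forall>a b. wt (a + b) = wt a + wt b)) \<and>
    ((\<forall>a b. wt (a + b) = wt a + wt b) \<longrightarrow>
      (\<forall>\<Phi>. double_bialgebra_morphism wt \<Phi> \<longleftrightarrow> \<Phi> = F_chr wt))"
proof -
  have exists: "double_bialgebra_morphism wt (F_chr wt)" if "\<forall>a b. wt (a + b) = wt a + wt b"
    using F_chr_homogeneous[OF assms] F_chr_Delta_morphism[OF assms] F_chr_delta_morphism[OF assms that]
    by (simp add: double_bialgebra_morphism_def)
  have additive: "\<forall>a b. wt (a + b) = wt a + wt b" if "double_bialgebra_morphism wt \<Phi>" for \<Phi>
    using that double_bialgebra_morphism_unique[OF assms that] delta_morphism_imp_additive[OF assms]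
    by (simp add: double_bialgebra_morphism_def)
  show ?thesis
    using exists additive double_bialgebra_morphism_unique[OF assms] by blast
qed

end
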